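(* Let $X$ be a smooth projective tropical space which is the tropical limit of a complex projective one-parameter degeneration, unimodularly triangulated. Let $\Delta$ be a finite sedentarity-$0$ simplex of $X$ of dimension $k$. Then for any $l\ge0$, any $c\in H_{2l}(\Delta)$ and any $0\le r\le k$, $$\phi\cap(c[-r])=c[-r-1],$$ where $\phi$ is the eigenwave (acting on chains) and $c[-k-1]:=0$.
   Context: **Setting.** $\mathbb T=[-\infty,\infty)$. A tropical space is a space with finitely many charts to balanced polyhedral complexes in $\mathbb T^N$ (finite unions of polyhedral domains cut out by inequalities $jx\le a$, $j\in\mathbb Z^N$, regular at infinity, i.e. each facet $D$ meets each $\mathbb T_I^\circ=\{y: y_i=-\infty\iff i\in I\}$ in the empty set or in a polyhedral domain of dimension $\dim D-|I|$), with integral affine overlap maps; balanced means that around each codimension one mobile face the primitive outward integer vectors of the adjacent facets sum to $0$ modulo the face. It is smooth if its charts go to products $\Sigma_M\times\mathbb T^s$ with $\Sigma_M$ the Bergman fan of a loopless matroid $M$ (union of the cones spanned by $e_{F_1},\dots,e_{F_k}$ over flags of flats, $e_F=\sum_{j\in F}e_j$, $\sum_{j\in M}e_j=0$, any $|M|-1$ of the $e_j$ a basis of $\mathbb Z^{|M|-1}$). It is projective if it sits in $\mathbb{TP}^N$ as a balanced polyhedral complex in each affine chart. It is the tropical limit of a family $\mathcal X\subset\mathbb{CP}^N\times\Delta^*$ over the punctured disc, meromorphic at $0$, if it is the limit as $t\to0$ of the images of the fibers under $[z_i]\mapsto[\log|z_i|/\log(1/|t|)]$, with multiplicities $1$. Unimodularly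 triangulated means: $X$ is a polyhedral complex whose finite cells are unimodular integral simplices and whose infinite cells are products of unimodular simplices with unimodular cones spanned by divisorial vectors. Faces with refined sedentarity $I$ are those lying in $\mathbb T_I$ generically; the divisorial vectors are the primitive vectors $-\mathbf e_i$ pointing towards the $-\infty$ strata; a face is finite if it is compact and contains no subface of higher sedentarity. **Coefficients and barycentric chains.** For a face $F$ of refined sedentarity $I$, $\mathcal F_p(F)\subset\Lambda^pT_{\mathbb Z}(F)$ is generated by the $p$-th exterior powers of the tangent lattices of the faces of $X$ of the same sedentarity containing $F$, inside the lattice $T_{\mathbb Z}(F)$ of the span of these faces (a quotient by the divisorial directions in $I$). For $F\subset F'$ there are natural maps $\iota:\mathcal F_p(F')\to\mathcal F_p(F)$ (inclusion composed with projection along divisorial directions). The first barycentric subdivision of $X$: the barycenter of a finite cell is an interior point; that of an infinite cell is the barycenter of its most sedentary (finite) subface; simplices correspond to flags of subfaces of minimal sedentarity. $C^{bar}_q(X;\mathcal F_p)$ is the simplicial chain complex of this subdivision with coefficients in $\mathcal F_p$ (here tensored with $\mathbb Q$ or $\mathbb R$), with boundary followed by $\iota$. **Propellers.** Let $\Delta$ be an oriented finite sedentarity-$0$ $k$-simplex. $\mathrm{Link}_l(\Delta)$ is the set of $\bar q=\{q_1,\dots,q_l\}$, each $q_i$ a vertex or a divisorial vector, such that the vertices of $\Delta$ and $\bar q$ span a face $\{\Delta\bar q\}$ of dimension $k+l$. $H_{2l}(\Delta)$ is the space of formal sums $c=\sum_{\bar q\in\mathrm{Link}_l(\Delta)}\rho_{\bar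 q}\{\Delta\bar q\}$, $\rho_{\bar q}\in\mathbb Q$, balanced along $\Delta$: for each $\bar r\in\mathrm{Link}_{l-1}(\Delta)$, $\sum_q\rho_{q\bar r}\overrightarrow{(\Delta q)}=0$ modulo the span of $\{\Delta\bar r\}$, where $\overrightarrow{(\Delta q)}$ is the divisorial vector $q$ or the vector from a vertex of $\Delta$ to the vertex $q$. **The chains $c[-r]$.** For a face $\Delta'$ of $\Delta$, the dual cell $\hat\Delta'_{\Delta\bar q}$ is the union (as a chain) of all $(k+l-\dim\Delta')$-simplices of the barycentric subdivision of $\{\Delta\bar q\}$ containing the barycenters of both $\Delta'$ and $\{\Delta\bar q\}$. $\mathrm{Vol}_{\Delta'\bar q}$ is the integral volume element of the face $\{\Delta'\bar q\}$. For $0\le r\le k$, $$c[-r]=\sum_{\bar q\in\mathrm{Link}_l(\Delta)}\ \sum_{\Delta'\prec\Delta,\ \dim\Delta'=r}(\rho_{\bar q}\,\mathrm{Vol}_{\Delta'\bar q})\,\hat\Delta'_{\Delta\bar q}\in C^{bar}_{k+l-r}(X;\mathcal F_{l+r}).$$ Orientations: order $\bar q$ and orient $\Delta'$; $\mathrm{Vol}_{\Delta'\bar q}$ is positive for $\mathrm{or}(\Delta')\wedge\bar q$, and $\hat\Delta'_{\Delta\bar q}$ has an oriented basis $(h_1,\dots,h_m)$ with $h_m\wedge\dots\wedge h_1\wedge\mathrm{or}(\Delta')=\mathrm{or}(\Delta)\wedge\bar q$. The result depends only on the orientation of $\Delta$. **Action of $\phi$.** For an edge $e$ of the barycentric subdivision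 with endpoints $x_0,x_1$ let $w_e=y_{x_1}-y_{x_0}$, where $y_x=x$ if $x$ has sedentarity $0$ and otherwise $y_x$ is a nearby sedentarity-$0$ point projecting to $x$ along divisorial directions. Order the vertices of each barycentric simplex $\sigma$ by increasing dimension of the largest cells whose barycenters they represent. Then $\phi\cap(\beta\sigma)=(w_{\sigma_{01}}\wedge\beta)\,\sigma_{1\dots m}$, where $\sigma_{01}$ is the first edge, $\sigma_{1\dots m}$ is the face opposite to the first vertex, and the coefficient is pushed to it by $\iota$. On the chains $c[-r]$ this is independent of the choices of $y_x$, since the coefficients on infinite cells are divisible by the divisorial vectors. *)

theory Defs
  imports "HOL-Analysis.Analysis" "HOL-Complex_Analysis.Complex_Analysis"
begin

section \<open>Tropical projective space\<close>

text \<open>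
  The index type \<open>'n\<close> labels the homogeneous coordinates, so the dimension \<open>N\<close> of the tropical
  projective space is \<open>CARD('n) - 1\<close>. A point is stored as its unique vector of homogeneous
  coordinates with maximum \<open>0\<close>; this set of representatives, with the topology induced from
  \<open>ereal ^ 'n\<close>, is homeomorphic to the quotient of the nonzero tropical vectors by rescaling.
  Finite points and tangent vectors are handled through lifts in \<open>real ^ 'n\<close>, which are only
  meaningful modulo the line through \<open>1\<close>.
\<close>

definition tproj :: "(ereal ^ 'n::finite) set" where
  "tproj = {x. (\<forall>i. x $ i \<le> 0) \<and> (\<exists>i. x $ i = 0)}"

definition tnormalize :: "ereal ^ 'n::finite \<Rightarrow> ereal ^ 'n" where
  "tnormalize x = (\<chi> i. x $ i - Max (range (($) x)))"

definition emb :: "real ^ 'n::finite \<Rightarrow> ereal ^ 'n" where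
  "emb v = (\<chi> i. ereal (v $ i))"

definition tpoint :: "real ^ 'n::finite \<Rightarrow> ereal ^ 'n" where
  "tpoint v = tnormalize (emb v)"

definition rvec :: "ereal ^ 'n::finite \<Rightarrow> real ^ 'n" where
  "rvec x = (\<chi> i. real_of_ereal (x $ i))"

definition sed :: "ereal ^ 'n::finite \<Rightarrow> 'n set" where
  "sed x = {i. x $ i = - \<infinity>}"

text \<open>Projection along the divisorial directions in \<open>A\<close>.\<close>

definition tsend :: "'n::finite set \<Rightarrow> ereal ^ 'n \<Rightarrow> ereal ^ 'n" where
  "tsend A x = tnormalize (\<chi> i. if i \<in> A then - \<infinity> else x $ i)"

text \<open>The divisorial vector pointing towards the stratum \<open>x $ i = - \<infinity>\<close>.\<close>

definition divisorial :: "'n::finite \<Rightarrow> real ^ 'n" where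
  "divisorial i = - axis i 1"


section \<open>Tangent lattices of subsets of tropical projective space\<close>

text \<open>Generic (minimal) refined sedentarity.\<close>

definition csed :: "(ereal ^ 'n::finite) set \<Rightarrow> 'n set" where
  "csed F = (\<Inter>x\<in>F. sed x)"

text \<open>
  The stratum of sedentarity \<open>I\<close> is the real affine space on \<open>real ^ 'n\<close> modulo
  \<open>divker I\<close>. All linear data of a set \<open>F\<close> of generic sedentarity \<open>I\<close> are represented
  by their full preimages in \<open>real ^ 'n\<close>; in particular \<open>tangent F\<close> contains \<open>divker I\<close> and
  \<open>tlattice F\<close> is the preimage of the tangent lattice.
\<close>

definition divker :: "'n::finite set \<Rightarrow> (real ^ 'n) set" where
  "divker I = span (insert 1 (divisorial ` I))"

definition lifts :: "(ereal ^ 'n::finite) set \<Rightarrow> (real ^ 'n) set" where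
  "lifts F = {v. tsend (csed F) (emb v) \<in> F}"

definition tangent :: "(ereal ^ 'n::finite) set \<Rightarrow> (real ^ 'n) set" where
  "tangent F = span {u - v | u v. u \<in> lifts F \<and> v \<in> lifts F}"

definition tlattice :: "(ereal ^ 'n::finite) set \<Rightarrow> (real ^ 'n) set" where
  "tlattice F = {z \<in> tangent F. \<forall>i. z $ i \<in> \<int>}"

definition tdim :: "(ereal ^ 'n::finite) set \<Rightarrow> nat" where
  "tdim F = dim (tangent F) - dim (divker (csed F))"

text \<open>\<open>bs\<close> represents a basis of the lattice \<open>tlattice F\<close> modulo \<open>divker (csed F)\<close>.\<close>

definition lattice_basis :: "(ereal ^ 'n::finite) set \<Rightarrow> (real ^ 'n) list \<Rightarrow> bool" where
  "lattice_basis F bs \<longleftrightarrow>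
     set bs \<subseteq> tlattice F \<and>
     (\<forall>c :: nat \<Rightarrow> real. (\<Sum>k<length bs. c k *\<^sub>R bs ! k) \<in> divker (csed F) \<longrightarrow>
        (\<forall>k<length bs. c k = 0)) \<and>
     (\<forall>z\<in>tlattice F. \<exists>c :: nat \<Rightarrow> int.
        z - (\<Sum>k<length bs. of_int (c k) *\<^sub>R bs ! k) \<in> divker (csed F))"


section \<open>Projective tropical spaces\<close>

text \<open>
  A half-space \<open>j x \<le> a\<close>. The terms with negative coefficients are moved to the right, so that
  the condition makes sense (and defines the closure of the real half-space) at points with
  coordinates \<open>- \<infinity>\<close>. Covectors with coordinate sum \<open>0\<close> are the integer covectors of each affine
  chart.
\<close>

type_synonym 'n ineq = "(int ^ 'n) \<times> real"

definition pos_part :: "int ^ 'n::finite \<Rightarrow> ereal ^ 'n \<Rightarrow> ereal" where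
  "pos_part j x = (\<Sum>i\<in>{i. j $ i > 0}. ereal (of_int (j $ i)) * x $ i)"

definition neg_part :: "int ^ 'n::finite \<Rightarrow> ereal ^ 'n \<Rightarrow> ereal" where
  "neg_part j x = (\<Sum>i\<in>{i. j $ i < 0}. ereal (of_int (- j $ i)) * x $ i)"

text \<open>The polyhedral domain in the affine chart \<open>x $ i0 \<noteq> - \<infinity>\<close> cut out by \<open>H\<close>.\<close>

definition domain_of :: "'n::finite \<Rightarrow> 'n ineq set \<Rightarrow> (ereal ^ 'n) set" where
  "domain_of i0 H = {x \<in> tproj. x $ i0 \<noteq> - \<infinity> \<and>
     (\<forall>(j, a)\<in>H. pos_part j x \<le> ereal a + neg_part j x)}"

definition mobile_face :: "'n::finite \<Rightarrow> 'n ineq set \<Rightarrow> (ereal ^ 'n) set \<Rightarrow> bool" where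
  "mobile_face i0 H E \<longleftrightarrow> (\<exists>S\<subseteq>H. E = {x \<in> domain_of i0 H.
     \<forall>(j, a)\<in>S. pos_part j x = ereal a + neg_part j x})"

definition domain_face :: "'n::finite \<Rightarrow> 'n ineq set \<Rightarrow> (ereal ^ 'n) set \<Rightarrow> bool" where
  "domain_face i0 H E \<longleftrightarrow>
     (\<exists>E' A. mobile_face i0 H E' \<and> E = {x \<in> E'. \<forall>i\<in>A. x $ i = - \<infinity>})"

definition regular_at_infinity :: "(ereal ^ 'n::finite) set \<Rightarrow> bool" where
  "regular_at_infinity D \<longleftrightarrow> (\<forall>I. {x \<in> D. sed x = I} = {} \<or>
     tdim {x \<in> D. sed x = I} + card I = tdim D)"

text \<open>
  The primitive integer vector of the facet \<open>D\<close> along its codimension one face \<open>E\<close>, pointing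
  from \<open>E\<close> into \<open>D\<close>.
\<close>

definition outward_primitive ::
  "(ereal ^ 'n::finite) set \<Rightarrow> (ereal ^ 'n) set \<Rightarrow> real ^ 'n \<Rightarrow> bool" where
  "outward_primitive E D u \<longleftrightarrow>
     u \<in> tlattice D \<and>
     (\<forall>z\<in>tlattice D. \<exists>m::int. z - of_int m *\<^sub>R u \<in> tangent E) \<and>
     (\<exists>p\<in>lifts E. \<exists>\<epsilon>>0. p + \<epsilon> *\<^sub>R u \<in> lifts D)"

definition balanced_along ::
  "(ereal ^ 'n::finite) set set \<Rightarrow> (ereal ^ 'n) set \<Rightarrow> bool" where
  "balanced_along \<D> E \<longleftrightarrow>
     (let adj = {D \<in> \<D>. E \<subseteq> D \<and> tdim D = tdim E + 1} in
      \<exists>u. (\<forall>D\<in>adj. outward_primitive E D (u D)) \<and> (\<Sum>D\<in>adj. u D) \<in> tangent E)"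

text \<open>
  Facets are given by finite systems of inequalities. The codimension one mobile faces entering
  the balancing condition are those meeting the finite part of the chart.
\<close>

definition balanced_complex :: "'n::finite \<Rightarrow> (ereal ^ 'n) set \<Rightarrow> bool" where
  "balanced_complex i0 Y \<longleftrightarrow> (\<exists>\<H> :: 'n ineq set set.
     finite \<H> \<and>
     (\<forall>H\<in>\<H>. finite H \<and> (\<forall>(j, a)\<in>H. (\<Sum>i\<in>UNIV. j $ i) = 0)) \<and>
     Y = (\<Union>H\<in>\<H>. domain_of i0 H) \<and>
     (\<forall>H\<in>\<H>. domain_of i0 H \<noteq> {} \<and> regular_at_infinity (domain_of i0 H)) \<and>
     (\<forall>H\<in>\<H>. \<forall>H'\<in>\<H>. domain_of i0 H \<subseteq> domain_of i0 H' \<longrightarrow>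
        domain_of i0 H = domain_of i0 H') \<and>
     (\<forall>H\<in>\<H>. \<forall>H'\<in>\<H>. domain_of i0 H \<inter> domain_of i0 H' = {} \<or>
        domain_face i0 H (domain_of i0 H \<inter> domain_of i0 H') \<and>
        domain_face i0 H' (domain_of i0 H \<inter> domain_of i0 H')) \<and>
     (\<forall>H\<in>\<H>. \<forall>E. mobile_face i0 H E \<and> (\<exists>x\<in>E. sed x = {}) \<and>
        tdim E + 1 = tdim (domain_of i0 H) \<longrightarrow> balanced_along (domain_of i0 ` \<H>) E))"

definition projective_tropical_space :: "(ereal ^ 'n::finite) set \<Rightarrow> bool" where
  "projective_tropical_space X \<longleftrightarrow>
     X \<subseteq> tproj \<and> (\<forall>i0. balanced_complex i0 {x \<in> X. x $ i0 \<noteq> - \<infinity>})"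


section \<open>Smoothness\<close>

text \<open>Matroids on the ground set \<open>{..<m}\<close>, given by their independent sets.\<close>

definition matroid :: "nat \<Rightarrow> nat set set \<Rightarrow> bool" where
  "matroid m \<I> \<longleftrightarrow>
     \<I> \<subseteq> Pow {..<m} \<and> {} \<in> \<I> \<and>
     (\<forall>A\<in>\<I>. \<forall>B\<subseteq>A. B \<in> \<I>) \<and>
     (\<forall>A\<in>\<I>. \<forall>B\<in>\<I>. card A < card B \<longrightarrow> (\<exists>x\<in>B - A. insert x A \<in> \<I>))"

definition loopless :: "nat \<Rightarrow> nat set set \<Rightarrow> bool" where
  "loopless m \<I> \<longleftrightarrow> (\<forall>x<m. {x} \<in> \<I>)"

definition rank_of :: "nat set set \<Rightarrow> nat set \<Rightarrow> nat" where
  "rank_of \<I> A = Max {card B | B. B \<in> \<I> \<and> B \<subseteq> A}"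

definition flat :: "nat \<Rightarrow> nat set set \<Rightarrow> nat set \<Rightarrow> bool" where
  "flat m \<I> F \<longleftrightarrow> F \<subseteq> {..<m} \<and> (\<forall>x\<in>{..<m} - F. rank_of \<I> F < rank_of \<I> (insert x F))"

text \<open>
  The vectors \<open>e_j\<close> in \<open>\<int>^(m-1)\<close>: the standard basis for \<open>j < m - 1\<close>, and minus its sum for
  \<open>j = m - 1\<close>. The flats \<open>{}\<close> and \<open>{..<m}\<close> contribute the vector \<open>0\<close>.
\<close>

definition mvec :: "nat \<Rightarrow> nat \<Rightarrow> nat \<Rightarrow> real" where
  "mvec m j = (\<lambda>i. if i < m - 1 then (if j = m - 1 then - 1 else if i = j then 1 else 0) else 0)"

definition flat_vec :: "nat \<Rightarrow> nat set \<Rightarrow> nat \<Rightarrow> real" where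
  "flat_vec m F = (\<lambda>i. \<Sum>j\<in>F. mvec m j i)"

definition bergman_fan :: "nat \<Rightarrow> nat set set \<Rightarrow> (nat \<Rightarrow> real) set" where
  "bergman_fan m \<I> = {x. \<exists>\<C> a. (\<forall>F\<in>\<C>. flat m \<I> F \<and> a F \<ge> 0) \<and>
     (\<forall>F\<in>\<C>. \<forall>G\<in>\<C>. F \<subseteq> G \<or> G \<subseteq> F) \<and> x = (\<lambda>i. \<Sum>F\<in>\<C>. a F * flat_vec m F i)}"

text \<open>
  The product of the Bergman fan with the \<open>s\<close>-fold tropical affine space, in coordinates
  \<open>0, \<dots>, m - 1 + s - 1\<close>; the remaining coordinates are \<open>0\<close>.
\<close>

definition smooth_model :: "nat \<Rightarrow> nat set set \<Rightarrow> nat \<Rightarrow> (nat \<Rightarrow> ereal) set" where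
  "smooth_model m \<I> s = {z. \<exists>x\<in>bergman_fan m \<I>.
     (\<forall>i<m - 1. z i = ereal (x i)) \<and> (\<forall>i\<ge>m - 1. i < m - 1 + s \<longrightarrow> z i \<noteq> \<infinity>) \<and>
     (\<forall>i\<ge>m - 1 + s. z i = 0)}"

text \<open>
  Integral affine maps (integer linear part, real translation) are prescribed on points of
  sedentarity \<open>0\<close> and extended by continuity.
\<close>

definition smooth_chart :: "(ereal ^ 'n::finite) set \<Rightarrow> (ereal ^ 'n) set \<Rightarrow> bool" where
  "smooth_chart X U \<longleftrightarrow> openin (top_of_set X) U \<and>
     (\<exists>m \<I> s V f g. m \<ge> 1 \<and> matroid m \<I> \<and> loopless m \<I> \<and>
        openin (top_of_set (smooth_model m \<I> s)) V \<and> homeomorphism U V f g \<and>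
        (\<exists>(A :: nat \<Rightarrow> int ^ 'n) b. \<forall>k<m - 1 + s. (\<Sum>i\<in>UNIV. A k $ i) = 0 \<and>
           (\<forall>x\<in>U. sed x = {} \<longrightarrow>
              f x k = ereal ((\<Sum>i\<in>UNIV. of_int (A k $ i) * rvec x $ i) + b k))) \<and>
        (\<exists>(B :: 'n \<Rightarrow> nat \<Rightarrow> int) b. \<forall>z\<in>V. (\<forall>k. z k \<noteq> - \<infinity>) \<longrightarrow>
           g z = tpoint (\<chi> i. (\<Sum>k<m - 1 + s. of_int (B i k) * real_of_ereal (z k)) + b i)))"

definition smooth_tropical_space :: "(ereal ^ 'n::finite) set \<Rightarrow> bool" where
  "smooth_tropical_space X \<longleftrightarrow>
     (\<exists>\<U>. finite \<U> \<and> \<Union>\<U> = X \<and> (\<forall>U\<in>\<U>. smooth_chart X U))"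


section \<open>Tropical limits\<close>

text \<open>
  A projective family over the punctured disc of radius \<open>R\<close>, meromorphic at \<open>0\<close>: the fibers are
  the common zeros of finitely many homogeneous polynomials (indexed by \<open>s < m\<close>, of degree
  \<open>d s\<close> and with exponent vectors in \<open>S s\<close>) whose coefficients are holomorphic on the punctured
  disc and meromorphic at \<open>0\<close>. Fibers are given by nonzero homogeneous coordinate vectors.
\<close>

definition meromorphic_family ::
  "real \<Rightarrow> (complex \<Rightarrow> (complex ^ 'n::finite) set) \<Rightarrow> bool" where
  "meromorphic_family R Z \<longleftrightarrow> R > 0 \<and>
     (\<exists>(m :: nat) (d :: nat \<Rightarrow> nat) (S :: nat \<Rightarrow> (nat ^ 'n) set)
        (a :: nat \<Rightarrow> nat ^ 'n \<Rightarrow> complex \<Rightarrow> complex).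
        (\<forall>s<m. finite (S s) \<and> (\<forall>\<alpha>\<in>S s. (\<Sum>i\<in>UNIV. \<alpha> $ i) = d s \<and>
           a s \<alpha> holomorphic_on (ball 0 R - {0}) \<and> a s \<alpha> meromorphic_on {0})) \<and>
        (\<forall>t\<in>ball 0 R - {0}. Z t = {z. z \<noteq> 0 \<and>
           (\<forall>s<m. (\<Sum>\<alpha>\<in>S s. a s \<alpha> t * (\<Prod>i\<in>UNIV. (z $ i) ^ (\<alpha> $ i))) = 0)}))"

definition tlog :: "complex \<Rightarrow> complex ^ 'n::finite \<Rightarrow> ereal ^ 'n" where
  "tlog t z = tnormalize (\<chi> i. if z $ i = 0 then - \<infinity>
     else ereal (ln (cmod (z $ i)) / ln (1 / cmod t)))"

text \<open>
  Convergence of closed subsets of the compact space \<open>tproj\<close> as \<open>t \<rightarrow> 0\<close> (Hausdorff convergence,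
  phrased through neighbourhoods).
\<close>

definition set_limit :: "(complex \<Rightarrow> (ereal ^ 'n::finite) set) \<Rightarrow> (ereal ^ 'n) set \<Rightarrow> bool" where
  "set_limit A X \<longleftrightarrow>
     (\<forall>x\<in>X. \<forall>W. open W \<and> x \<in> W \<longrightarrow> (\<forall>\<^sub>F t in at 0. A t \<inter> W \<noteq> {})) \<and>
     (\<forall>x\<in>tproj - X. \<exists>W. open W \<and> x \<in> W \<and> (\<forall>\<^sub>F t in at 0. A t \<inter> W = {}))"

definition pairing :: "int ^ 'n::finite \<Rightarrow> real ^ 'n \<Rightarrow> real" where
  "pairing m v = (\<Sum>i\<in>UNIV. of_int (m $ i) * v $ i)"

text \<open>\<open>v\<close> lifts a point in the interior of a facet of \<open>X\<close> with tangent space \<open>L\<close>.\<close>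

definition facet_point ::
  "(ereal ^ 'n::finite) set \<Rightarrow> real ^ 'n \<Rightarrow> (real ^ 'n) set \<Rightarrow> bool" where
  "facet_point X v L \<longleftrightarrow> subspace L \<and> 1 \<in> L \<and>
     (\<exists>\<delta>>0. \<forall>u. dist u v < \<delta> \<longrightarrow> (tpoint u \<in> X \<longleftrightarrow> u - v \<in> L))"

text \<open>\<open>ms\<close> are integral coordinates on the lattice of \<open>L\<close> modulo \<open>1\<close>.\<close>

definition lattice_coordinates :: "(real ^ 'n::finite) set \<Rightarrow> (int ^ 'n) list \<Rightarrow> bool" where
  "lattice_coordinates L ms \<longleftrightarrow>
     (\<forall>m\<in>set ms. (\<Sum>i\<in>UNIV. m $ i) = 0) \<and>
     (\<forall>c :: int list. length c = length ms \<longrightarrow>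
        (\<exists>z\<in>L. (\<forall>i. z $ i \<in> \<int>) \<and> map (\<lambda>m. pairing m z) ms = map of_int c)) \<and>
     (\<forall>z\<in>L. (\<forall>i. z $ i \<in> \<int>) \<and> (\<forall>m\<in>set ms. pairing m z = 0) \<longrightarrow> z \<in> span {1})"

text \<open>
  The multiplicity of a facet in the limit is the local degree, near an interior point of the
  facet, of the projection of the fibers along monomials giving integral coordinates on the
  facet. It is \<open>1\<close> if every target point with logarithm near the given one has exactly one
  preimage.
\<close>

definition multiplicity_one ::
  "(complex \<Rightarrow> (complex ^ 'n::finite) set) \<Rightarrow> (ereal ^ 'n) set \<Rightarrow> bool" where
  "multiplicity_one Z X \<longleftrightarrow> (\<forall>v L ms. facet_point X v L \<and> lattice_coordinates L ms \<longrightarrow>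
     (\<exists>U. open U \<and> tpoint v \<in> U \<and> (\<exists>\<delta>>0. \<forall>\<^sub>F t in at 0. \<forall>w :: complex list.
        length w = length ms \<and>
        (\<forall>k<length ms. w ! k \<noteq> 0 \<and>
           \<bar>ln (cmod (w ! k)) / ln (1 / cmod t) - pairing (ms ! k) v\<bar> < \<delta>) \<longrightarrow>
        (let P = {z \<in> Z t. (\<forall>i. z $ i \<noteq> 0) \<and> tlog t z \<in> U \<and>
                    (\<forall>k<length ms. (\<Prod>i\<in>UNIV. (z $ i) powi (ms ! k $ i)) = w ! k)}
         in \<exists>z\<in>P. \<forall>z'\<in>P. \<exists>c. z' = c *s z))))"

definition tropical_limit_of_family :: "(ereal ^ 'n::finite) set \<Rightarrow> bool" where
  "tropical_limit_of_family X \<longleftrightarrow>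
     (\<exists>R Z. meromorphic_family R Z \<and> set_limit (\<lambda>t. tlog t ` Z t) X \<and> multiplicity_one Z X)"


section \<open>Unimodular triangulations\<close>

text \<open>
  The cell with vertex set \<open>V\<close> (points of a common sedentarity) and recession cone spanned by the
  divisorial vectors in \<open>J\<close>, closed up by allowing infinite cone coordinates.
\<close>

definition tcell :: "(ereal ^ 'n::finite) set \<Rightarrow> 'n set \<Rightarrow> (ereal ^ 'n) set" where
  "tcell V J = {tnormalize x | x. (\<exists>i. x $ i \<noteq> - \<infinity>) \<and>
     (\<exists>(p :: ereal ^ 'n \<Rightarrow> real) (\<mu> :: 'n \<Rightarrow> ereal).
        (\<forall>v\<in>V. 0 \<le> p v) \<and> (\<Sum>v\<in>V. p v) = 1 \<and> (\<forall>i\<in>J. 0 \<le> \<mu> i) \<and>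
        (\<forall>i. x $ i = (\<Sum>v\<in>V. ereal (p v) * v $ i) - (if i \<in> J then \<mu> i else 0)))}"

definition unimodular_cell :: "(ereal ^ 'n::finite) set \<Rightarrow> 'n set \<Rightarrow> bool" where
  "unimodular_cell V J \<longleftrightarrow>
     finite V \<and> V \<noteq> {} \<and> V \<subseteq> tproj \<and>
     (\<forall>v\<in>V. sed v = csed V \<and> (\<forall>i. rvec v $ i \<in> \<int>)) \<and>
     J \<inter> csed V = {} \<and>
     (\<exists>vs js. distinct vs \<and> set vs = V \<and> distinct js \<and> set js = J \<and>
        lattice_basis (tcell V J)
          (map (\<lambda>v. rvec v - rvec (hd vs)) (tl vs) @ map divisorial js))"

text \<open>A face is given by some of the vertices, some of the cone directions, and the set \<open>A\<close> of
  cone directions along which it lies at infinity.\<close>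

definition tcell_faces :: "(ereal ^ 'n::finite) set \<Rightarrow> 'n set \<Rightarrow> (ereal ^ 'n) set set" where
  "tcell_faces V J = {tcell (tsend A ` V') J' | V' J' A.
     V' \<subseteq> V \<and> V' \<noteq> {} \<and> J' \<subseteq> J \<and> A \<subseteq> J \<and> A \<inter> J' = {}}"

definition unimodular_triangulation ::
  "(ereal ^ 'n::finite) set set \<Rightarrow> (ereal ^ 'n) set \<Rightarrow> bool" where
  "unimodular_triangulation K X \<longleftrightarrow>
     finite K \<and> \<Union>K = X \<and>
     (\<forall>F\<in>K. \<exists>V J. unimodular_cell V J \<and> F = tcell V J \<and> tcell_faces V J \<subseteq> K \<and>
        (\<forall>G\<in>K. F \<inter> G \<noteq> {} \<longrightarrow> F \<inter> G \<in> tcell_faces V J))"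

text \<open>In such a complex \<open>K\<close>, a cell is a face of another one iff it is contained in it.\<close>

definition finite_face :: "(ereal ^ 'n::finite) set set \<Rightarrow> (ereal ^ 'n) set \<Rightarrow> bool" where
  "finite_face K F \<longleftrightarrow> compact F \<and> (\<forall>G\<in>K. G \<subseteq> F \<longrightarrow> csed G = csed F)"

definition relint :: "(ereal ^ 'n::finite) set set \<Rightarrow> (ereal ^ 'n) set \<Rightarrow> (ereal ^ 'n) set" where
  "relint K F = F - \<Union>{G \<in> K. G \<subset> F}"

definition vertices_of ::
  "(ereal ^ 'n::finite) set set \<Rightarrow> (ereal ^ 'n) set \<Rightarrow> (ereal ^ 'n) set" where
  "vertices_of K F = {x \<in> F. {x} \<in> K}"


section \<open>Polyvectors and the coefficient groups\<close>

text \<open>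
  The exterior powers of \<open>real ^ 'n\<close> modulo \<open>divker I\<close> are realised as alternating forms on the dual
  space \<open>covectors I\<close>: the polyvector \<open>v\<^sub>1 \<and> \<dots> \<and> v\<^sub>p\<close> sends a list of covectors \<open>j\<^sub>1, \<dots>, j\<^sub>p\<close>
  to the determinant of the matrix \<open>j\<^sub>a \<bullet> v\<^sub>b\<close>, and is extended by \<open>0\<close> to other lists. The
  projection to a quotient by further divisorial directions is then the restriction to fewer
  covectors.
\<close>

type_synonym 'n polyvector = "(real ^ 'n) list \<Rightarrow> real"

definition covectors :: "'n::finite set \<Rightarrow> (real ^ 'n) set" where
  "covectors I = {j. (\<Sum>i\<in>UNIV. j $ i) = 0 \<and> (\<forall>i\<in>I. j $ i = 0)}"

definition pv_project :: "'n::finite set \<Rightarrow> 'n polyvector \<Rightarrow> 'n polyvector" where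
  "pv_project I \<beta> = (\<lambda>js. if set js \<subseteq> covectors I then \<beta> js else 0)"

text \<open>Left exterior multiplication by a vector, as expansion of the determinant along it.\<close>

definition vwedge :: "real ^ 'n::finite \<Rightarrow> 'n polyvector \<Rightarrow> 'n polyvector" where
  "vwedge v \<beta> = (\<lambda>js. \<Sum>a<length js.
     (- 1) ^ a * (js ! a \<bullet> v) * \<beta> (take a js @ drop (Suc a) js))"

definition wedge :: "(real ^ 'n::finite) list \<Rightarrow> 'n polyvector" where
  "wedge vs = pv_project {} (foldr vwedge vs (\<lambda>js. if js = [] then 1 else 0))"

text \<open>The coefficient group \<open>\<F>\<^sub>p(F)\<close>, tensored with the reals.\<close>

definition Fp :: "(ereal ^ 'n::finite) set set \<Rightarrow> nat \<Rightarrow> (ereal ^ 'n) set \<Rightarrow> 'n polyvector set" where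
  "Fp K p F = {\<beta>. \<exists>(m :: nat) (a :: nat \<Rightarrow> real) vs.
     (\<forall>k<m. length (vs k) = p \<and>
        (\<exists>G\<in>K. F \<subseteq> G \<and> csed G = csed F \<and> set (vs k) \<subseteq> tlattice G)) \<and>
     \<beta> = (\<lambda>js. \<Sum>k<m. a k * pv_project (csed F) (wedge (vs k)) js)}"


section \<open>Barycentric chains\<close>

definition most_sedentary :: "(ereal ^ 'n::finite) set \<Rightarrow> (ereal ^ 'n) set" where
  "most_sedentary F = {x \<in> F. \<forall>x'\<in>F. sed x' \<subseteq> sed x}"

definition barycenters ::
  "(ereal ^ 'n::finite) set set \<Rightarrow> ((ereal ^ 'n) set \<Rightarrow> ereal ^ 'n) \<Rightarrow> bool" where
  "barycenters K b \<longleftrightarrow> (\<forall>F\<in>K.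
     if finite_face K F then b F \<in> relint K F else b F = b (most_sedentary F))"

text \<open>
  Simplices are given by their vertex sets. A simplex lying at infinity arises from flags of
  several sedentarities, which are identified here.
\<close>

definition bary_simplices ::
  "(ereal ^ 'n::finite) set set \<Rightarrow> ((ereal ^ 'n) set \<Rightarrow> ereal ^ 'n) \<Rightarrow> (ereal ^ 'n) set set" where
  "bary_simplices K b = {b ` \<F> | \<F>. \<F> \<subseteq> K \<and> \<F> \<noteq> {} \<and>
     (\<forall>F\<in>\<F>. \<forall>G\<in>\<F>. (F \<subseteq> G \<or> G \<subseteq> F) \<and> csed F = csed G)}"

text \<open>The smallest cell containing a barycentric simplex; it is the cell whose relative interior
  contains that of the simplex.\<close>

definition carrier_cell ::
  "(ereal ^ 'n::finite) set set \<Rightarrow> (ereal ^ 'n) set \<Rightarrow> (ereal ^ 'n) set" where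
  "carrier_cell K \<sigma> = \<Inter>{G \<in> K. \<sigma> \<subseteq> G}"

text \<open>The dimension of the largest cell with barycenter \<open>x\<close>.\<close>

definition level ::
  "(ereal ^ 'n::finite) set set \<Rightarrow> ((ereal ^ 'n) set \<Rightarrow> ereal ^ 'n) \<Rightarrow> ereal ^ 'n \<Rightarrow> nat" where
  "level K b x = Max {tdim F | F. F \<in> K \<and> b F = x}"

definition first_vertex ::
  "(ereal ^ 'n::finite) set set \<Rightarrow> ((ereal ^ 'n) set \<Rightarrow> ereal ^ 'n) \<Rightarrow>
   (ereal ^ 'n) set \<Rightarrow> ereal ^ 'n" where
  "first_vertex K b \<sigma> = arg_min_on (level K b) \<sigma>"

text \<open>
  A chain assigns to each barycentric simplex, oriented by increasing \<open>level\<close> of its vertices,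
  a coefficient at its carrier.
\<close>

type_synonym 'n chain = "(ereal ^ 'n) set \<Rightarrow> 'n polyvector"

definition bary_chains ::
  "(ereal ^ 'n::finite) set set \<Rightarrow> ((ereal ^ 'n) set \<Rightarrow> ereal ^ 'n) \<Rightarrow> nat \<Rightarrow> nat \<Rightarrow>
   'n chain set" where
  "bary_chains K b q p = {\<gamma>. \<forall>\<sigma>.
     if \<sigma> \<in> bary_simplices K b \<and> card \<sigma> = q + 1 then \<gamma> \<sigma> \<in> Fp K p (carrier_cell K \<sigma>)
     else \<gamma> \<sigma> = (\<lambda>_. 0)}"


section \<open>The action of the eigenwave\<close>

text \<open>
  \<open>y x\<close> is a real lift of a point of sedentarity \<open>0\<close> that projects to \<open>x\<close> along the divisorial
  directions. It need not be near \<open>x\<close>, so all admissible choices are covered.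
\<close>

definition eigenwave_lift ::
  "(ereal ^ 'n::finite) set set \<Rightarrow> ((ereal ^ 'n) set \<Rightarrow> ereal ^ 'n) \<Rightarrow>
   (ereal ^ 'n \<Rightarrow> real ^ 'n) \<Rightarrow> bool" where
  "eigenwave_lift K b y \<longleftrightarrow> (\<forall>F\<in>K. tsend (sed (b F)) (emb (y (b F))) = b F)"

text \<open>
  The coefficient of the cap product at \<open>\<tau>\<close> collects the simplices \<open>\<sigma>\<close> whose face opposite to the
  first vertex is \<open>\<tau>\<close>; the second vertex of \<open>\<sigma>\<close> is the first vertex of \<open>\<tau>\<close>.
\<close>

definition eigenwave_cap ::
  "(ereal ^ 'n::finite) set set \<Rightarrow> ((ereal ^ 'n) set \<Rightarrow> ereal ^ 'n) \<Rightarrow>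
   (ereal ^ 'n \<Rightarrow> real ^ 'n) \<Rightarrow> 'n chain \<Rightarrow> 'n chain" where
  "eigenwave_cap K b y \<gamma> = (\<lambda>\<tau>. if \<tau> = {} then (\<lambda>_. 0) else
     (\<lambda>js. \<Sum>\<sigma>\<in>{\<sigma> \<in> bary_simplices K b. \<sigma> - {first_vertex K b \<sigma>} = \<tau>}.
        pv_project (csed (carrier_cell K \<tau>))
          (vwedge (y (first_vertex K b \<tau>) - y (first_vertex K b \<sigma>)) (\<gamma> \<sigma>)) js))"


section \<open>Propellers and their shifts\<close>

datatype 'n generator = Vertex "(ereal, 'n::finite) vec" | Divisorial "'n"

text \<open>\<open>dir_vec x0 q\<close> is the vector from the vertex \<open>x0\<close> in the direction of \<open>q\<close>.\<close>

fun dir_vec :: "ereal ^ 'n::finite \<Rightarrow> 'n generator \<Rightarrow> real ^ 'n" where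
  "dir_vec x0 (Vertex x) = rvec x - rvec x0"
| "dir_vec x0 (Divisorial i) = divisorial i"

text \<open>The face spanned by the vertices of \<open>D\<close> and by \<open>qb\<close>.\<close>

definition joined ::
  "(ereal ^ 'n::finite) set set \<Rightarrow> (ereal ^ 'n) set \<Rightarrow> 'n generator set \<Rightarrow> (ereal ^ 'n) set" where
  "joined K D qb = tcell (vertices_of K D \<union> {x. Vertex x \<in> qb}) {i. Divisorial i \<in> qb}"

definition Link ::
  "(ereal ^ 'n::finite) set set \<Rightarrow> (ereal ^ 'n) set \<Rightarrow> nat \<Rightarrow> 'n generator set set" where
  "Link K D l = {qb. finite qb \<and> card qb = l \<and>
     (\<forall>x. Vertex x \<in> qb \<longrightarrow> {x} \<in> K \<and> sed x = {}) \<and>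
     joined K D qb \<in> K \<and> tdim (joined K D qb) = tdim D + l}"

text \<open>An element is given by its coefficients \<open>\<rho>\<close>; balancing is empty for \<open>l = 0\<close>.\<close>

definition propellers ::
  "(ereal ^ 'n::finite) set set \<Rightarrow> (ereal ^ 'n) set \<Rightarrow> nat \<Rightarrow> ('n generator set \<Rightarrow> rat) set" where
  "propellers K D l = {\<rho>. (\<forall>qb. qb \<notin> Link K D l \<longrightarrow> \<rho> qb = 0) \<and>
     (\<forall>l' rb x0. l = Suc l' \<and> rb \<in> Link K D l' \<and> x0 \<in> vertices_of K D \<longrightarrow>
        (\<Sum>q\<in>{q. q \<notin> rb \<and> insert q rb \<in> Link K D l}.
           real_of_rat (\<rho> (insert q rb)) *\<^sub>R dir_vec x0 q) \<in> tangent (joined K D rb))}"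

text \<open>The frame of \<open>or(D) \<and> qb\<close> for a simplex with ordered vertices \<open>xs\<close>.\<close>

definition frame :: "(ereal ^ 'n::finite) list \<Rightarrow> 'n generator list \<Rightarrow> (real ^ 'n) list" where
  "frame xs qs = map (\<lambda>x. rvec x - rvec (hd xs)) (tl xs) @ map (dir_vec (hd xs)) qs"

text \<open>The integral volume element of \<open>F\<close> that is positive for the frame \<open>us\<close>.\<close>

definition volume_element ::
  "(ereal ^ 'n::finite) set \<Rightarrow> (real ^ 'n) list \<Rightarrow> 'n polyvector" where
  "volume_element F us = (SOME \<omega>. \<exists>bs. lattice_basis F bs \<and> \<omega> = wedge bs \<and>
     (\<exists>a>0. wedge bs = (\<lambda>js. a * wedge us js)))"

definition orientation_sign :: "(real ^ 'n::finite) list \<Rightarrow> (real ^ 'n) list \<Rightarrow> real" where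
  "orientation_sign us vs =
     (if \<exists>a>0. wedge us = (\<lambda>js. a * wedge vs js) then 1
      else if \<exists>a<0. wedge us = (\<lambda>js. a * wedge vs js) then - 1 else 0)"

text \<open>
  The simplices of the dual cell of \<open>D'\<close> in \<open>G\<close>: maximal flags of sedentarity \<open>0\<close> faces from
  \<open>D'\<close> to \<open>G\<close>. Flags with members strictly below \<open>D'\<close> are not transverse to \<open>D'\<close>, so the
  orientation rule below excludes them.
\<close>

definition dual_flags ::
  "(ereal ^ 'n::finite) set set \<Rightarrow> (ereal ^ 'n) set \<Rightarrow> (ereal ^ 'n) set \<Rightarrow>
   (ereal ^ 'n) set list set" where
  "dual_flags K D' G = {Fs. length Fs = tdim G - tdim D' + 1 \<and> sorted_wrt (\<subset>) Fs \<and>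
     set Fs \<subseteq> {F \<in> K. csed F = {}} \<and> hd Fs = D' \<and> last Fs = G}"

text \<open>
  The edge vectors \<open>h\<^sub>1, \<dots>, h\<^sub>m\<close> of the simplex of a flag. A barycenter at infinity is
  replaced by a point in the interior of its cell projecting to it.
\<close>

definition inner_lift ::
  "(ereal ^ 'n::finite) set set \<Rightarrow> ((ereal ^ 'n) set \<Rightarrow> ereal ^ 'n) \<Rightarrow>
   (ereal ^ 'n) set \<Rightarrow> real ^ 'n" where
  "inner_lift K b F = (SOME v. tpoint v \<in> relint K F \<and> tsend (sed (b F)) (emb v) = b F)"

definition flag_edges ::
  "(ereal ^ 'n::finite) set set \<Rightarrow> ((ereal ^ 'n) set \<Rightarrow> ereal ^ 'n) \<Rightarrow>
   (ereal ^ 'n) set list \<Rightarrow> (real ^ 'n) list" where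
  "flag_edges K b Fs = map (\<lambda>(F, F'). inner_lift K b F' - inner_lift K b F) (zip Fs (tl Fs))"

text \<open>An arbitrary ordering; the chains below do not depend on it.\<close>

definition listing :: "'a set \<Rightarrow> 'a list" where
  "listing A = (SOME xs. distinct xs \<and> set xs = A)"

text \<open>
  The chain \<open>c[-r]\<close>, for the propeller \<open>c\<close> with coefficients \<open>\<rho>\<close> along the simplex \<open>D\<close> oriented by the
  ordering \<open>ds\<close> of its vertices. For \<open>r = tdim D + 1\<close> the sum is empty and the chain is \<open>0\<close>.
\<close>

definition shifted_chain ::
  "(ereal ^ 'n::finite) set set \<Rightarrow> ((ereal ^ 'n) set \<Rightarrow> ereal ^ 'n) \<Rightarrow>
   (ereal ^ 'n) set \<Rightarrow> (ereal ^ 'n) list \<Rightarrow> nat \<Rightarrow> ('n generator set \<Rightarrow> rat) \<Rightarrow> nat \<Rightarrow>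
   'n chain" where
  "shifted_chain K b D ds l \<rho> r = (\<lambda>\<sigma> js.
     \<Sum>qb\<in>Link K D l. \<Sum>D'\<in>{D' \<in> K. D' \<subseteq> D \<and> tdim D' = r}.
       \<Sum>Fs\<in>{Fs \<in> dual_flags K D' (joined K D qb). b ` set Fs = \<sigma>}.
         (let qs = listing qb; xs = listing (vertices_of K D') in
            real_of_rat (\<rho> qb) *
            orientation_sign (rev (flag_edges K b Fs) @ frame xs []) (frame ds qs) *
            volume_element (joined K D' qb) (frame xs qs) js))"

end

theory Submission
  imports Defs
begin

text \<open>
  The coefficient of \<open>\<phi> \<inter> c[-r]\<close> at a barycentric simplex \<open>\<tau>\<close> is a sum over flags
  \<open>D' \<subset> F \<subset> \<dots>\<close> whose tail has image \<open>\<tau>\<close>, of the vector \<open>w\<close> from the barycenter of \<open>D'\<close> to that of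
  \<open>F\<close> wedged with the volume element of \<open>{D' qb}\<close>. If \<open>F\<close> arises from \<open>D'\<close> by adding an element of
  \<open>qb\<close>, then \<open>w\<close> is tangent to \<open>{D' qb}\<close> and the term vanishes. Otherwise \<open>F\<close> is a face \<open>D''\<close> of \<open>D\<close>
  with one more vertex \<open>v\<close> than \<open>D'\<close>, and \<open>w\<close> is, modulo the tangent space of \<open>D'\<close>, the vector
  towards \<open>v\<close> multiplied by the barycentric coordinate of \<open>v\<close> in the barycenter of \<open>D''\<close>. This
  coordinate is positive, so that the orientation signs cancel, and for fixed \<open>D''\<close> the coordinates
  sum to \<open>1\<close>, which leaves the coefficient of \<open>c[-r-1]\<close>.
\<close>

section \<open>Exterior algebra\<close>

text \<open>Cells are given as point sets, and lifts, orderings and volume elements through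
  arbitrary choices, so the combinatorial argument has to be recovered from them. A cell of generic
  sedentarity \<open>{}\<close> is encoded by its generators, the vertices and divisorial
  directions: inclusion of cells becomes inclusion of generator sets, and the dimension is their
  number minus one. Points are handled through real lifts, with equality in a stratum read modulo
  \<open>divker\<close>; polyvectors are evaluated on covectors of coordinate sum \<open>0\<close>,
  which do not see the line through \<open>1\<close>. Two kinds of choice have to drop out. A lift
  of a barycenter at infinity is ambiguous only by vectors tangent to its cell, which the
  coefficient concerned absorbs. The orderings picked for the vertices of \<open>D'\<close> and of
  \<open>D''\<close> are unrelated, but the sign comparing them enters the orientation and the
  volume element once each, so its square \<open>1\<close> remains. Finally, the chains are sums
  over flags while the cap product is a sum over simplices; the two are matched by grouping flags
  according to their image.\<close>

lemma vwedge_Nil [simp]: "vwedge v \<beta> [] = 0"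
  by (simp add: vwedge_def)

lemma vwedge_Cons:
  "vwedge v \<beta> (j # js) = (j \<bullet> v) * \<beta> js - vwedge v (\<lambda>l. \<beta> (j # l)) js"
  unfolding vwedge_def by (simp add: sum.lessThan_Suc_shift sum_negf algebra_simps del: sum.lessThan_Suc)

lemma vwedge_cong:
  assumes "set js \<subseteq> C" "\<And>j. j \<in> C \<Longrightarrow> j \<bullet> v = j \<bullet> w"
    "\<And>l. set l \<subseteq> C \<Longrightarrow> \<beta> l = \<gamma> l"
  shows "vwedge v \<beta> js = vwedge w \<gamma> js"
  unfolding vwedge_def
proof (rule sum.cong[OF refl])
  fix a assume a: "a \<in> {..<length js}"
  have "set (take a js @ drop (Suc a) js) \<subseteq> C"
    using assms(1) set_take_subset[of a js] set_drop_subset[of "Suc a" js] by auto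
  moreover have "js ! a \<in> C" using a assms(1) by (auto simp: subset_iff)
  ultimately show "(- 1) ^ a * (js ! a \<bullet> v) * \<beta> (take a js @ drop (Suc a) js) =
    (- 1) ^ a * (js ! a \<bullet> w) * \<gamma> (take a js @ drop (Suc a) js)"
    using assms(2,3) by auto
qed

lemma vwedge_add_left: "vwedge (v + w) \<beta> = (\<lambda>js. vwedge v \<beta> js + vwedge w \<beta> js)"
  by (simp add: vwedge_def fun_eq_iff inner_add_right algebra_simps sum.distrib)

lemma vwedge_scale_left: "vwedge (t *\<^sub>R v) \<beta> = (\<lambda>js. t * vwedge v \<beta> js)"
  by (simp add: vwedge_def fun_eq_iff algebra_simps sum_distrib_left)

lemma vwedge_zero_left: "vwedge 0 \<beta> = (\<lambda>js. 0)"
  by (simp add: vwedge_def)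

lemma vwedge_add: "vwedge v (\<lambda>js. \<beta> js + \<gamma> js) = (\<lambda>js. vwedge v \<beta> js + vwedge v \<gamma> js)"
  by (simp add: vwedge_def fun_eq_iff algebra_simps sum.distrib)

lemma vwedge_scale: "vwedge v (\<lambda>js. t * \<beta> js) = (\<lambda>js. t * vwedge v \<beta> js)"
  by (simp add: vwedge_def fun_eq_iff algebra_simps sum_distrib_left)

lemma vwedge_zero: "vwedge v (\<lambda>js. 0) = (\<lambda>js. 0)"
  by (simp add: vwedge_def)

lemma vwedge_sum: "vwedge v (\<lambda>js. \<Sum>a\<in>A. f a js) = (\<lambda>js. \<Sum>a\<in>A. vwedge v (f a) js)"
  by (induction A rule: infinite_finite_induct) (simp_all add: vwedge_zero vwedge_add)

text \<open>Induction on the covectors. When both products are expanded along the first covector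
  \<open>j\<close>, the two terms in which \<open>j\<close> meets only one vector trade places with
  opposite signs; in the remaining term both products act on
  \<open>\<lambda>l. \<beta> (j # l)\<close>, and the induction hypothesis applies.\<close>

lemma vwedge_anticommute: "vwedge v (vwedge w \<beta>) js = - vwedge w (vwedge v \<beta>) js"
proof (induction js arbitrary: \<beta>)
  case (Cons j js)
  have "vwedge v (\<lambda>l. vwedge w \<beta> (j # l)) js =
      (j \<bullet> w) * vwedge v \<beta> js - vwedge v (vwedge w (\<lambda>l. \<beta> (j # l))) js" for v w
    using vwedge_add[of v "\<lambda>l. (j \<bullet> w) * \<beta> l" "\<lambda>l. (-1) * vwedge w (\<lambda>l. \<beta> (j # l)) l"]
    unfolding vwedge_Cons by (simp only: vwedge_scale) (simp add: fun_eq_iff)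
  then show ?case
    using Cons.IH[of "\<lambda>l. \<beta> (j # l)"] by (simp add: vwedge_Cons)
qed simp

lemma vwedge_self: "vwedge v (vwedge v \<beta>) = (\<lambda>js. 0)"
  using vwedge_anticommute[of v v \<beta>] by (auto simp: fun_eq_iff)

text \<open>Left multiplication by a list, with an arbitrary factor on the right and without the
  projection built into \<open>wedge\<close>. Frames can thus be cut anywhere and signs computed for
  one piece at a time.\<close>

definition wedges :: "(real ^ 'n::finite) list \<Rightarrow> 'n polyvector \<Rightarrow> 'n polyvector" where
  "wedges us \<beta> = foldr vwedge us \<beta>"

lemma wedges_simps [simp]:
  "wedges [] \<beta> = \<beta>" "wedges (u # us) \<beta> = vwedge u (wedges us \<beta>)"
  "wedges (us @ vs) \<beta> = wedges us (wedges vs \<beta>)"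
  by (simp_all add: wedges_def)

lemma wedges_scale: "wedges us (\<lambda>js. t * \<beta> js) = (\<lambda>js. t * wedges us \<beta> js)"
  by (induction us) (simp_all add: vwedge_scale)

lemma wedges_vwedge:
  "wedges us (vwedge v \<beta>) = (\<lambda>js. (- 1) ^ length us * vwedge v (wedges us \<beta>) js)"
proof (induction us)
  case (Cons u us)
  have "wedges (u # us) (vwedge v \<beta>) = (\<lambda>js. (- 1) ^ length us * vwedge u (vwedge v (wedges us \<beta>)) js)"
    using Cons.IH by (simp add: vwedge_scale)
  also have "\<dots> = (\<lambda>js. (- 1) ^ length (u # us) * vwedge v (wedges (u # us) \<beta>) js)"
    using vwedge_anticommute[of u v] by (simp add: fun_eq_iff)
  finally show ?case .
qed simp

text \<open>By linearity \<open>v\<close> may be taken to be an entry of \<open>us\<close>. Moving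
  that entry to the front costs only a sign and leaves a product with \<open>v\<close> twice in
  succession.\<close>

lemma wedges_in_span:
  assumes "v \<in> span (set us)"
  shows "vwedge v (wedges us \<beta>) = (\<lambda>js. 0)"
  using assms
proof (induction rule: span_induct_alt)
  case base
  then show ?case by (rule vwedge_zero_left)
next
  case (step t x y)
  from step(1) obtain as bs where us: "us = as @ x # bs"
    using split_list by metis
  have "vwedge x (wedges us \<beta>) = (\<lambda>js. (-1) ^ length as * vwedge x (vwedge x (wedges as (wedges bs \<beta>))) js)"
    unfolding us by (simp add: wedges_vwedge vwedge_scale)
  then have "vwedge x (wedges us \<beta>) = (\<lambda>js. 0)" by (simp add: vwedge_self)
  then show ?case using step(2) by (simp add: vwedge_add_left vwedge_scale_left)
qed

text \<open>The factor \<open>us\<close> annihilates its own span, so vectors further right matter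
  only modulo that span. Each of them is moved in front of \<open>us\<close>, replaced there, and
  moved back with the same sign. This is the mechanism behind a change of base vertex in a
  frame.\<close>

lemma wedges_absorb:
  assumes "list_all2 (\<lambda>v w. v - w \<in> span (set us)) vs ws"
  shows "wedges us (wedges vs \<beta>) = wedges us (wedges ws \<beta>)"
  using assms
proof (induction rule: list_all2_induct)
  case (Cons v vs w ws)
  have 1: "vwedge (v - w) (wedges us \<gamma>) = (\<lambda>js. 0)" for \<gamma>
    using Cons(1) by (rule wedges_in_span)
  have "vwedge v (wedges us \<gamma>) = vwedge w (wedges us \<gamma>)" for \<gamma>
    using vwedge_add_left[of w "v - w" "wedges us \<gamma>"] 1[of \<gamma>] by simp
  then show ?case using Cons(3) by (simp add: wedges_vwedge)
qed simp

text \<open>The sign is chosen before \<open>\<beta>\<close>, so one permutation contributes the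
  same sign whatever stands to the right of it.\<close>

lemma wedges_permute:
  assumes "mset us = mset vs"
  shows "\<exists>\<epsilon>\<in>{1, -1}. \<forall>\<beta>. wedges us \<beta> = (\<lambda>js. \<epsilon> * wedges vs \<beta> js)"
  using assms
proof (induction us arbitrary: vs)
  case (Cons u us)
  then have "u \<in> set vs" by (metis list.set_intros(1) set_mset_mset)
  then obtain as bs where vs: "vs = as @ u # bs" using split_list by metis
  then have "mset us = mset (as @ bs)" using Cons.prems by simp
  from Cons.IH[OF this] obtain \<epsilon> where \<epsilon>: "\<epsilon> = 1 \<or> \<epsilon> = -1"
    "\<And>\<beta>. wedges us \<beta> = (\<lambda>js. \<epsilon> * wedges (as @ bs) \<beta> js)" by blast
  have "wedges (u # us) \<beta> = (\<lambda>js. (\<epsilon> * (-1) ^ length as) * wedges vs \<beta> js)" for \<beta>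
    unfolding vs by (simp add: \<epsilon>(2) vwedge_scale wedges_vwedge fun_eq_iff power_add[symmetric])
  moreover have "\<epsilon> * (-1) ^ length as \<in> {1, -1}"
    using \<epsilon>(1) by (cases "even (length as)") auto
  ultimately show ?case by blast
qed simp

section \<open>Polyvectors as forms on covectors of coordinate sum zero\<close>

abbreviation unit_pv :: "'n::finite polyvector" where
  "unit_pv \<equiv> (\<lambda>js. if js = [] then 1 else 0)"

lemma wedge_wedges: "wedge us = pv_project {} (wedges us unit_pv)"
  by (simp add: wedge_def wedges_def)

lemma pv_project_wedge: "pv_project {} (wedge us) = wedge us"
  by (simp add: wedge_def pv_project_def fun_eq_iff)

lemma covectors_antimono: "I \<subseteq> I' \<Longrightarrow> covectors I' \<subseteq> covectors I"
  by (auto simp: covectors_def)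

lemma inner_one: "(j :: real ^ 'n::finite) \<bullet> 1 = (\<Sum>i\<in>UNIV. j $ i)"
  by (simp add: inner_vec_def)

lemma covectors_inner:
  assumes "j \<in> covectors I" "v - w \<in> span {1}"
  shows "j \<bullet> v = j \<bullet> w"
proof -
  obtain t where "v - w = t *\<^sub>R 1" using assms(2) by (auto simp: span_singleton)
  then have "v = w + t *\<^sub>R 1" by (simp add: algebra_simps)
  moreover have "j \<bullet> 1 = 0" using assms(1) by (simp add: inner_one covectors_def)
  ultimately show ?thesis by (simp add: inner_add_right)
qed

text \<open>Covectors in \<open>covectors I\<close> have coordinate sum \<open>0\<close> and are
  therefore blind to the line through \<open>1\<close>. A tangent vector may accordingly be
  represented by any of its real lifts.\<close>

lemma pv_project_vwedge:
  assumes "v - w \<in> span {1}" "pv_project {} \<beta> = pv_project {} \<gamma>"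
  shows "pv_project I (vwedge v \<beta>) = pv_project I (vwedge w \<gamma>)"
proof
  fix js
  have "vwedge v \<beta> js = vwedge w \<gamma> js" if "set js \<subseteq> covectors I"
  proof (rule vwedge_cong[where C = "covectors {}"])
    show "set js \<subseteq> covectors {}" using that covectors_antimono[of "{}" I] by auto
    show "j \<bullet> v = j \<bullet> w" if "j \<in> covectors {}" for j
      using that assms(1) by (rule covectors_inner)
    show "\<beta> l = \<gamma> l" if "set l \<subseteq> covectors {}" for l
      using fun_cong[OF assms(2), of l] that by (simp add: pv_project_def)
  qed
  then show "pv_project I (vwedge v \<beta>) js = pv_project I (vwedge w \<gamma>) js"
    by (simp add: pv_project_def)
qed

lemma wedge_Cons: "pv_project {} (vwedge v (wedge us)) = wedge (v # us)"
  unfolding wedge_wedges wedges_simps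
  by (rule pv_project_vwedge) (auto simp: span_zero pv_project_def)

lemma wedge_cong:
  assumes "list_all2 (\<lambda>v w. v - w \<in> span {1}) us vs"
  shows "wedge us = wedge vs"
  using assms
proof (induction rule: list_all2_induct)
  case (Cons v vs w ws)
  then show ?case unfolding wedge_wedges wedges_simps
    by (intro pv_project_vwedge) auto
qed simp

text \<open>The component along \<open>1\<close> is killed by the covectors, and the rest of
  \<open>v\<close> repeats factors of the product.\<close>

lemma vwedge_project_zero:
  assumes "v \<in> span (insert 1 (set us))"
  shows "pv_project I (vwedge v (wedge us)) = (\<lambda>js. 0)"
proof -
  obtain t where t: "v - t *\<^sub>R 1 \<in> span (set us)"
    using assms by (auto simp: span_insert)
  have "pv_project I (vwedge v (wedge us)) = pv_project I (vwedge (v - t *\<^sub>R 1) (wedges us unit_pv))"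
    by (rule pv_project_vwedge) (auto simp: span_singleton wedge_wedges pv_project_def)
  then show ?thesis using wedges_in_span[OF t] by (simp add: pv_project_def)
qed

text \<open>Independence modulo the line through \<open>1\<close>, stated by positions so that a
  repeated vector already counts as a dependence. It is the second clause of
  \<open>lattice_basis\<close> for a set of generic sedentarity \<open>{}\<close>.\<close>

definition independent_list :: "(real ^ 'n::finite) list \<Rightarrow> bool" where
  "independent_list us \<longleftrightarrow>
     (\<forall>c :: nat \<Rightarrow> real. (\<Sum>k<length us. c k *\<^sub>R us ! k) \<in> span {1} \<longrightarrow> (\<forall>k<length us. c k = 0))"

lemma independent_listD:
  fixes us :: "(real ^ 'n::finite) list"
  assumes "independent_list us"
  shows "distinct us" "1 \<notin> set us" "independent (insert 1 (set us))"
proof -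
  have sum1: "(\<Sum>k<length us. (if k = a then t else if k = b then s else 0) *\<^sub>R us ! k) =
      t *\<^sub>R us ! a + s *\<^sub>R us ! b" if "a < length us" "b < length us" "a \<noteq> b" for a b t s
  proof -
    have "(\<Sum>k<length us. (if k = a then t else if k = b then s else 0) *\<^sub>R us ! k) =
       (\<Sum>k<length us. (if k = a then t *\<^sub>R us ! k else 0) + (if k = b then s *\<^sub>R us ! k else 0))"
      using that by (intro sum.cong) auto
    then show ?thesis using that by (simp add: sum.distrib)
  qed
  show d: "distinct us"
  proof (rule ccontr)
    assume "\<not> distinct us"
    then obtain a b where ab: "a < length us" "b < length us" "a \<noteq> b" "us ! a = us ! b"
      by (auto simp: distinct_conv_nth)
    have "(\<Sum>k<length us. (if k = a then 1 else if k = b then -1 else 0) *\<^sub>R us ! k) \<in> span {1}"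
      using sum1[of a b 1 "-1"] ab by (simp add: span_zero)
    then have "(if a = a then 1 else if a = b then -1 else 0) = (0 :: real)"
      using assms[unfolded independent_list_def, THEN spec[of _ "\<lambda>k. if k = a then 1 else if k = b then -1 else 0"]] ab(1)
      by blast
    then show False by simp
  qed
  show n1: "1 \<notin> set us"
  proof
    assume "1 \<in> set us"
    then obtain a where a: "a < length us" "us ! a = 1" by (auto simp: in_set_conv_nth)
    have "(\<Sum>k<length us. (if k = a then 1 else 0) *\<^sub>R us ! k) = 
        (\<Sum>k<length us. if k = a then us ! k else 0)"
      by (intro sum.cong) auto
    then have "(\<Sum>k<length us. (if k = a then 1 else 0) *\<^sub>R us ! k) \<in> span {1}"
      using a by (simp add: span_base)
    then have "(if a = a then 1 else 0) = (0 :: real)"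
      using assms[unfolded independent_list_def, THEN spec[of _ "\<lambda>k. if k = a then 1 else 0"]] a(1)
      by blast
    then show False by simp
  qed
  show "independent (insert 1 (set us))"
  proof (rule independent_if_scalars_zero)
    fix f :: "real ^ 'n \<Rightarrow> real" and x
    assume s: "(\<Sum>x\<in>insert 1 (set us). f x *\<^sub>R x) = 0" and x: "x \<in> insert 1 (set us)"
    have "(\<Sum>x\<in>set us. f x *\<^sub>R x) = (- f 1) *\<^sub>R 1"
      using s n1 by (simp add: add_eq_0_iff)
    moreover have eq: "(\<Sum>x\<in>set us. f x *\<^sub>R x) = (\<Sum>k<length us. f (us ! k) *\<^sub>R us ! k)"
      using sum.reindex_bij_betw[OF bij_betw_nth[OF d refl refl], of "\<lambda>x. f x *\<^sub>R x"] by simp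
    ultimately have "(\<Sum>k<length us. f (us ! k) *\<^sub>R us ! k) \<in> span {1}"
      by (metis insertI1 span_base span_scale)
    then have z: "\<forall>k<length us. f (us ! k) = 0"
      using assms[unfolded independent_list_def, THEN spec[of _ "\<lambda>k. f (us ! k)"]] by blast
    then have "(\<Sum>x\<in>set us. f x *\<^sub>R x) = 0" unfolding eq by simp
    then have "f 1 = 0" using s n1 by (simp add: vec_eq_iff)
    then show "f x = 0" using x z by (auto simp: in_set_conv_nth)
  qed simp
qed

definition dual_covectors :: "(real ^ 'n::finite) list \<Rightarrow> (real ^ 'n) list \<Rightarrow> bool" where
  "dual_covectors us js \<longleftrightarrow> length js = length us \<and> set js \<subseteq> covectors {} \<and>
     (\<forall>a<length us. \<forall>k<length us. js ! a \<bullet> us ! k = (if a = k then 1 else 0))"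

lemma dual_covectors_exist:
  assumes "independent_list us"
  shows "\<exists>js. dual_covectors us js"
proof -
  note ind = independent_listD[OF assms]
  have "\<exists>j. j \<in> covectors {} \<and> (\<forall>k<length us. j \<bullet> us ! k = (if a = k then 1 else 0))" for a
  proof -
    obtain f where f: "linear f"
      "\<And>x. x \<in> insert 1 (set us) \<Longrightarrow> f x = (if a < length us \<and> x = us ! a then 1 else 0 :: real)"
      using linear_independent_extend[OF ind(3), of "\<lambda>x. if a < length us \<and> x = us ! a then 1 else 0 :: real"]
      by blast
    \<comment> \<open>\<open>adjoint f 1\<close> is the vector whose inner product represents the
      functional \<open>f\<close>. Since \<open>f\<close> vanishes on \<open>1\<close>, its
      coordinate sum is \<open>0\<close>.\<close>
    define j where "j = adjoint f 1"
    have j: "j \<bullet> x = f x" for x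
      using adjoint_works[OF f(1), of x 1] by (simp add: j_def inner_commute)
    have "j \<bullet> 1 = 0" using f(2)[of 1] ind(2) j by (metis insertI1 nth_mem)
    then have "j \<in> covectors {}" by (simp add: covectors_def inner_one)
    moreover have "j \<bullet> us ! k = (if a = k then 1 else 0)" if "k < length us" for k
      using f(2)[of "us ! k"] j that ind(1) by (auto simp: nth_eq_iff_index_eq)
    ultimately show ?thesis by blast
  qed
  then obtain J where J: "\<And>a. J a \<in> covectors {}"
    "\<And>a k. k < length us \<Longrightarrow> J a \<bullet> us ! k = (if a = k then 1 else 0)" by metis
  have "dual_covectors us (map J [0..<length us])"
    using J by (auto simp: dual_covectors_def)
  then show ?thesis by blast
qed

text \<open>The matrix of pairings is the identity. In the expansion along \<open>u\<close> every
  covector but the first vanishes on \<open>u\<close>, so a single term with coefficient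
  \<open>1\<close> survives.\<close>

lemma wedge_dual:
  assumes "dual_covectors us js"
  shows "wedge us js = 1"
proof -
  have "wedges us unit_pv js = 1"
    using assms
  proof (induction us arbitrary: js)
    case Nil
    then show ?case by (auto simp: dual_covectors_def)
  next
    case (Cons u us)
    then obtain j js' where js: "js = j # js'" by (cases js) (auto simp: dual_covectors_def)
    have d: "\<forall>a<Suc (length us). \<forall>k<Suc (length us). (j # js') ! a \<bullet> (u # us) ! k = (if a = k then 1 else 0)"
      and len: "length js' = length us"
      using Cons.prems by (auto simp: dual_covectors_def js)
    have ju: "j \<bullet> u = 1" using d[rule_format, of 0 0] by simp
    have ja: "js' ! a \<bullet> u = 0" if "a < length us" for a
      using d[rule_format, of "Suc a" 0] that by auto
    have "js' ! a \<bullet> us ! k = (if a = k then 1 else 0)" if "a < length us" "k < length us" for a k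
      using d[rule_format, of "Suc a" "Suc k"] that by auto
    then have "dual_covectors us js'"
      using Cons.prems len by (auto simp: dual_covectors_def js)
    moreover have "vwedge u \<beta> js' = 0" for \<beta>
      unfolding vwedge_def using ja len by simp
    ultimately show ?case using Cons.IH ju by (simp add: js vwedge_Cons)
  qed
  then show ?thesis
    using assms by (simp add: wedge_wedges pv_project_def dual_covectors_def)
qed

lemma wedge_nonzero: "independent_list us \<Longrightarrow> wedge us \<noteq> (\<lambda>js. 0)"
  using dual_covectors_exist wedge_dual by (metis zero_neq_one)

lemma wedge_integer:
  assumes "\<And>j u. j \<in> set js \<Longrightarrow> u \<in> set us \<Longrightarrow> j \<bullet> u \<in> \<int>"
  shows "wedge us js \<in> \<int>"
proof -
  have "wedges us unit_pv js \<in> \<int>" using assms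
  proof (induction us arbitrary: js)
    case (Cons u us)
    have "wedges us unit_pv (take a js @ drop (Suc a) js) \<in> \<int>" for a
      using Cons.prems set_take_subset[of a js] set_drop_subset[of "Suc a" js]
      by (intro Cons.IH) auto
    moreover have "js ! a \<bullet> u \<in> \<int>" if "a < length js" for a
      using Cons.prems that by auto
    ultimately show ?case unfolding wedges_simps vwedge_def
      by (intro Ints_sum Ints_mult) (auto intro!: Ints_power)
  qed auto
  then show ?thesis by (auto simp: wedge_wedges pv_project_def)
qed

text \<open>Nonvanishing of \<open>wedge vs\<close> makes the ratio of a polyvector to it unique, so
  the positive and the negative case exclude each other. If \<open>us'\<close> has no nonzero ratio
  to \<open>vs\<close>, neither has \<open>us\<close>, and both signs take the default value
  \<open>0\<close>.\<close>

lemma orientation_sign_scale: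
  assumes "wedge vs \<noteq> (\<lambda>js. 0)" "t \<noteq> 0" "wedge us = (\<lambda>js. t * wedge us' js)"
  shows "orientation_sign us vs = sgn t * orientation_sign us' vs"
proof -
  obtain js0 where js0: "wedge vs js0 \<noteq> 0" using assms(1) by blast
  have uniq: "a = a'" if "wedge us' = (\<lambda>js. a * wedge vs js)" "wedge us' = (\<lambda>js. a' * wedge vs js)" for a a'
    using fun_cong[OF that(1), of js0] fun_cong[OF that(2), of js0] js0 by simp
  have iff: "wedge us = (\<lambda>js. a * wedge vs js) \<longleftrightarrow> wedge us' = (\<lambda>js. (a / t) * wedge vs js)" for a
    unfolding assms(3) using assms(2) by (auto simp: fun_eq_iff field_simps)
  have pos: "(\<exists>a>0. wedge us = (\<lambda>js. a * wedge vs js)) \<longleftrightarrow>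
    (\<exists>a. a * t > 0 \<and> wedge us' = (\<lambda>js. a * wedge vs js))"
    unfolding iff using assms(2) by (metis nonzero_eq_divide_eq)
  have neg: "(\<exists>a<0. wedge us = (\<lambda>js. a * wedge vs js)) \<longleftrightarrow>
    (\<exists>a. a * t < 0 \<and> wedge us' = (\<lambda>js. a * wedge vs js))"
    unfolding iff using assms(2) by (metis nonzero_eq_divide_eq)
  show ?thesis
  proof (cases "\<exists>a. a \<noteq> 0 \<and> wedge us' = (\<lambda>js. a * wedge vs js)")
    case True
    then obtain a where a: "a \<noteq> 0" "wedge us' = (\<lambda>js. a * wedge vs js)" by blast
    then have "(\<exists>a. P a \<and> wedge us' = (\<lambda>js. a * wedge vs js)) \<longleftrightarrow> P a" for P
      using uniq by blast
    then show ?thesis unfolding orientation_sign_def pos neg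
      using a(1) assms(2) by (auto simp: sgn_if mult_less_0_iff zero_less_mult_iff)
  next
    case False
    then have "(\<exists>a. P a \<and> wedge us' = (\<lambda>js. a * wedge vs js)) = False" if "\<not> P 0" for P
      using that by metis
    from this[of "\<lambda>a. a > 0"] this[of "\<lambda>a. a < 0"] this[of "\<lambda>a. a * t > 0"] this[of "\<lambda>a. a * t < 0"]
    show ?thesis unfolding orientation_sign_def pos neg by (simp only:) simp
  qed
qed

section \<open>Points of the strata and cells\<close>

text \<open>Every point of \<open>tproj\<close> has this form with \<open>S\<close> its sedentarity.
  Equality of such points is membership of the difference of lifts in \<open>divker S\<close>, which
  turns questions about cells into linear algebra.\<close>

definition stratum_point :: "'n::finite set \<Rightarrow> real ^ 'n \<Rightarrow> ereal ^ 'n" where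
  "stratum_point S u = tsend S (emb u)"

lemma sum_divisorial_nth:
  fixes f :: "'n::finite \<Rightarrow> real"
  shows "(\<Sum>i\<in>J. f i *\<^sub>R divisorial i) $ k = (if k \<in> J then - f k else 0)"
proof -
  have "(\<Sum>i\<in>J. f i *\<^sub>R divisorial i) $ k = (\<Sum>i\<in>J. if k = i then - f k else 0)"
    unfolding sum_component by (intro sum.cong) (auto simp: divisorial_def axis_def)
  then show ?thesis by simp
qed

text \<open>The divisorial vectors of \<open>S\<close> change the coordinates in \<open>S\<close> at
  will, while \<open>1\<close> shifts all the others simultaneously.\<close>

lemma divker_iff: "d \<in> divker S \<longleftrightarrow> (\<exists>t. \<forall>i. i \<notin> S \<longrightarrow> d $ i = t)"
proof
  assume "d \<in> divker S"
  then obtain t where t: "d - t *\<^sub>R 1 \<in> span (divisorial ` S)"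
    by (auto simp: divker_def span_insert)
  have "x $ i = 0" if "x \<in> span (divisorial ` S)" "i \<notin> S" for x :: "real ^ 'a" and i
    using that(1) by (induction rule: span_induct_alt) (use that(2) in \<open>auto simp: divisorial_def axis_def split: if_splits\<close>)
  from this[OF t] show "\<exists>t. \<forall>i. i \<notin> S \<longrightarrow> d $ i = t" by auto
next
  assume "\<exists>t. \<forall>i. i \<notin> S \<longrightarrow> d $ i = t"
  then obtain t where t: "\<And>i. i \<notin> S \<Longrightarrow> d $ i = t" by blast
  have "d = t *\<^sub>R 1 + (\<Sum>i\<in>S. (t - d $ i) *\<^sub>R divisorial i)"
  proof -
    have "(\<Sum>i\<in>S. (t - d $ i) *\<^sub>R divisorial i) $ k = (if k \<in> S then d $ k - t else 0)" for k
      by (simp only: sum_divisorial_nth) simp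
    then show ?thesis using t by (simp add: vec_eq_iff del: sum_component)
  qed
  also have "\<dots> \<in> divker S" unfolding divker_def
    by (intro span_add span_scale span_sum) (auto intro: span_base)
  finally show "d \<in> divker S" .
qed

lemma divker_subspace: "subspace (divker S)" by (simp add: divker_def)
lemmas divker_arith = subspace_0[OF divker_subspace] subspace_add[OF divker_subspace]
  subspace_diff[OF divker_subspace] subspace_scale[OF divker_subspace]

lemma divker_empty: "divker {} = span {1}" by (simp add: divker_def)

lemma divker_mono: "S \<subseteq> T \<Longrightarrow> divker S \<subseteq> divker T"
  unfolding divker_def by (intro span_mono) auto

lemma divisorial_in_divker: "i \<in> S \<Longrightarrow> divisorial i \<in> divker S"
  by (auto simp: divker_def intro: span_base)

lemma stratum_point_nth:
  assumes "S \<noteq> UNIV"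
  shows "stratum_point S u $ i = (if i \<in> S then - \<infinity> else ereal (u $ i - Max ((\<lambda>j. u $ j) ` (- S))))"
proof -
  define m where "m = Max ((\<lambda>j. u $ j) ` (- S))"
  have ne: "- S \<noteq> {}" using assms by auto
  have "Max (range (($) (\<chi> i. if i \<in> S then - \<infinity> else emb u $ i))) = ereal m"
  proof (rule Max_eqI)
    have "m \<in> (\<lambda>j. u $ j) ` (- S)" unfolding m_def using ne by (intro Max_in) auto
    then obtain j where "j \<notin> S" "m = u $ j" by auto
    then show "ereal m \<in> range (($) (\<chi> i. if i \<in> S then - \<infinity> else emb u $ i))"
      by (auto simp: emb_def intro!: image_eqI[of _ _ j])
    show "y \<le> ereal m" if "y \<in> range (($) (\<chi> i. if i \<in> S then - \<infinity> else emb u $ i))" for y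
      using that by (auto simp: emb_def m_def)
  qed auto
  then show ?thesis by (simp add: stratum_point_def tsend_def tnormalize_def m_def emb_def)
qed

lemma sed_stratum_point: "S \<noteq> UNIV \<Longrightarrow> sed (stratum_point S u) = S"
  by (auto simp: sed_def stratum_point_nth)

lemma stratum_point_tproj:
  assumes "S \<noteq> UNIV" shows "stratum_point S u \<in> tproj"
proof -
  have "Max ((\<lambda>j. u $ j) ` (- S)) \<in> (\<lambda>j. u $ j) ` (- S)"
    using assms by (intro Max_in) auto
  then obtain j where j: "j \<notin> S" "Max ((\<lambda>j. u $ j) ` (- S)) = u $ j" by auto
  then have "stratum_point S u $ j = 0" using assms by (simp add: stratum_point_nth zero_ereal_def)
  moreover have "stratum_point S u $ i \<le> 0" for i
    using assms by (auto simp: stratum_point_nth zero_ereal_def)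
  ultimately show ?thesis by (auto simp: tproj_def)
qed

text \<open>Normalisation subtracts the maximum over the coordinates outside \<open>S\<close>, so
  what survives of a lift is its coordinates outside \<open>S\<close> up to a common shift.\<close>

lemma stratum_point_eq_iff:
  assumes "S \<noteq> UNIV"
  shows "stratum_point S u = stratum_point S v \<longleftrightarrow> u - v \<in> divker S"
proof
  assume eq: "stratum_point S u = stratum_point S v"
  have "(u - v) $ i = Max ((\<lambda>j. u $ j) ` (- S)) - Max ((\<lambda>j. v $ j) ` (- S))" if "i \<notin> S" for i
    using arg_cong[OF eq, of "\<lambda>x. x $ i"] that assms by (simp add: stratum_point_nth)
  then show "u - v \<in> divker S" unfolding divker_iff by blast
next
  assume "u - v \<in> divker S"
  then obtain t where t: "\<And>i. i \<notin> S \<Longrightarrow> u $ i = v $ i + t" by (auto simp: divker_iff algebra_simps)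
  have "(\<lambda>j. u $ j) ` (- S) = (\<lambda>x. x + t) ` (\<lambda>j. v $ j) ` (- S)"
    using t by (auto simp: image_image)
  moreover have "Max ((\<lambda>x. x + t) ` (\<lambda>j. v $ j) ` (- S)) = Max ((\<lambda>j. v $ j) ` (- S)) + t"
    using assms by (intro Max_eqI) (auto intro!: image_eqI[OF _ Max_in])
  ultimately show "stratum_point S u = stratum_point S v"
    using t assms by (simp add: vec_eq_iff stratum_point_nth)
qed

lemma tproj_nth:
  assumes "x \<in> tproj" "i \<notin> sed x" shows "x $ i = ereal (rvec x $ i)"
proof -
  have "x $ i \<le> 0" "x $ i \<noteq> - \<infinity>" using assms by (auto simp: tproj_def sed_def)
  then show ?thesis by (cases "x $ i") (auto simp: rvec_def)
qed

lemma sed_not_UNIV: "x \<in> tproj \<Longrightarrow> sed x \<noteq> UNIV"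
proof
  assume "x \<in> tproj" "sed x = UNIV"
  then obtain i where "x $ i = 0" "i \<in> sed x" by (auto simp: tproj_def)
  then show False by (simp add: sed_def)
qed

lemma tsend_eq:
  assumes "x \<in> tproj" shows "tsend A x = stratum_point (sed x \<union> A) (rvec x)"
proof -
  have "(\<chi> i. if i \<in> A then - \<infinity> else x $ i) = (\<chi> i. if i \<in> sed x \<union> A then - \<infinity> else emb (rvec x) $ i)"
    using tproj_nth[OF assms] by (auto simp: vec_eq_iff sed_def emb_def)
  then show ?thesis by (simp add: tsend_def stratum_point_def)
qed

lemma stratum_point_rvec:
  assumes "x \<in> tproj" shows "stratum_point (sed x) (rvec x) = x"
proof -
  have U: "sed x \<noteq> UNIV" using assms by (rule sed_not_UNIV)
  obtain j where j: "x $ j = 0" using assms by (auto simp: tproj_def)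
  have "Max ((\<lambda>j. rvec x $ j) ` (- sed x)) = 0"
  proof (rule Max_eqI)
    show "0 \<in> (\<lambda>j. rvec x $ j) ` (- sed x)"
      using j by (intro image_eqI[of _ _ j]) (auto simp: rvec_def sed_def)
    show "y \<le> 0" if y: "y \<in> (\<lambda>j. rvec x $ j) ` (- sed x)" for y
    proof -
      obtain i where i: "i \<notin> sed x" "y = rvec x $ i" using y by blast
      have "x $ i \<le> 0" using assms by (auto simp: tproj_def)
      then show ?thesis using tproj_nth[OF assms i(1)] i(2) by simp
    qed
  qed auto
  then have "stratum_point (sed x) (rvec x) $ i = x $ i" for i
  proof -
    have "x $ i = (if i \<in> sed x then - \<infinity> else ereal (rvec x $ i))"
      using tproj_nth[OF assms, of i] by (simp add: sed_def)
    with \<open>Max _ = 0\<close> show ?thesis by (simp add: stratum_point_nth[OF U])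
  qed
  then show ?thesis by (simp add: vec_eq_iff)
qed

lemma continuous_stratum_point:
  assumes "S \<noteq> UNIV"
  shows "continuous_on UNIV (stratum_point S)"
proof -
  have M: "continuous_on UNIV (\<lambda>u :: real ^ 'a. Max ((\<lambda>j. u $ j) ` A))" if "finite A" "A \<noteq> {}" for A
    using that
  proof (induction rule: finite_ne_induct)
    case (insert a A)
    then have "(\<lambda>u :: real ^ 'a. Max ((\<lambda>j. u $ j) ` insert a A)) = (\<lambda>u. max (u $ a) (Max ((\<lambda>j. u $ j) ` A)))"
      by (auto simp: fun_eq_iff)
    then show ?case using insert by (auto intro!: continuous_intros continuous_on_max)
  qed (auto intro!: continuous_intros)
  have "continuous_on UNIV (\<lambda>u. stratum_point S u $ i)" for i
    unfolding stratum_point_nth[OF assms]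
    using assms by (cases "i \<in> S") (auto intro!: continuous_intros continuous_on_ereal M)
  then have "continuous_on UNIV (\<lambda>u. \<chi> i. stratum_point S u $ i)"
    by (intro continuous_on_vec_lambda)
  then show ?thesis by (simp add: vec_lambda_eta)
qed

section \<open>Cells described by their generators\<close>

fun gen_vec :: "'n::finite generator \<Rightarrow> real ^ 'n" where
  "gen_vec (Vertex x) = rvec x"
| "gen_vec (Divisorial i) = divisorial i"

text \<open>Homogenisation: vertices sit at height \<open>1\<close> and recession directions at
  height \<open>0\<close>. Points are combinations of total height \<open>1\<close>, tangent vectors
  combinations of total height \<open>0\<close>.\<close>

fun gen_deg :: "'n::finite generator \<Rightarrow> real" where
  "gen_deg (Vertex x) = 1"
| "gen_deg (Divisorial i) = 0"

abbreviation gen_verts :: "'n::finite generator set \<Rightarrow> (ereal ^ 'n) set" where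
  "gen_verts Q \<equiv> {x. Vertex x \<in> Q}"

abbreviation gen_divs :: "'n::finite generator set \<Rightarrow> 'n set" where
  "gen_divs Q \<equiv> {i. Divisorial i \<in> Q}"

text \<open>One set holds vertices and recession directions alike, so that faces and joins
  correspond to subsets and unions of generator sets.\<close>

definition gen_cell :: "'n::finite generator set \<Rightarrow> (ereal ^ 'n) set" where
  "gen_cell Q = tcell (gen_verts Q) (gen_divs Q)"

definition gen_hull :: "'n::finite generator set \<Rightarrow> (real ^ 'n) set" where
  "gen_hull Q = {\<Sum>q\<in>Q. \<alpha> q *\<^sub>R gen_vec q | \<alpha>. (\<forall>q\<in>Q. 0 \<le> \<alpha> q) \<and> (\<Sum>q\<in>Q. gen_deg q * \<alpha> q) = 1}"

text \<open>The last condition guarantees that the stratum where all recession directions have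
  become infinite is still a stratum of \<open>tproj\<close>.\<close>

definition cell_gens :: "'n::finite set \<Rightarrow> 'n generator set \<Rightarrow> bool" where
  "cell_gens S Q \<longleftrightarrow> finite Q \<and> gen_verts Q \<noteq> {} \<and>
     (\<forall>x. Vertex x \<in> Q \<longrightarrow> x \<in> tproj \<and> sed x = S) \<and>
     gen_divs Q \<inter> S = {} \<and> S \<union> gen_divs Q \<noteq> UNIV"

lemma gens_union: "Q = Vertex ` gen_verts Q \<union> Divisorial ` gen_divs Q"
proof -
  have "q \<in> Vertex ` gen_verts Q \<union> Divisorial ` gen_divs Q" if "q \<in> Q" for q
    using that by (cases q) auto
  then show ?thesis by auto
qed

lemma finite_gens:
  assumes "finite Q" shows "finite (gen_verts Q)" "finite (gen_divs Q)"
  using finite_vimageI[OF assms, of Vertex] finite_vimageI[OF assms, of Divisorial]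
  by (simp_all add: inj_on_def vimage_def)

lemma sum_gens:
  assumes "finite Q"
  shows "(\<Sum>q\<in>Q. f q) = (\<Sum>x\<in>gen_verts Q. f (Vertex x)) + (\<Sum>i\<in>gen_divs Q. f (Divisorial i))"
proof -
  have "(\<Sum>q\<in>Q. f q) = (\<Sum>q\<in>Vertex ` gen_verts Q. f q) + (\<Sum>q\<in>Divisorial ` gen_divs Q. f q)"
    using finite_gens[OF assms] by (subst gens_union[of Q], intro sum.union_disjoint) auto
  then show ?thesis by (simp add: sum.reindex inj_on_def)
qed

lemma cell_gens_subset:
  assumes "cell_gens S Q" "Q' \<subseteq> Q" "gen_verts Q' \<noteq> {}"
  shows "cell_gens S Q'"
proof -
  have "gen_divs Q' \<subseteq> gen_divs Q" using assms(2) by auto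
  then show ?thesis using assms finite_subset[of Q' Q] unfolding cell_gens_def by blast
qed

lemma tcell_coordinate:
  fixes \<mu> :: "'n::finite \<Rightarrow> ereal"
  assumes "finite V" "\<forall>x\<in>V. x \<in> tproj \<and> sed x = S" "J \<inter> S = {}"
    and p: "\<forall>v\<in>V. 0 \<le> p v" "(\<Sum>v\<in>V. p v) = 1" and \<mu>: "\<forall>i\<in>J. 0 \<le> \<mu> i"
  shows "(\<Sum>v\<in>V. ereal (p v) * v $ i) - (if i \<in> J then \<mu> i else 0) =
      (if i \<in> S \<union> {j\<in>J. \<mu> j = \<infinity>} then - \<infinity> else
        ereal ((\<Sum>v\<in>V. p v * rvec v $ i) - (if i \<in> J then real_of_ereal (\<mu> i) else 0)))"
proof (cases "i \<in> S")
  case True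
  \<comment> \<open>Some weight has to be positive: a weight \<open>0\<close> times
    \<open>- \<infinity>\<close> is \<open>0\<close>, so without it the coordinate would be
    finite.\<close>
  obtain v0 where v0: "v0 \<in> V" "p v0 > 0"
  proof (rule ccontr)
    assume "\<not> thesis"
    then have "\<forall>v\<in>V. p v = 0" using that p(1) by (metis antisym_conv2)
    then show False using p(2) by simp
  qed
  have i: "v $ i = - \<infinity>" if "v \<in> V" for v using assms(2) that True by (auto simp: sed_def)
  have "(\<Sum>v\<in>V. ereal (p v) * v $ i) = ereal (p v0) * v0 $ i + (\<Sum>v\<in>V - {v0}. ereal (p v) * v $ i)"
    using assms(1) v0 by (simp add: sum.remove)
  also have "ereal (p v0) * v0 $ i = - \<infinity>" using i[OF v0(1)] v0(2) by simp
  also have "- \<infinity> + (\<Sum>v\<in>V - {v0}. ereal (p v) * v $ i) = - \<infinity>"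
  proof -
    have "(\<Sum>v\<in>V - {v0}. ereal (p v) * v $ i) \<noteq> \<infinity>"
      using i p(1) by (subst sum_Pinfty) (auto simp: zero_less_mult_iff less_le)
    then show ?thesis by simp
  qed
  finally show ?thesis using True assms(3) by auto
next
  case False
  have "(\<Sum>v\<in>V. ereal (p v) * v $ i) = (\<Sum>v\<in>V. ereal (p v * rvec v $ i))"
    using assms(2) False by (intro sum.cong) (auto simp: tproj_nth)
  also have "\<dots> = ereal (\<Sum>v\<in>V. p v * rvec v $ i)" by simp
  finally have s: "(\<Sum>v\<in>V. ereal (p v) * v $ i) = ereal (\<Sum>v\<in>V. p v * rvec v $ i)" .
  show ?thesis
  proof (cases "i \<in> J")
    case True
    then show ?thesis using False \<mu> s by (cases "\<mu> i") auto
  qed (use False s in auto)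
qed

text \<open>A point of the cell amounts to a real combination of the generators together with the
  set \<open>A\<close> of recession directions whose coefficient is infinite. Real coefficients
  assigned to the directions in \<open>A\<close> are invisible in that stratum.\<close>

lemma gen_cell_eq:
  assumes "cell_gens S Q"
  shows "gen_cell Q = {stratum_point (S \<union> A) u | A u. A \<subseteq> gen_divs Q \<and> u \<in> gen_hull Q}"
proof -
  define V J where "V = gen_verts Q" and "J = gen_divs Q"
  have Q: "finite Q" "V \<noteq> {}" "\<And>x. x \<in> V \<Longrightarrow> x \<in> tproj \<and> sed x = S" "J \<inter> S = {}" "S \<union> J \<noteq> UNIV"
    using assms by (auto simp: cell_gens_def V_def J_def)
  have fin: "finite V" "finite J" using finite_gens[OF Q(1)] by (auto simp: V_def J_def)
  have "\<forall>x\<in>V. x \<in> tproj \<and> sed x = S" using Q(3) by blast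
  note coord = tcell_coordinate[OF fin(1) this Q(4)]
  have hull: "(\<Sum>q\<in>Q. \<alpha> q *\<^sub>R gen_vec q) $ i =
     (\<Sum>v\<in>V. \<alpha> (Vertex v) * rvec v $ i) - (if i \<in> J then \<alpha> (Divisorial i) else 0)" for \<alpha> i
    using sum_divisorial_nth[of "\<lambda>i. \<alpha> (Divisorial i)" J i]
    by (simp add: sum_gens[OF Q(1)] V_def J_def)
  show ?thesis
  proof (intro subset_antisym subsetI)
    fix z assume "z \<in> gen_cell Q"
    then obtain x p and \<mu> :: "'a \<Rightarrow> ereal" where z: "z = tnormalize x"
      "\<forall>v\<in>V. 0 \<le> p v" "(\<Sum>v\<in>V. p v) = 1" "\<forall>i\<in>J. 0 \<le> \<mu> i"
      "\<And>i. x $ i = (\<Sum>v\<in>V. ereal (p v) * v $ i) - (if i \<in> J then \<mu> i else 0)"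
      by (auto simp: gen_cell_def tcell_def V_def[symmetric] J_def[symmetric])
    define A where "A = {j\<in>J. \<mu> j = \<infinity>}"
    \<comment> \<open>\<open>real_of_ereal\<close> turns an infinite coefficient into
      \<open>0\<close>. This is harmless, because the coordinate concerned lies in
      \<open>A\<close>.\<close>
    define \<alpha> where "\<alpha> = (\<lambda>q. case q of Vertex v \<Rightarrow> p v | Divisorial i \<Rightarrow> real_of_ereal (\<mu> i))"
    define u where "u = (\<Sum>q\<in>Q. \<alpha> q *\<^sub>R gen_vec q)"
    have "x = (\<chi> i. if i \<in> S \<union> A then - \<infinity> else emb u $ i)"
      using coord[OF z(2,3,4)] z(5)
      by (auto simp: vec_eq_iff emb_def u_def hull A_def \<alpha>_def simp del: sum_component)
    then have "z = stratum_point (S \<union> A) u" by (simp add: z(1) stratum_point_def tsend_def)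
    moreover have "u \<in> gen_hull Q"
      unfolding gen_hull_def u_def
    proof (intro CollectI exI[of _ \<alpha>] conjI refl ballI)
      show "0 \<le> \<alpha> q" if "q \<in> Q" for q
        using that z(2,4) by (cases q) (auto simp: \<alpha>_def V_def J_def real_of_ereal_pos)
      show "(\<Sum>q\<in>Q. gen_deg q * \<alpha> q) = 1"
        using z(3) by (simp add: sum_gens[OF Q(1)] \<alpha>_def V_def)
    qed
    moreover have "A \<subseteq> J" by (auto simp: A_def)
    ultimately show "z \<in> {stratum_point (S \<union> A) u | A u. A \<subseteq> gen_divs Q \<and> u \<in> gen_hull Q}"
      unfolding J_def by blast
  next
    fix z assume "z \<in> {stratum_point (S \<union> A) u | A u. A \<subseteq> gen_divs Q \<and> u \<in> gen_hull Q}"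
    then obtain A \<alpha> where z: "z = stratum_point (S \<union> A) (\<Sum>q\<in>Q. \<alpha> q *\<^sub>R gen_vec q)" "A \<subseteq> J"
      "\<And>q. q \<in> Q \<Longrightarrow> 0 \<le> \<alpha> q" "(\<Sum>q\<in>Q. gen_deg q * \<alpha> q) = 1"
      unfolding gen_hull_def J_def by blast
    define u where "u = (\<Sum>q\<in>Q. \<alpha> q *\<^sub>R gen_vec q)"
    define p where "p = (\<lambda>v. \<alpha> (Vertex v))"
    define \<mu> where "\<mu> = (\<lambda>i. if i \<in> A then \<infinity> else ereal (\<alpha> (Divisorial i)))"
    define x where "x = (\<chi> i. if i \<in> S \<union> A then - \<infinity> else emb u $ i)"
    have p: "\<forall>v\<in>V. 0 \<le> p v" "(\<Sum>v\<in>V. p v) = 1" "\<forall>i\<in>J. 0 \<le> \<mu> i"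
      using z(3,4) by (auto simp: p_def V_def J_def \<mu>_def sum_gens[OF Q(1)])
    have A: "{j \<in> J. \<mu> j = \<infinity>} = A" using z(2) by (auto simp: \<mu>_def)
    have "\<forall>i. x $ i = (\<Sum>v\<in>V. ereal (p v) * v $ i) - (if i \<in> J then \<mu> i else 0)"
      unfolding coord[OF p] A by (auto simp: x_def emb_def u_def hull p_def \<mu>_def simp del: sum_component)
    moreover have "\<exists>i. x $ i \<noteq> - \<infinity>"
      using Q(5) z(2) by (auto simp: x_def emb_def)
    moreover have "z = tnormalize x" by (simp only: z(1) x_def stratum_point_def tsend_def u_def)
    ultimately show "z \<in> gen_cell Q"
      unfolding gen_cell_def tcell_def V_def[symmetric] J_def[symmetric] using p by blast
  qed
qed

lemma dir_vec_eq: "dir_vec x0 q = gen_vec q - gen_deg q *\<^sub>R rvec x0"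
  by (cases q) auto

lemma sum_dir_vec:
  "(\<Sum>q\<in>Q. \<alpha> q *\<^sub>R dir_vec x0 q) =
     (\<Sum>q\<in>Q. \<alpha> q *\<^sub>R gen_vec q) - (\<Sum>q\<in>Q. gen_deg q * \<alpha> q) *\<^sub>R rvec x0"
  by (simp add: dir_vec_eq scaleR_diff_right sum_subtractf scaleR_sum_left mult.commute)

lemma gen_hull_vertex:
  assumes "finite Q" "Vertex x \<in> Q" shows "rvec x \<in> gen_hull Q"
proof -
  define \<alpha> :: "'a generator \<Rightarrow> real" where "\<alpha> = (\<lambda>q. if q = Vertex x then 1 else 0)"
  have "(\<Sum>q\<in>Q. \<alpha> q *\<^sub>R gen_vec q) = (\<Sum>q\<in>Q. if q = Vertex x then rvec x else 0)"
    by (intro sum.cong) (auto simp: \<alpha>_def)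
  then have "rvec x = (\<Sum>q\<in>Q. \<alpha> q *\<^sub>R gen_vec q)" using assms by simp
  moreover have "(\<Sum>q\<in>Q. gen_deg q * \<alpha> q) = (\<Sum>q\<in>Q. if q = Vertex x then 1 else 0)"
    by (intro sum.cong) (auto simp: \<alpha>_def)
  then have "(\<Sum>q\<in>Q. gen_deg q * \<alpha> q) = 1" using assms by simp
  moreover have "\<forall>q\<in>Q. 0 \<le> \<alpha> q" by (simp add: \<alpha>_def)
  ultimately show ?thesis unfolding gen_hull_def by blast
qed

lemma gen_hull_mono:
  assumes "finite Q" "Q' \<subseteq> Q" shows "gen_hull Q' \<subseteq> gen_hull Q"
proof
  fix u assume "u \<in> gen_hull Q'"
  then obtain \<alpha> where u: "u = (\<Sum>q\<in>Q'. \<alpha> q *\<^sub>R gen_vec q)" "\<forall>q\<in>Q'. 0 \<le> \<alpha> q"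
    "(\<Sum>q\<in>Q'. gen_deg q * \<alpha> q) = 1" unfolding gen_hull_def by blast
  define \<beta> where "\<beta> = (\<lambda>q. if q \<in> Q' then \<alpha> q else 0)"
  have "(\<Sum>q\<in>Q'. \<alpha> q *\<^sub>R gen_vec q) = (\<Sum>q\<in>Q. \<beta> q *\<^sub>R gen_vec q)"
    using assms by (intro sum.mono_neutral_cong_left) (auto simp: \<beta>_def)
  moreover have "(\<Sum>q\<in>Q'. gen_deg q * \<alpha> q) = (\<Sum>q\<in>Q. gen_deg q * \<beta> q)"
    using assms by (intro sum.mono_neutral_cong_left) (auto simp: \<beta>_def)
  moreover have "\<forall>q\<in>Q. 0 \<le> \<beta> q" using u(2) by (simp add: \<beta>_def)
  ultimately show "u \<in> gen_hull Q" using u unfolding gen_hull_def by auto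
qed

lemma gen_hull_add_divisorial:
  assumes "finite Q" "Divisorial i \<in> Q" "u \<in> gen_hull Q"
  shows "u + divisorial i \<in> gen_hull Q"
proof -
  obtain \<alpha> where u: "u = (\<Sum>q\<in>Q. \<alpha> q *\<^sub>R gen_vec q)" "\<forall>q\<in>Q. 0 \<le> \<alpha> q"
    "(\<Sum>q\<in>Q. gen_deg q * \<alpha> q) = 1" using assms(3) unfolding gen_hull_def by blast
  define \<beta> where "\<beta> = (\<lambda>q. \<alpha> q + (if q = Divisorial i then 1 else 0))"
  have "(\<Sum>q\<in>Q. \<beta> q *\<^sub>R gen_vec q) = (\<Sum>q\<in>Q. \<alpha> q *\<^sub>R gen_vec q + (if q = Divisorial i then divisorial i else 0))"
    by (intro sum.cong) (auto simp: \<beta>_def algebra_simps)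
  then have "u + divisorial i = (\<Sum>q\<in>Q. \<beta> q *\<^sub>R gen_vec q)"
    using assms u(1) by (simp add: sum.distrib)
  moreover have "(\<Sum>q\<in>Q. gen_deg q * \<beta> q) = (\<Sum>q\<in>Q. gen_deg q * \<alpha> q)"
    by (intro sum.cong) (auto simp: \<beta>_def)
  moreover have "\<forall>q\<in>Q. 0 \<le> \<beta> q" using u(2) by (simp add: \<beta>_def)
  ultimately show ?thesis using u(3) unfolding gen_hull_def by auto
qed

lemma cell_gens_obtain:
  assumes "cell_gens S Q"
  obtains x0 where "finite Q" "Vertex x0 \<in> Q" "x0 \<in> tproj" "sed x0 = S"
  using assms by (auto simp: cell_gens_def)

lemma cell_gens_not_UNIV:
  "cell_gens S Q \<Longrightarrow> A \<subseteq> gen_divs Q \<Longrightarrow> S \<union> A \<noteq> UNIV"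
  by (auto simp: cell_gens_def)

lemma gen_cell_nonempty:
  assumes "cell_gens S Q" shows "gen_hull Q \<noteq> {}" "gen_cell Q \<noteq> {}"
proof -
  show h: "gen_hull Q \<noteq> {}"
    using gen_hull_vertex cell_gens_obtain[OF assms] by (metis empty_iff)
  then show "gen_cell Q \<noteq> {}" unfolding gen_cell_eq[OF assms] by blast
qed

lemma gen_cell_sed:
  assumes "cell_gens S Q" "A \<subseteq> gen_divs Q"
  shows "{x \<in> gen_cell Q. sed x = S \<union> A} = stratum_point (S \<union> A) ` gen_hull Q"
proof -
  have "sed (stratum_point (S \<union> B) u) = S \<union> B" if "B \<subseteq> gen_divs Q" for B u
    using cell_gens_not_UNIV[OF assms(1) that] by (rule sed_stratum_point)
  then show ?thesis unfolding gen_cell_eq[OF assms(1)] using assms(2) by auto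
qed

lemma gen_cell_sed_cases:
  assumes "cell_gens S Q" "x \<in> gen_cell Q"
  obtains A where "A \<subseteq> gen_divs Q" "sed x = S \<union> A"
  using assms cell_gens_not_UNIV[OF assms(1)] unfolding gen_cell_eq[OF assms(1)]
  by (auto simp: sed_stratum_point)

lemma csed_gen_cell:
  assumes "cell_gens S Q" shows "csed (gen_cell Q) = S"
proof -
  have "stratum_point (S \<union> {}) ` gen_hull Q \<subseteq> gen_cell Q"
    using gen_cell_sed[OF assms, of "{}"] by auto
  moreover obtain u where "u \<in> gen_hull Q" using gen_cell_nonempty[OF assms] by auto
  ultimately have "stratum_point S u \<in> gen_cell Q" "sed (stratum_point S u) = S"
    using cell_gens_not_UNIV[OF assms, of "{}"] by (auto simp: sed_stratum_point)
  moreover have "S \<subseteq> sed x" if "x \<in> gen_cell Q" for x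
    using gen_cell_sed_cases[OF assms that] by auto
  ultimately show ?thesis unfolding csed_def by fast
qed

lemma most_sedentary_gen_cell:
  assumes "cell_gens S Q"
  shows "most_sedentary (gen_cell Q) = stratum_point (S \<union> gen_divs Q) ` gen_hull Q"
proof -
  obtain u where u: "u \<in> gen_hull Q" using gen_cell_nonempty[OF assms] by auto
  then obtain z where z: "z \<in> gen_cell Q" "sed z = S \<union> gen_divs Q"
    using gen_cell_sed[OF assms subset_refl] by auto
  have le: "sed x \<subseteq> S \<union> gen_divs Q" if "x \<in> gen_cell Q" for x
  proof -
    obtain A where "A \<subseteq> gen_divs Q" "sed x = S \<union> A" using gen_cell_sed_cases[OF assms \<open>x \<in> _\<close>] .
    then show ?thesis by auto
  qed
  have "(\<forall>x'\<in>gen_cell Q. sed x' \<subseteq> sed x) \<longleftrightarrow> sed x = S \<union> gen_divs Q" if "x \<in> gen_cell Q" for x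
  proof
    assume "\<forall>x'\<in>gen_cell Q. sed x' \<subseteq> sed x"
    then have "sed z \<subseteq> sed x" using z(1) by (rule bspec)
    then show "sed x = S \<union> gen_divs Q" using le[OF that] z(2) by (intro subset_antisym) simp_all
  next
    assume "sed x = S \<union> gen_divs Q"
    then show "\<forall>x'\<in>gen_cell Q. sed x' \<subseteq> sed x" using le by simp
  qed
  then have "most_sedentary (gen_cell Q) = {x \<in> gen_cell Q. sed x = S \<union> gen_divs Q}"
    unfolding most_sedentary_def by blast
  then show ?thesis using gen_cell_sed[OF assms subset_refl] by simp
qed

section \<open>Tangent spaces of cells\<close>

lemma tangent_stratum:
  assumes "T \<noteq> UNIV" "csed P = T" "{x \<in> P. sed x = T} = stratum_point T ` H" "H \<noteq> {}"
  shows "tangent P = span ({u - v | u v. u \<in> H \<and> v \<in> H} \<union> divker T)"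
proof -
  have l: "lifts P = {u + d | u d. u \<in> H \<and> d \<in> divker T}"
  proof -
    have "v \<in> lifts P \<longleftrightarrow> stratum_point T v \<in> {x \<in> P. sed x = T}" for v
      using assms(1) by (simp add: lifts_def assms(2) stratum_point_def[symmetric] sed_stratum_point)
    then have "v \<in> lifts P \<longleftrightarrow> (\<exists>u\<in>H. v - u \<in> divker T)" for v
      unfolding assms(3) image_iff stratum_point_eq_iff[OF assms(1)] by simp
    moreover have "(\<exists>u\<in>H. v - u \<in> divker T) \<longleftrightarrow> (\<exists>u d. v = u + d \<and> u \<in> H \<and> d \<in> divker T)" for v
      by (metis add.commute add_diff_cancel_left' diff_add_cancel)
    ultimately show ?thesis by blast
  qed
  show ?thesis unfolding tangent_def
  proof (rule subset_antisym; rule span_minimal[OF _ subspace_span]; rule subsetI)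
    fix x assume "x \<in> {u - v |u v. u \<in> lifts P \<and> v \<in> lifts P}"
    then obtain u v d e where x: "x = (u - v) + (d - e)" "u \<in> H" "v \<in> H" "d \<in> divker T" "e \<in> divker T"
      unfolding l by (auto simp: algebra_simps)
    have "u - v \<in> span ({u - v | u v. u \<in> H \<and> v \<in> H} \<union> divker T)"
      "d \<in> span ({u - v | u v. u \<in> H \<and> v \<in> H} \<union> divker T)"
      "e \<in> span ({u - v | u v. u \<in> H \<and> v \<in> H} \<union> divker T)"
      using x by (auto intro!: span_base)
    then show "x \<in> span ({u - v | u v. u \<in> H \<and> v \<in> H} \<union> divker T)"
      unfolding x(1) by (rule span_add[OF _ span_diff])
  next
    fix x assume "x \<in> {u - v | u v. u \<in> H \<and> v \<in> H} \<union> divker T"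
    moreover obtain h where "h \<in> H" using assms(4) by auto
    moreover have "u \<in> lifts P" if "u \<in> H" for u
      unfolding l using that divker_arith(1)[of T] by (intro CollectI exI[of _ u] exI[of _ 0]) simp
    moreover have "u + d \<in> lifts P" if "u \<in> H" "d \<in> divker T" for u d
      unfolding l using that by blast
    ultimately have "x \<in> {u - v |u v. u \<in> lifts P \<and> v \<in> lifts P}"
      by auto (metis add_diff_cancel_left')
    then show "x \<in> span {u - v |u v. u \<in> lifts P \<and> v \<in> lifts P}" by (rule span_base)
  qed
qed

text \<open>All differences are measured from \<open>x0\<close>. A recession direction is itself a
  difference, between the translate of \<open>x0\<close> along it and \<open>x0\<close>.\<close>

lemma span_gen_hull:
  assumes "finite Q" "Vertex x0 \<in> Q"
  shows "span ({u - v | u v. u \<in> gen_hull Q \<and> v \<in> gen_hull Q} \<union> W) = span (dir_vec x0 ` Q \<union> W)"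
proof (rule subset_antisym; rule span_minimal[OF _ subspace_span]; rule subsetI)
  have d: "u - rvec x0 \<in> span (dir_vec x0 ` Q \<union> W)" if "u \<in> gen_hull Q" for u
  proof -
    obtain \<alpha> where u: "u = (\<Sum>q\<in>Q. \<alpha> q *\<^sub>R gen_vec q)" "(\<Sum>q\<in>Q. gen_deg q * \<alpha> q) = 1"
      using \<open>u \<in> _\<close> unfolding gen_hull_def by blast
    then have "u - rvec x0 = (\<Sum>q\<in>Q. \<alpha> q *\<^sub>R dir_vec x0 q)" by (simp add: sum_dir_vec)
    also have "\<dots> \<in> span (dir_vec x0 ` Q \<union> W)"
      by (intro span_sum span_scale span_base) auto
    finally show ?thesis .
  qed
  fix x assume "x \<in> {u - v | u v. u \<in> gen_hull Q \<and> v \<in> gen_hull Q} \<union> W"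
  then consider u v where "x = u - v" "u \<in> gen_hull Q" "v \<in> gen_hull Q" | "x \<in> W" by auto
  then show "x \<in> span (dir_vec x0 ` Q \<union> W)"
  proof cases
    case 1
    then have "x = (u - rvec x0) - (v - rvec x0)" by simp
    then show ?thesis using span_diff[OF d[OF 1(2)] d[OF 1(3)]] by simp
  qed (auto intro: span_base)
next
  fix x assume "x \<in> dir_vec x0 ` Q \<union> W"
  then consider q where "q \<in> Q" "x = dir_vec x0 q" | "x \<in> W" by auto
  then show "x \<in> span ({u - v | u v. u \<in> gen_hull Q \<and> v \<in> gen_hull Q} \<union> W)"
  proof cases
    case 1
    have "\<exists>u\<in>gen_hull Q. x = u - rvec x0"
      using 1 gen_hull_vertex[OF assms(1)] gen_hull_add_divisorial[OF assms(1), of _ "rvec x0"] assms(2)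
      by (cases q) (auto intro!: bexI[of _ "rvec x0 + divisorial _"])
    then have "x \<in> {u - v | u v. u \<in> gen_hull Q \<and> v \<in> gen_hull Q} \<union> W"
      using gen_hull_vertex[OF assms] by blast
    then show ?thesis by (rule span_base)
  qed (auto intro: span_base)
qed

lemma tangent_gen_cell:
  assumes "cell_gens S Q" "Vertex x0 \<in> Q"
  shows "tangent (gen_cell Q) = span (dir_vec x0 ` Q \<union> divker S)"
proof -
  have "finite Q" using assms by (simp add: cell_gens_def)
  then show ?thesis
    using tangent_stratum[of S "gen_cell Q" "gen_hull Q"] gen_cell_sed[OF assms(1), of "{}"]
      cell_gens_not_UNIV[OF assms(1), of "{}"] gen_cell_nonempty[OF assms(1)] csed_gen_cell[OF assms(1)]
      span_gen_hull[OF _ assms(2), of "divker S"] by simp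
qed

lemma sed_most_sedentary:
  assumes "cell_gens S Q" "x \<in> most_sedentary (gen_cell Q)"
  shows "sed x = S \<union> gen_divs Q"
  using assms(2) sed_stratum_point[OF cell_gens_not_UNIV[OF assms(1) subset_refl]]
  unfolding most_sedentary_gen_cell[OF assms(1)] by blast

lemma csed_most_sedentary:
  assumes "cell_gens S Q"
  shows "csed (most_sedentary (gen_cell Q)) = S \<union> gen_divs Q"
proof -
  have "most_sedentary (gen_cell Q) \<noteq> {}"
    using gen_cell_nonempty[OF assms] by (simp add: most_sedentary_gen_cell[OF assms])
  then show ?thesis using sed_most_sedentary[OF assms] unfolding csed_def by auto
qed

text \<open>The directions that become infinite are already tangent to the cell, so enlarging
  \<open>divker\<close> by them does not change the full preimage. Only the dimension of the
  subtracted kernel changes.\<close>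

lemma tangent_most_sedentary:
  assumes "cell_gens S Q"
  shows "tangent (most_sedentary (gen_cell Q)) = tangent (gen_cell Q)"
proof -
  obtain x0 where x0: "finite Q" "Vertex x0 \<in> Q" using cell_gens_obtain[OF assms] by blast
  define T where "T = S \<union> gen_divs Q"
  have T: "T \<noteq> UNIV" using cell_gens_not_UNIV[OF assms subset_refl] by (simp add: T_def)
  have "{x \<in> most_sedentary (gen_cell Q). sed x = T} = most_sedentary (gen_cell Q)"
    using sed_most_sedentary[OF assms] by (auto simp: T_def)
  then have "tangent (most_sedentary (gen_cell Q)) = span (dir_vec x0 ` Q \<union> divker T)"
    using tangent_stratum[OF T csed_most_sedentary[OF assms, folded T_def], of "gen_hull Q"]
      most_sedentary_gen_cell[OF assms] gen_cell_nonempty[OF assms] span_gen_hull[OF x0]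
    by (simp add: T_def)
  also have "\<dots> = span (dir_vec x0 ` Q \<union> divker S)"
  proof (rule subset_antisym)
    show "span (dir_vec x0 ` Q \<union> divker S) \<subseteq> span (dir_vec x0 ` Q \<union> divker T)"
      using divker_mono[of S T] by (intro span_mono) (auto simp: T_def)
    have "divker T \<subseteq> span (dir_vec x0 ` Q \<union> divker S)"
      unfolding divker_def[of T]
    proof (rule span_minimal[OF _ subspace_span], rule subsetI)
      fix x assume "x \<in> insert 1 (divisorial ` T)"
      then consider "x \<in> divker S" | i where "Divisorial i \<in> Q" "x = divisorial i"
        by (auto simp: T_def divker_def intro: span_base)
      then show "x \<in> span (dir_vec x0 ` Q \<union> divker S)"
      proof cases
        case 2
        then have "x = dir_vec x0 (Divisorial i)" by simp
        then show ?thesis using 2 by (intro span_base) blast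
      qed (auto intro: span_base)
    qed
    moreover have "dir_vec x0 ` Q \<subseteq> span (dir_vec x0 ` Q \<union> divker S)" by (auto intro: span_base)
    ultimately show "span (dir_vec x0 ` Q \<union> divker T) \<subseteq> span (dir_vec x0 ` Q \<union> divker S)"
      by (intro span_minimal[OF _ subspace_span]) auto
  qed
  finally show ?thesis using tangent_gen_cell[OF assms x0(2)] by simp
qed

section \<open>Unimodularity in terms of generators\<close>

definition gens_independent :: "'n::finite set \<Rightarrow> 'n generator set \<Rightarrow> bool" where
  "gens_independent S Q \<longleftrightarrow> (\<forall>\<alpha>. (\<Sum>q\<in>Q. gen_deg q * \<alpha> q) = 0 \<and>
     (\<Sum>q\<in>Q. \<alpha> q *\<^sub>R gen_vec q) \<in> divker S \<longrightarrow> (\<forall>q\<in>Q. \<alpha> q = 0))"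

text \<open>Together with \<open>gens_independent\<close> this expresses
  \<open>lattice_basis\<close> without singling out a base vertex: relations are combinations of
  degree \<open>0\<close>, and integral tangent vectors must have integral coefficients.\<close>

definition gens_saturated :: "'n::finite set \<Rightarrow> 'n generator set \<Rightarrow> bool" where
  "gens_saturated S Q \<longleftrightarrow> (\<forall>\<alpha>. \<forall>d\<in>divker S. (\<Sum>q\<in>Q. gen_deg q * \<alpha> q) = 0 \<and>
     (\<forall>i. ((\<Sum>q\<in>Q. \<alpha> q *\<^sub>R gen_vec q) + d) $ i \<in> \<int>) \<longrightarrow> (\<forall>q\<in>Q. \<alpha> q \<in> \<int>))"

definition unimodular_gens :: "'n::finite set \<Rightarrow> 'n generator set \<Rightarrow> bool" where
  "unimodular_gens S Q \<longleftrightarrow> cell_gens S Q \<and> (\<forall>x. Vertex x \<in> Q \<longrightarrow> (\<forall>i. rvec x $ i \<in> \<int>)) \<and>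
     gens_independent S Q \<and> gens_saturated S Q"

lemma sum_nth_gens:
  assumes "distinct gs" "Vertex x0 \<notin> set gs" "(\<Sum>q\<in>insert (Vertex x0) (set gs). gen_deg q * \<alpha> q) = 0"
  shows "(\<Sum>q\<in>insert (Vertex x0) (set gs). \<alpha> q *\<^sub>R gen_vec q) =
    (\<Sum>k<length (map (dir_vec x0) gs). \<alpha> (gs ! k) *\<^sub>R map (dir_vec x0) gs ! k)"
proof -
  have "(\<Sum>q\<in>insert (Vertex x0) (set gs). \<alpha> q *\<^sub>R gen_vec q) =
     (\<Sum>q\<in>insert (Vertex x0) (set gs). \<alpha> q *\<^sub>R dir_vec x0 q)"
    using assms(3) by (simp only: sum_dir_vec) simp
  also have "\<dots> = (\<Sum>q\<in>set gs. \<alpha> q *\<^sub>R dir_vec x0 q)" using assms(2) by simp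
  also have "\<dots> = (\<Sum>k<length gs. \<alpha> (gs ! k) *\<^sub>R dir_vec x0 (gs ! k))"
    using sum.reindex_bij_betw[OF bij_betw_nth[OF assms(1) refl refl], of "\<lambda>q. \<alpha> q *\<^sub>R dir_vec x0 q"] by simp
  finally show ?thesis by simp
qed

lemma coefficients_extend:
  assumes "distinct gs" "Vertex x0 \<notin> set gs"
  obtains \<alpha> where "(\<Sum>q\<in>insert (Vertex x0) (set gs). gen_deg q * \<alpha> q) = 0"
    "\<And>k. k < length gs \<Longrightarrow> \<alpha> (gs ! k) = c k"
proof -
  define \<beta> where "\<beta> = (\<lambda>q. c (the_inv_into {..<length gs} ((!) gs) q))"
  have \<beta>: "\<beta> (gs ! k) = c k" if "k < length gs" for k
    using that assms(1) by (auto simp: \<beta>_def the_inv_into_f_f inj_on_def nth_eq_iff_index_eq)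
  \<comment> \<open>Total degree \<open>0\<close> dictates the coefficient of the base
    vertex.\<close>
  define \<alpha> where "\<alpha> = \<beta>(Vertex x0 := - (\<Sum>q\<in>set gs. gen_deg q * \<beta> q))"
  have "(\<Sum>q\<in>set gs. gen_deg q * \<alpha> q) = (\<Sum>q\<in>set gs. gen_deg q * \<beta> q)"
    using assms(2) by (intro sum.cong) (auto simp: \<alpha>_def)
  then have "(\<Sum>q\<in>insert (Vertex x0) (set gs). gen_deg q * \<alpha> q) = 0"
    using assms(2) by (simp add: \<alpha>_def)
  moreover have "\<alpha> (gs ! k) = c k" if "k < length gs" for k
    using \<beta>[OF that] assms(2) nth_mem[OF that] by (auto simp: \<alpha>_def)
  ultimately show ?thesis by (rule that)
qed

lemma gens_independent_list:
  assumes "distinct gs" "Vertex x0 \<notin> set gs"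
  shows "gens_independent S (insert (Vertex x0) (set gs)) \<longleftrightarrow>
    (\<forall>c :: nat \<Rightarrow> real. (\<Sum>k<length (map (dir_vec x0) gs). c k *\<^sub>R map (dir_vec x0) gs ! k) \<in> divker S \<longrightarrow>
        (\<forall>k<length (map (dir_vec x0) gs). c k = 0))" (is "?I \<longleftrightarrow> ?L")
proof
  assume I: ?I
  show ?L
  proof (intro allI impI)
    fix c :: "nat \<Rightarrow> real" and k
    assume c: "(\<Sum>k<length (map (dir_vec x0) gs). c k *\<^sub>R map (dir_vec x0) gs ! k) \<in> divker S"
      and k: "k < length (map (dir_vec x0) gs)"
    obtain \<alpha> where \<alpha>: "(\<Sum>q\<in>insert (Vertex x0) (set gs). gen_deg q * \<alpha> q) = 0"
      "\<And>k. k < length gs \<Longrightarrow> \<alpha> (gs ! k) = c k" using coefficients_extend[OF assms, of c] by blast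
    have "(\<Sum>q\<in>insert (Vertex x0) (set gs). \<alpha> q *\<^sub>R gen_vec q) \<in> divker S"
      using c \<alpha>(2) by (simp only: sum_nth_gens[OF assms \<alpha>(1)]) simp
    then have "\<forall>q\<in>insert (Vertex x0) (set gs). \<alpha> q = 0"
      using I \<alpha>(1) unfolding gens_independent_def by blast
    then show "c k = 0" using k \<alpha>(2)[of k] by simp
  qed
next
  assume L: ?L
  show ?I unfolding gens_independent_def
  proof (intro allI impI)
    fix \<alpha> :: "'a generator \<Rightarrow> real" 
    assume "(\<Sum>q\<in>insert (Vertex x0) (set gs). gen_deg q * \<alpha> q) = 0 \<and>
      (\<Sum>q\<in>insert (Vertex x0) (set gs). \<alpha> q *\<^sub>R gen_vec q) \<in> divker S"
    then have \<alpha>: "(\<Sum>q\<in>insert (Vertex x0) (set gs). gen_deg q * \<alpha> q) = 0"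
      "(\<Sum>k<length (map (dir_vec x0) gs). \<alpha> (gs ! k) *\<^sub>R map (dir_vec x0) gs ! k) \<in> divker S"
      using sum_nth_gens[OF assms] by auto
    then have "\<forall>k<length gs. \<alpha> (gs ! k) = 0"
      using L[THEN spec[of _ "\<lambda>k. \<alpha> (gs ! k)"]] by simp
    then have z: "\<alpha> q = 0" if "q \<in> set gs" for q using that by (auto simp: in_set_conv_nth)
    moreover have "\<alpha> (Vertex x0) = 0" using \<alpha>(1) assms(2) z by simp
    ultimately show "\<forall>q\<in>insert (Vertex x0) (set gs). \<alpha> q = 0" by blast
  qed
qed

lemma lattice_basis_gens:
  assumes "distinct gs" "Vertex x0 \<notin> set gs" "Q = insert (Vertex x0) (set gs)"
    and "cell_gens S Q" "\<And>x i. Vertex x \<in> Q \<Longrightarrow> rvec x $ i \<in> \<int>"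
  shows "lattice_basis (gen_cell Q) (map (dir_vec x0) gs) \<longleftrightarrow> gens_independent S Q \<and> gens_saturated S Q"
proof -
  let ?bs = "map (dir_vec x0) gs"
  have x0: "Vertex x0 \<in> Q" and fin: "finite Q" using assms(3) by auto
  note tan = tangent_gen_cell[OF assms(4) x0]
  note comb = sum_nth_gens[OF assms(1,2), folded assms(3)]
  have int: "dir_vec x0 q $ i \<in> \<int>" if "q \<in> Q" for q i
    using that assms(5)[OF x0] assms(5) by (cases q) (auto simp: divisorial_def axis_def)
  have c1: "set ?bs \<subseteq> tlattice (gen_cell Q)"
  proof
    fix v assume "v \<in> set ?bs"
    then obtain q where q: "q \<in> Q" "v = dir_vec x0 q" using assms(3) by auto
    then have "v \<in> tangent (gen_cell Q)" unfolding tan by (intro span_base) auto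
    then show "v \<in> tlattice (gen_cell Q)" using int q by (simp add: tlattice_def)
  qed
  have rep: "\<exists>\<alpha>. \<exists>d\<in>divker S. (\<Sum>q\<in>Q. gen_deg q * \<alpha> q) = 0 \<and> z = (\<Sum>q\<in>Q. \<alpha> q *\<^sub>R gen_vec q) + d"
    if "z \<in> tangent (gen_cell Q)" for z
    using that unfolding tan
  proof (induction rule: span_induct_alt)
    case base
    show ?case using divker_arith(1)[of S] by (intro exI[of _ "\<lambda>_. 0"] bexI[of _ 0]) auto
  next
    case (step t x y)
    then obtain \<alpha> d where y: "d \<in> divker S" "(\<Sum>q\<in>Q. gen_deg q * \<alpha> q) = 0"
      "y = (\<Sum>q\<in>Q. \<alpha> q *\<^sub>R gen_vec q) + d" by blast
    show ?case
    proof (cases "x \<in> divker S")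
      case True
      then have "d + t *\<^sub>R x \<in> divker S" using y(1) by (intro divker_arith(2,4))
      then show ?thesis using y(2,3)
        by (intro exI[of _ \<alpha>] bexI[of _ "d + t *\<^sub>R x"]) (auto simp: algebra_simps)
    next
      case False
      then obtain q0 where q0: "q0 \<in> Q" "x = dir_vec x0 q0" using step(1) by auto
      \<comment> \<open>Adding a multiple of \<open>dir_vec x0 q0\<close> raises the weight of
        \<open>q0\<close> and lowers that of the base vertex by the degree, which keeps the total
        degree at \<open>0\<close>. For \<open>q0 = Vertex x0\<close> the two changes
        cancel.\<close>
      define \<beta> where "\<beta> = (\<lambda>q. \<alpha> q + (if q = q0 then t else 0) - (if q = Vertex x0 then gen_deg q0 * t else 0))"
      have "(\<Sum>q\<in>Q. gen_deg q * \<beta> q) = (\<Sum>q\<in>Q. gen_deg q * \<alpha> q + (if q = q0 then gen_deg q0 * t else 0)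
          - (if q = Vertex x0 then gen_deg q0 * t else 0))"
        by (intro sum.cong) (auto simp: \<beta>_def algebra_simps)
      then have 1: "(\<Sum>q\<in>Q. gen_deg q * \<beta> q) = 0"
        using fin q0(1) x0 y(2) by (simp add: sum.distrib sum_subtractf)
      have "(\<Sum>q\<in>Q. \<beta> q *\<^sub>R gen_vec q) = (\<Sum>q\<in>Q. \<alpha> q *\<^sub>R gen_vec q + (if q = q0 then t *\<^sub>R gen_vec q0 else 0)
          - (if q = Vertex x0 then (gen_deg q0 * t) *\<^sub>R rvec x0 else 0))"
        by (intro sum.cong) (auto simp: \<beta>_def algebra_simps)
      also have "\<dots> = (\<Sum>q\<in>Q. \<alpha> q *\<^sub>R gen_vec q) + t *\<^sub>R x"
        using fin q0(1) x0 by (simp add: sum.distrib sum_subtractf q0(2) dir_vec_eq scaleR_diff_right mult.commute)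
      finally show ?thesis using y 1
        by (intro exI[of _ \<beta>] bexI[of _ d]) (auto simp: algebra_simps)
    qed
  qed
  have mem: "(\<Sum>q\<in>Q. \<alpha> q *\<^sub>R gen_vec q) + d \<in> tangent (gen_cell Q)"
    if "d \<in> divker S" "(\<Sum>q\<in>Q. gen_deg q * \<alpha> q) = 0" for \<alpha> d
  proof -
    have "(\<Sum>q\<in>Q. \<alpha> q *\<^sub>R gen_vec q) = (\<Sum>q\<in>Q. \<alpha> q *\<^sub>R dir_vec x0 q)"
      using that(2) by (simp add: sum_dir_vec)
    also have "\<dots> \<in> span (dir_vec x0 ` Q \<union> divker S)" by (intro span_sum span_scale span_base) auto
    finally show ?thesis unfolding tan using that(1) by (intro span_add) (auto intro: span_base)
  qed
  have c2: "(\<forall>c :: nat \<Rightarrow> real. (\<Sum>k<length ?bs. c k *\<^sub>R ?bs ! k) \<in> divker (csed (gen_cell Q)) \<longrightarrow>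
        (\<forall>k<length ?bs. c k = 0)) \<longleftrightarrow> gens_independent S Q"
    unfolding csed_gen_cell[OF assms(4)] using gens_independent_list[OF assms(1,2), of S] assms(3) by simp
  have c3: "(\<forall>z\<in>tlattice (gen_cell Q). \<exists>c :: nat \<Rightarrow> int.
        z - (\<Sum>k<length ?bs. of_int (c k) *\<^sub>R ?bs ! k) \<in> divker S) \<longleftrightarrow> gens_saturated S Q"
    if ind: "gens_independent S Q"
  proof
    assume L: "\<forall>z\<in>tlattice (gen_cell Q). \<exists>c :: nat \<Rightarrow> int.
        z - (\<Sum>k<length ?bs. of_int (c k) *\<^sub>R ?bs ! k) \<in> divker S"
    show "gens_saturated S Q" unfolding gens_saturated_def
    proof (intro allI ballI impI)
      fix \<alpha> d q assume d: "d \<in> divker S" and q: "q \<in> Q"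
        and a: "(\<Sum>q\<in>Q. gen_deg q * \<alpha> q) = 0 \<and> (\<forall>i. ((\<Sum>q\<in>Q. \<alpha> q *\<^sub>R gen_vec q) + d) $ i \<in> \<int>)"
      have "(\<Sum>q\<in>Q. \<alpha> q *\<^sub>R gen_vec q) + d \<in> tlattice (gen_cell Q)"
        unfolding tlattice_def using mem[OF d] a by blast
      then obtain c :: "nat \<Rightarrow> int" where c:
        "(\<Sum>q\<in>Q. \<alpha> q *\<^sub>R gen_vec q) + d - (\<Sum>k<length ?bs. of_int (c k) *\<^sub>R ?bs ! k) \<in> divker S"
        using L by blast
      obtain \<gamma> where \<gamma>: "(\<Sum>q\<in>Q. gen_deg q * \<gamma> q) = 0"
        "\<And>k. k < length gs \<Longrightarrow> \<gamma> (gs ! k) = of_int (c k)"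
        using coefficients_extend[OF assms(1,2), of "\<lambda>k. of_int (c k)"] unfolding assms(3) by blast
      have "(\<Sum>q\<in>Q. \<gamma> q *\<^sub>R gen_vec q) = (\<Sum>k<length ?bs. of_int (c k) *\<^sub>R ?bs ! k)"
        unfolding comb[OF \<gamma>(1)] using \<gamma>(2) by simp
      then have "(\<Sum>q\<in>Q. \<alpha> q *\<^sub>R gen_vec q) + d - (\<Sum>q\<in>Q. \<gamma> q *\<^sub>R gen_vec q) - d \<in> divker S"
        using c d divker_arith(3) by metis
      then have "(\<Sum>q\<in>Q. (\<alpha> q - \<gamma> q) *\<^sub>R gen_vec q) \<in> divker S"
        by (simp add: scaleR_diff_left sum_subtractf)
      moreover have "(\<Sum>q\<in>Q. gen_deg q * (\<alpha> q - \<gamma> q)) = 0"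
        using a \<gamma>(1) by (simp add: right_diff_distrib sum_subtractf)
      ultimately have eq: "\<forall>q\<in>Q. \<alpha> q - \<gamma> q = 0"
        using ind[unfolded gens_independent_def, THEN spec[of _ "\<lambda>q. \<alpha> q - \<gamma> q"]] by blast
      have g: "\<gamma> q \<in> \<int>" if "q \<in> set gs" for q using that \<gamma>(2) by (auto simp: in_set_conv_nth)
      have deg: "gen_deg q \<in> \<int>" for q :: "'a generator" by (cases q) auto
      have "\<gamma> (Vertex x0) = - (\<Sum>q\<in>set gs. gen_deg q * \<gamma> q)"
        using \<gamma>(1) assms(2) unfolding assms(3) by simp
      also have "\<dots> \<in> \<int>" using g deg by (intro Ints_minus Ints_sum Ints_mult) auto
      finally show "\<alpha> q \<in> \<int>" using eq g q assms(3) by auto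
    qed
  next
    assume sat: "gens_saturated S Q"
    show "\<forall>z\<in>tlattice (gen_cell Q). \<exists>c :: nat \<Rightarrow> int.
        z - (\<Sum>k<length ?bs. of_int (c k) *\<^sub>R ?bs ! k) \<in> divker S"
    proof
      fix z assume "z \<in> tlattice (gen_cell Q)"
      then have z: "z \<in> tangent (gen_cell Q)" "\<forall>i. z $ i \<in> \<int>" by (auto simp: tlattice_def)
      obtain \<alpha> d where r: "d \<in> divker S" "(\<Sum>q\<in>Q. gen_deg q * \<alpha> q) = 0"
        "z = (\<Sum>q\<in>Q. \<alpha> q *\<^sub>R gen_vec q) + d" using rep[OF z(1)] by blast
      then have "\<forall>q\<in>Q. \<alpha> q \<in> \<int>" using sat z(2) unfolding gens_saturated_def by blast
      then have "\<forall>q\<in>Q. \<exists>m. \<alpha> q = of_int m" by (auto elim!: Ints_cases)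
      then obtain m where m: "\<And>q. q \<in> Q \<Longrightarrow> \<alpha> q = of_int (m q)" by metis
      have "z - (\<Sum>k<length ?bs. of_int (m (gs ! k)) *\<^sub>R ?bs ! k) = d"
        unfolding r(3) comb[OF r(2)] using m assms(3) by simp
      then show "\<exists>c :: nat \<Rightarrow> int. z - (\<Sum>k<length ?bs. of_int (c k) *\<^sub>R ?bs ! k) \<in> divker S"
        using r(1) by (intro exI[of _ "\<lambda>k. m (gs ! k)"]) simp
    qed
  qed
  show ?thesis unfolding lattice_basis_def c2 using c1 c3 csed_gen_cell[OF assms(4)] by auto
qed

section \<open>Faces of a unimodular cell\<close>

lemma vertex_in_gen_cell:
  assumes "cell_gens S Q" "Vertex x \<in> Q" shows "x \<in> gen_cell Q"
proof -
  have x: "x \<in> tproj" "sed x = S" "finite Q" using assms by (auto simp: cell_gens_def)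
  then have "x = stratum_point (S \<union> {}) (rvec x)" using stratum_point_rvec[OF x(1)] by simp
  then have "x \<in> stratum_point (S \<union> {}) ` gen_hull Q"
    using gen_hull_vertex[OF x(3) assms(2)] by blast
  then show ?thesis using gen_cell_sed[OF assms(1), of "{}"] by auto
qed

lemma gen_cell_sed_empty:
  assumes "cell_gens {} Q" "x \<in> gen_cell Q" "sed x = {}"
  obtains u where "u \<in> gen_hull Q" "x = stratum_point {} u"
proof -
  have "x \<in> {x \<in> gen_cell Q. sed x = {} \<union> {}}" using assms by simp
  then have "x \<in> stratum_point ({} \<union> {}) ` gen_hull Q"
    unfolding gen_cell_sed[OF assms(1) empty_subsetI] .
  then show ?thesis using that by auto
qed

lemma gen_cell_mono:
  assumes "cell_gens S Q" "Q' \<subseteq> Q" "gen_verts Q' \<noteq> {}"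
  shows "gen_cell Q' \<subseteq> gen_cell Q"
proof -
  have "gen_hull Q' \<subseteq> gen_hull Q" using assms by (intro gen_hull_mono) (auto simp: cell_gens_def)
  moreover have "gen_divs Q' \<subseteq> gen_divs Q" using assms(2) by auto
  ultimately show ?thesis
    unfolding gen_cell_eq[OF assms(1)] gen_cell_eq[OF cell_gens_subset[OF assms]] by blast
qed

text \<open>Otherwise \<open>x\<close> would be a combination of degree \<open>1\<close> of other
  generators modulo the line through \<open>1\<close>, and subtracting the two expressions would
  contradict independence.\<close>

lemma vertex_in_face:
  assumes "unimodular_gens {} Q" "Q' \<subseteq> Q" "gen_verts Q' \<noteq> {}" "Vertex x \<in> Q" "x \<in> gen_cell Q'"
  shows "Vertex x \<in> Q'"
proof (rule ccontr)
  assume n: "Vertex x \<notin> Q'"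
  have c: "cell_gens {} Q" and ind: "gens_independent {} Q"
    using assms(1) by (auto simp: unimodular_gens_def)
  have fin: "finite Q" and x: "x \<in> tproj" "sed x = {}" using c assms(4) by (auto simp: cell_gens_def)
  obtain u where u: "u \<in> gen_hull Q'" "x = stratum_point {} u"
    using gen_cell_sed_empty[OF cell_gens_subset[OF c assms(2,3)] assms(5) x(2)] .
  obtain \<alpha> where \<alpha>: "u = (\<Sum>q\<in>Q'. \<alpha> q *\<^sub>R gen_vec q)" "(\<Sum>q\<in>Q'. gen_deg q * \<alpha> q) = 1"
    using u(1) unfolding gen_hull_def by blast
  have "stratum_point {} (rvec x) = stratum_point {} u"
    using stratum_point_rvec[OF x(1)] x(2) u(2) by simp
  then have d: "rvec x - u \<in> divker {}" by (simp add: stratum_point_eq_iff)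
  define \<beta> where "\<beta> = (\<lambda>q. if q = Vertex x then 1 else if q \<in> Q' then - \<alpha> q else 0)"
  have "(\<Sum>q\<in>Q. f (\<beta> q) q) = f 1 (Vertex x) + (\<Sum>q\<in>Q'. f (- \<alpha> q) q)"
    if "\<And>q. f 0 q = 0" for f :: "real \<Rightarrow> 'a generator \<Rightarrow> 'b::comm_monoid_add"
  proof -
    have "(\<Sum>q\<in>Q. f (\<beta> q) q) = (\<Sum>q\<in>insert (Vertex x) Q'. f (\<beta> q) q)"
      using fin assms(2,4) that by (intro sum.mono_neutral_right) (auto simp: \<beta>_def)
    also have "\<dots> = f 1 (Vertex x) + (\<Sum>q\<in>Q'. f (\<beta> q) q)"
      using n finite_subset[OF assms(2) fin] by (simp add: \<beta>_def)
    also have "(\<Sum>q\<in>Q'. f (\<beta> q) q) = (\<Sum>q\<in>Q'. f (- \<alpha> q) q)"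
      using n by (intro sum.cong) (auto simp: \<beta>_def)
    finally show ?thesis .
  qed
  from this[of "\<lambda>t q. gen_deg q * t"] this[of "\<lambda>t q. t *\<^sub>R gen_vec q"]
  have "(\<Sum>q\<in>Q. gen_deg q * \<beta> q) = 0" "(\<Sum>q\<in>Q. \<beta> q *\<^sub>R gen_vec q) = rvec x - u"
    using \<alpha> by (simp_all add: sum_negf)
  then have "\<forall>q\<in>Q. \<beta> q = 0" using ind d unfolding gens_independent_def by auto
  then show False using assms(4) by (auto simp: \<beta>_def)
qed

text \<open>Letting the direction \<open>i\<close> become infinite gives a point of sedentarity
  \<open>{i}\<close> in the smaller cell. The larger cell contains such a point only if
  \<open>i\<close> is one of its own recession directions.\<close>

lemma divisorial_in_face:
  assumes "cell_gens {} Q" "cell_gens {} Q'" "gen_cell Q \<subseteq> gen_cell Q'" "Divisorial i \<in> Q"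
  shows "Divisorial i \<in> Q'"
proof -
  obtain u where "u \<in> gen_hull Q" using gen_cell_nonempty[OF assms(1)] by auto
  then have "stratum_point ({} \<union> {i}) u \<in> {x \<in> gen_cell Q. sed x = {} \<union> {i}}"
    using gen_cell_sed[OF assms(1), of "{i}"] assms(4) by blast
  then have "stratum_point ({} \<union> {i}) u \<in> gen_cell Q'" "sed (stratum_point ({} \<union> {i}) u) = {i}"
    using assms(3) by auto
  then show ?thesis using gen_cell_sed_cases[OF assms(2)] by (metis CollectD Un_empty_left insert_subset)
qed

lemma gen_cell_subset_iff:
  assumes "unimodular_gens {} Q" "Q1 \<subseteq> Q" "gen_verts Q1 \<noteq> {}" "Q2 \<subseteq> Q" "gen_verts Q2 \<noteq> {}"
  shows "gen_cell Q1 \<subseteq> gen_cell Q2 \<longleftrightarrow> Q1 \<subseteq> Q2"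
proof
  have c: "cell_gens {} Q" using assms(1) by (simp add: unimodular_gens_def)
  note c12 = cell_gens_subset[OF c assms(2,3)] cell_gens_subset[OF c assms(4,5)]
  show "gen_cell Q1 \<subseteq> gen_cell Q2" if "Q1 \<subseteq> Q2"
    using gen_cell_mono[OF c12(2) that assms(3)] .
  assume sub: "gen_cell Q1 \<subseteq> gen_cell Q2"
  show "Q1 \<subseteq> Q2"
  proof
    fix q assume q: "q \<in> Q1"
    show "q \<in> Q2"
    proof (cases q)
      case (Vertex x)
      then show ?thesis
        using q vertex_in_face[OF assms(1,4,5), of x] vertex_in_gen_cell[OF c12(1), of x] sub assms(2) by blast
    next
      case (Divisorial i)
      then show ?thesis using divisorial_in_face[OF c12 sub] q by blast
    qed
  qed
qed

lemma gen_cell_singleton: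
  assumes "x \<in> tproj" shows "cell_gens (sed x) {Vertex x}" "gen_cell {Vertex x} = {x}"
proof -
  show c: "cell_gens (sed x) {Vertex x}"
    using assms sed_not_UNIV[OF assms] by (auto simp: cell_gens_def)
  have "gen_hull {Vertex x} = {rvec x}"
    by (auto simp: gen_hull_def intro: exI[of _ "\<lambda>_. 1"])
  then show "gen_cell {Vertex x} = {x}"
    unfolding gen_cell_eq[OF c] using stratum_point_rvec[OF assms] by auto
qed

section \<open>Frames, dimension and volume of a unimodular cell\<close>

lemma unimodular_gens_frame:
  assumes "unimodular_gens {} Q" "distinct gs" "Vertex x0 \<notin> set gs" "Q = insert (Vertex x0) (set gs)"
  shows "lattice_basis (gen_cell Q) (map (dir_vec x0) gs)" "independent_list (map (dir_vec x0) gs)"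
proof -
  show "lattice_basis (gen_cell Q) (map (dir_vec x0) gs)"
    using lattice_basis_gens[OF assms(2,3,4)] assms(1) by (auto simp: unimodular_gens_def)
  show "independent_list (map (dir_vec x0) gs)"
    unfolding independent_list_def divker_empty[symmetric]
    using gens_independent_list[OF assms(2,3), of "{}"] assms(1,4) by (simp add: unimodular_gens_def)
qed

lemma gens_listing:
  assumes "cell_gens S Q" "Vertex x0 \<in> Q"
  obtains gs where "distinct gs" "Vertex x0 \<notin> set gs" "Q = insert (Vertex x0) (set gs)"
proof -
  have "finite (Q - {Vertex x0})" using assms by (simp add: cell_gens_def)
  then obtain gs where "set gs = Q - {Vertex x0}" "distinct gs" using finite_distinct_list by blast
  then show ?thesis using assms(2) by (intro that[of gs]) auto
qed

text \<open>The tangent preimage is spanned by the vectors from a base vertex together with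
  \<open>1\<close>, so \<open>1\<close> replaces the base vertex in the count of generators.
  \<open>tdim\<close> then subtracts the line through \<open>1\<close>.\<close>

lemma tdim_gen_cell:
  assumes "unimodular_gens {} Q" shows "tdim (gen_cell Q) + 1 = card Q"
proof -
  have c: "cell_gens {} Q" using assms by (simp add: unimodular_gens_def)
  obtain x0 where x0: "Vertex x0 \<in> Q" using cell_gens_obtain[OF c] by blast
  obtain gs where gs: "distinct gs" "Vertex x0 \<notin> set gs" "Q = insert (Vertex x0) (set gs)"
    using gens_listing[OF c x0] .
  let ?us = "map (dir_vec x0) gs"
  note ind = independent_listD[OF unimodular_gens_frame(2)[OF assms gs]]
  have "dir_vec x0 ` Q \<union> divker {} \<subseteq> span (insert 1 (set ?us))"
  proof -
    have "divker {} \<subseteq> span (insert 1 (set ?us))" unfolding divker_empty by (intro span_mono) auto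
    moreover have "dir_vec x0 ` Q \<subseteq> span (insert 1 (set ?us))"
      unfolding gs(3) by (auto simp: span_zero intro: span_base)
    ultimately show ?thesis by blast
  qed
  moreover have "insert 1 (set ?us) \<subseteq> span (dir_vec x0 ` Q \<union> divker {})"
    unfolding gs(3) divker_empty by (auto intro: span_base)
  ultimately have "tangent (gen_cell Q) = span (insert 1 (set ?us))"
    unfolding tangent_gen_cell[OF c x0] by (meson span_minimal subset_antisym subspace_span)
  then have "dim (tangent (gen_cell Q)) = card (insert 1 (set ?us))"
    using dim_span dim_eq_card_independent[OF ind(3)] by metis
  also have "\<dots> = card Q"
    using ind(2) distinct_card[OF ind(1)] distinct_card[OF gs(1)] gs(2) by (simp add: gs(3))
  finally have 1: "dim (tangent (gen_cell Q)) = card Q" .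
  have "independent {1 :: real ^ 'a}" using ind(3) independent_mono by blast
  then have "dim (divker {} :: (real ^ 'a) set) = 1"
    unfolding divker_empty using dim_span dim_eq_card_independent by (metis card_1_singleton_iff One_nat_def)
  moreover have "card Q > 0" unfolding gs(3) by (simp add: card_gt_0_iff)
  ultimately show ?thesis using 1 unfolding tdim_def csed_gen_cell[OF c] by simp
qed

text \<open>Modulo \<open>1\<close>, a lattice vector is an integral combination of basis vectors,
  on which the dual covectors take the values \<open>0\<close> and \<open>1\<close>.\<close>

lemma lattice_basis_pairing:
  assumes "csed F = {}" "lattice_basis F us" "dual_covectors us js" "v \<in> tlattice F" "j \<in> set js"
  shows "j \<bullet> v \<in> \<int>"
proof -
  obtain c :: "nat \<Rightarrow> int" where c: "v - (\<Sum>k<length us. of_int (c k) *\<^sub>R us ! k) \<in> span {1}"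
    using assms(1,2,4) unfolding lattice_basis_def divker_empty[symmetric] by force
  obtain a where a: "a < length us" "j = js ! a"
    using assms(3,5) by (auto simp: dual_covectors_def in_set_conv_nth)
  have "j \<bullet> v = j \<bullet> (\<Sum>k<length us. of_int (c k) *\<^sub>R us ! k)"
    using assms(3,5) c by (intro covectors_inner[of j "{}"]) (auto simp: dual_covectors_def)
  also have "\<dots> = (\<Sum>k<length us. of_int (c k) * (j \<bullet> us ! k))" by (simp add: inner_sum_right)
  also have "\<dots> \<in> \<int>"
    using assms(3) a by (intro Ints_sum Ints_mult) (auto simp: dual_covectors_def)
  finally show ?thesis .
qed

text \<open>Evaluation on dual covectors shows that the ratio of the two volume elements and its inverse
  are integers.\<close>

lemma volume_element_eq:
  assumes "csed F = {}" "lattice_basis F us"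
  shows "volume_element F us = wedge us"
proof -
  let ?P = "\<lambda>\<omega>. \<exists>bs. lattice_basis F bs \<and> \<omega> = wedge bs \<and> (\<exists>a>0. wedge bs = (\<lambda>js. a * wedge us js))"
  have ind: "independent_list bs" if "lattice_basis F bs" for bs
    using that assms(1) unfolding lattice_basis_def independent_list_def divker_empty[symmetric] by simp
  have int: "wedge bs js \<in> \<int>" if "lattice_basis F us" "dual_covectors us js" "lattice_basis F bs" for us bs js
    using that lattice_basis_pairing[OF assms(1) that(1,2)]
    by (intro wedge_integer) (auto simp: lattice_basis_def)
  have "\<omega> = wedge us" if \<omega>: "?P \<omega>" for \<omega>
  proof -
    obtain bs a where bs: "lattice_basis F bs" "\<omega> = wedge bs" "a > 0" "wedge bs = (\<lambda>js. a * wedge us js)"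
      using \<omega> by blast
    obtain js js' where js: "dual_covectors us js" "dual_covectors bs js'"
      using dual_covectors_exist[OF ind[OF assms(2)]] dual_covectors_exist[OF ind[OF bs(1)]] by blast
    have "a \<in> \<int>" using int[OF assms(2) js(1) bs(1)] wedge_dual[OF js(1)] bs(4) by simp
    then obtain m where m: "a = of_int m" by (auto elim: Ints_cases)
    have "1 = a * wedge us js'" using wedge_dual[OF js(2)] bs(4) by simp
    moreover obtain m' where "wedge us js' = of_int m'"
      using int[OF bs(1) js(2) assms(2)] by (auto elim: Ints_cases)
    ultimately have "real_of_int (m * m') = real_of_int 1" using m by simp
    then have "m * m' = 1" by (simp only: of_int_eq_iff)
    then have "m = 1" using bs(3) m zmult_eq_1_iff[of m m'] by auto
    then show ?thesis using bs m by simp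
  qed
  moreover have "?P (wedge us)" using assms(2) by (intro exI[of _ us] conjI refl exI[of _ 1]) auto
  ultimately show ?thesis unfolding volume_element_def by (intro some_equality)
qed

lemma csed_subset_tcell:
  assumes "finite V" "\<forall>x\<in>V. x \<in> tproj \<and> sed x = S" "J \<inter> S = {}"
  shows "S \<subseteq> csed (tcell V J)"
proof
  fix i assume i: "i \<in> S"
  have "x $ i = - \<infinity>" if "x \<in> tcell V J" for x
  proof -
    from that obtain z :: "ereal ^ 'a" and p \<mu> where z: "x = tnormalize z" "\<exists>i. z $ i \<noteq> - \<infinity>"
      "\<forall>v\<in>V. 0 \<le> p v" "(\<Sum>v\<in>V. p v) = 1" "\<forall>i\<in>J. 0 \<le> \<mu> i"
      "\<And>i. z $ i = (\<Sum>v\<in>V. ereal (p v) * v $ i) - (if i \<in> J then \<mu> i else 0)"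
      unfolding tcell_def by blast
    have zi: "z $ i = - \<infinity>" using i unfolding z(6) tcell_coordinate[OF assms z(3-5)] by simp
    obtain k where "z $ k \<noteq> - \<infinity>" using z(2) by blast
    moreover have "z $ k \<le> Max (range (\<lambda>i. z $ i))" by (intro Max_ge) auto
    ultimately have "Max (range (($) z)) \<noteq> - \<infinity>" by (metis ereal_infty_less_eq(2))
    then show ?thesis using zi by (cases "Max (range (($) z))") (auto simp: z(1) tnormalize_def)
  qed
  then show "i \<in> csed (tcell V J)" by (auto simp: csed_def sed_def)
qed

lemma gen_cell_tcell: "gen_cell (Vertex ` V \<union> Divisorial ` J) = tcell V J"
proof -
  have "gen_verts (Vertex ` V \<union> Divisorial ` J) = V" "gen_divs (Vertex ` V \<union> Divisorial ` J) = J"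
    by auto
  then show ?thesis by (simp add: gen_cell_def)
qed

lemma unimodular_cell_gens:
  assumes "unimodular_cell V J"
  shows "unimodular_gens (csed V) (Vertex ` V \<union> Divisorial ` J)"
proof -
  define S where "S = csed V"
  have V: "finite V" "V \<noteq> {}" "\<And>x. x \<in> V \<Longrightarrow> x \<in> tproj \<and> sed x = S" "J \<inter> S = {}"
    and int: "\<And>v i. v \<in> V \<Longrightarrow> rvec v $ i \<in> \<int>"
    using assms by (auto simp: unimodular_cell_def S_def)
  obtain vs js where l: "distinct vs" "set vs = V" "distinct js" "set js = J"
    "lattice_basis (tcell V J) (map (\<lambda>v. rvec v - rvec (hd vs)) (tl vs) @ map divisorial js)"
    using assms unfolding unimodular_cell_def by blast
  define x0 gs Q where "x0 = hd vs" and "gs = map Vertex (tl vs) @ map Divisorial js"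
    and "Q = Vertex ` V \<union> Divisorial ` J"
  have vs: "vs = x0 # tl vs" using V(2) l(2) by (cases vs) (auto simp: x0_def)
  have set: "V = insert x0 (set (tl vs))" "x0 \<notin> set (tl vs)" "distinct (tl vs)"
    using l(1,2) vs by (metis list.simps(15), metis distinct.simps(2), metis distinct_tl)
  have gs: "distinct gs" "Vertex x0 \<notin> set gs" "Q = insert (Vertex x0) (set gs)"
    using set l(3,4) by (auto simp: gs_def Q_def distinct_map inj_on_def)
  have basis: "lattice_basis (gen_cell Q) (map (dir_vec x0) gs)"
    using l(5) by (simp add: gs_def Q_def gen_cell_tcell x0_def[symmetric] comp_def)
  then have "gens_independent (csed (gen_cell Q)) Q"
    using gens_independent_list[OF gs(1,2), of "csed (gen_cell Q)"] gs(3) by (simp add: lattice_basis_def)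
  moreover have "S \<subseteq> csed (gen_cell Q)"
    using csed_subset_tcell[OF V(1) _ V(4)] V(3) by (simp add: Q_def gen_cell_tcell)
  ultimately have ind: "(\<Sum>q\<in>Q. \<alpha> q *\<^sub>R gen_vec q) \<in> divker S \<Longrightarrow> (\<Sum>q\<in>Q. gen_deg q * \<alpha> q) = 0 \<Longrightarrow>
     q \<in> Q \<Longrightarrow> \<alpha> q = 0" for \<alpha> q
    using divker_mono unfolding gens_independent_def by blast
  have finQ: "finite Q" by (simp add: gs(3))
  have gv: "gen_verts Q = V" "gen_divs Q = J" by (auto simp: Q_def)
  have "S \<union> J \<noteq> UNIV"
  proof
    assume U: "S \<union> J = UNIV"
    have "S \<noteq> UNIV" using V(2,3) sed_not_UNIV by blast
    then obtain j where j: "j \<in> J" using U by blast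
    \<comment> \<open>The divisorial vectors of \<open>J\<close> sum to a vector equal to
      \<open>-1\<close> on all of \<open>J\<close>. If \<open>S \<union> J = UNIV\<close>, it is
      constant outside \<open>S\<close>, which is a nontrivial relation modulo
      \<open>divker S\<close>.\<close>
    define \<alpha> :: "'a generator \<Rightarrow> real" where "\<alpha> = (\<lambda>q. 1 - gen_deg q)"
    have "(\<Sum>q\<in>Q. gen_deg q * \<alpha> q) = 0" by (simp add: sum_gens[OF finQ] \<alpha>_def)
    moreover have "(\<Sum>q\<in>Q. \<alpha> q *\<^sub>R gen_vec q) = (\<Sum>i\<in>J. 1 *\<^sub>R divisorial i)"
      by (simp add: sum_gens[OF finQ] \<alpha>_def gv)
    then have "(\<Sum>q\<in>Q. \<alpha> q *\<^sub>R gen_vec q) $ i = (if i \<in> J then - 1 else 0)" for i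
      by (simp only: sum_divisorial_nth)
    then have "(\<Sum>q\<in>Q. \<alpha> q *\<^sub>R gen_vec q) \<in> divker S"
      unfolding divker_iff using U by (intro exI[of _ "-1"]) auto
    ultimately have "\<alpha> (Divisorial j) = 0" using ind j by (auto simp: Q_def)
    then show False by (simp add: \<alpha>_def)
  qed
  then have c: "cell_gens S Q"
    using finQ V unfolding cell_gens_def gv by (auto simp: Q_def)
  moreover have int': "rvec x $ i \<in> \<int>" if "Vertex x \<in> Q" for x i using int that by (auto simp: Q_def)
  moreover have "gens_independent S Q \<and> gens_saturated S Q"
    using lattice_basis_gens[OF gs c int'] basis by blast
  ultimately show ?thesis unfolding unimodular_gens_def S_def[symmetric] Q_def[symmetric] by blast
qed

section \<open>Cells at infinity\<close>

lemma cell_gens_tsend: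
  assumes "cell_gens S Q" "A \<subseteq> gen_divs Q" "V \<subseteq> gen_verts Q" "V \<noteq> {}" "J \<subseteq> gen_divs Q" "A \<inter> J = {}"
  shows "cell_gens (S \<union> A) (Vertex ` tsend A ` V \<union> Divisorial ` J)"
proof -
  have Q: "finite Q" "\<And>x. Vertex x \<in> Q \<Longrightarrow> x \<in> tproj \<and> sed x = S" "gen_divs Q \<inter> S = {}"
    "S \<union> gen_divs Q \<noteq> UNIV"
    using assms(1) by (auto simp: cell_gens_def)
  have U: "S \<union> A \<noteq> UNIV" using cell_gens_not_UNIV[OF assms(1,2)] .
  have "finite V" "finite J" using finite_gens[OF Q(1)] assms(3,5) finite_subset by auto
  moreover have "tsend A v = stratum_point (S \<union> A) (rvec v)" if "v \<in> V" for v
    using Q(2)[of v] that assms(3) tsend_eq[of v A] by auto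
  then have "tsend A v \<in> tproj" "sed (tsend A v) = S \<union> A" if "v \<in> V" for v
    using that stratum_point_tproj[OF U] sed_stratum_point[OF U] by auto
  moreover have "J \<inter> (S \<union> A) = {}" "S \<union> A \<union> J \<noteq> UNIV"
    using Q(3,4) assms(2,5,6) by blast+
  moreover have "gen_verts (Vertex ` tsend A ` V \<union> Divisorial ` J) = tsend A ` V"
    "gen_divs (Vertex ` tsend A ` V \<union> Divisorial ` J) = J" by auto
  ultimately show ?thesis using assms(4) unfolding cell_gens_def by auto
qed

text \<open>Sending every recession direction to infinity projects the cell onto the simplex spanned
  by the projected vertices. By independence distinct vertices have distinct projections, so weights
  can be carried from \<open>V\<close> to its image and back.\<close>

lemma most_sedentary_tcell:
  assumes "unimodular_gens S Q"
  shows "most_sedentary (gen_cell Q) = tcell (tsend (gen_divs Q) ` gen_verts Q) {}"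
proof -
  have c: "cell_gens S Q" and ind: "gens_independent S Q" using assms by (auto simp: unimodular_gens_def)
  define V J T g where "V = gen_verts Q" and "J = gen_divs Q" and "T = S \<union> gen_divs Q"
    and "g = tsend (gen_divs Q)"
  have Q: "finite Q" "V \<noteq> {}" "\<And>x. x \<in> V \<Longrightarrow> x \<in> tproj \<and> sed x = S"
    using c by (auto simp: cell_gens_def V_def)
  have fin: "finite V" using finite_gens[OF Q(1)] by (auto simp: V_def)
  have T: "T \<noteq> UNIV" using cell_gens_not_UNIV[OF c subset_refl] by (simp add: T_def)
  have g: "g v = stratum_point T (rvec v)" if "v \<in> V" for v
    using Q(3)[OF that] tsend_eq[of v J] by (simp add: g_def T_def J_def)
  have gd: "rvec v - rvec (g v) \<in> divker T" if "v \<in> V" for v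
    using stratum_point_rvec[of "g v"] g[OF that] stratum_point_tproj[OF T] sed_stratum_point[OF T]
      stratum_point_eq_iff[OF T] by metis
  have dJ: "(\<Sum>i\<in>J. f i *\<^sub>R divisorial i) \<in> divker T" for f :: "'a \<Rightarrow> real"
    by (intro subspace_sum[OF divker_subspace] divker_arith(4) divisorial_in_divker) (simp add: T_def J_def)
  have inj: "inj_on g V"
  proof (rule inj_onI, rule ccontr)
    fix v w assume vw: "v \<in> V" "w \<in> V" "g v = g w" "v \<noteq> w"
    then have "rvec v - rvec w \<in> divker T" using g stratum_point_eq_iff[OF T] by metis
    then obtain t where t: "\<And>i. i \<notin> T \<Longrightarrow> (rvec v - rvec w) $ i = t" by (auto simp: divker_iff)
    \<comment> \<open>If \<open>v\<close> and \<open>w\<close> have the same projection, their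
      difference is constant outside \<open>T\<close>. Divisorial vectors of \<open>J\<close>
      correct the coordinates in \<open>J\<close> to the same constant, which yields a forbidden
      relation.\<close>
    define \<alpha> where "\<alpha> = (\<lambda>q. case q of Vertex x \<Rightarrow> (if x = v then 1 else if x = w then -1 else 0)
      | Divisorial i \<Rightarrow> (rvec v - rvec w) $ i - t)"
    have s: "(\<Sum>x\<in>V. f (if x = v then 1 else if x = w then - 1 else (0::real)) x) = f 1 v + f (-1) w"
      if "\<And>x. f 0 x = 0" for f :: "real \<Rightarrow> (ereal,'a) vec \<Rightarrow> 'b::comm_monoid_add"
    proof -
      have "(\<Sum>x\<in>V. f (if x = v then 1 else if x = w then - 1 else 0) x) =
        (\<Sum>x\<in>{v, w}. f (if x = v then 1 else if x = w then - 1 else 0) x)"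
        using vw fin that by (intro sum.mono_neutral_right) auto
      then show ?thesis using vw(4) by simp
    qed
    have "(\<Sum>q\<in>Q. gen_deg q * \<alpha> q) = 0"
      using s[of "\<lambda>t x. t"] by (simp add: sum_gens[OF Q(1)] V_def[symmetric] \<alpha>_def)
    moreover have "(\<Sum>q\<in>Q. \<alpha> q *\<^sub>R gen_vec q) =
        rvec v - rvec w + (\<Sum>i\<in>J. ((rvec v - rvec w) $ i - t) *\<^sub>R divisorial i)"
      using s[of "\<lambda>t x. t *\<^sub>R rvec x"] by (simp add: sum_gens[OF Q(1)] V_def[symmetric] J_def[symmetric] \<alpha>_def)
    then have e: "(\<Sum>q\<in>Q. \<alpha> q *\<^sub>R gen_vec q) $ i =
        (rvec v - rvec w) $ i + (if i \<in> J then - ((rvec v - rvec w) $ i - t) else 0)" for i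
      by (simp only: vector_add_component sum_divisorial_nth)
    have "(\<Sum>q\<in>Q. \<alpha> q *\<^sub>R gen_vec q) \<in> divker S"
      unfolding divker_iff e using t by (intro exI[of _ t]) (auto simp: T_def J_def)
    ultimately have "\<alpha> (Vertex v) = 0" using ind vw(1) unfolding gens_independent_def V_def by blast
    then show False by (simp add: \<alpha>_def)
  qed
  define W where "W = g ` V"
  have cW: "cell_gens T (Vertex ` W \<union> Divisorial ` {})"
    using cell_gens_tsend[OF c, of J V "{}"] Q(2) by (simp add: W_def g_def T_def J_def V_def)
  have eqW: "stratum_point T ` gen_hull (Vertex ` W) = tcell W {}"
    using gen_cell_eq[OF cW] gen_cell_tcell[of W "{}"] by (auto simp: image_def)
  have sumW: "(\<Sum>q\<in>Vertex ` W. f q) = (\<Sum>v\<in>V. f (Vertex (g v)))" for f :: "'a generator \<Rightarrow> 'b::comm_monoid_add"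
    unfolding W_def using inj by (simp add: sum.reindex inj_on_def)
  have diff: "stratum_point T ((\<Sum>v\<in>V. p v *\<^sub>R rvec v) + (\<Sum>i\<in>J. f i *\<^sub>R divisorial i)) =
      stratum_point T (\<Sum>v\<in>V. p v *\<^sub>R rvec (g v))" for p f
  proof -
    have "(\<Sum>v\<in>V. p v *\<^sub>R rvec v) + (\<Sum>i\<in>J. f i *\<^sub>R divisorial i) - (\<Sum>v\<in>V. p v *\<^sub>R rvec (g v)) =
      (\<Sum>v\<in>V. p v *\<^sub>R (rvec v - rvec (g v))) + (\<Sum>i\<in>J. f i *\<^sub>R divisorial i)"
      by (simp add: scaleR_diff_right sum_subtractf)
    also have "\<dots> \<in> divker T"
      by (rule divker_arith(2)[OF subspace_sum[OF divker_subspace divker_arith(4)[OF gd]] dJ])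
    finally show ?thesis by (simp add: stratum_point_eq_iff[OF T])
  qed
  have hullQ: "gen_hull Q = {(\<Sum>v\<in>V. p v *\<^sub>R rvec v) + (\<Sum>i\<in>J. f i *\<^sub>R divisorial i) | p f.
      (\<forall>v\<in>V. 0 \<le> p v) \<and> (\<forall>i\<in>J. 0 \<le> f i) \<and> (\<Sum>v\<in>V. p v) = 1}" (is "_ = ?H")
  proof (intro subset_antisym subsetI)
    fix u assume "u \<in> gen_hull Q"
    then obtain \<alpha> where "u = (\<Sum>q\<in>Q. \<alpha> q *\<^sub>R gen_vec q)" "\<forall>q\<in>Q. 0 \<le> \<alpha> q"
      "(\<Sum>q\<in>Q. gen_deg q * \<alpha> q) = 1" unfolding gen_hull_def by blast
    then show "u \<in> ?H"
      by (intro CollectI exI[of _ "\<lambda>v. \<alpha> (Vertex v)"] exI[of _ "\<lambda>i. \<alpha> (Divisorial i)"])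
        (auto simp: sum_gens[OF Q(1)] V_def J_def)
  next
    fix u assume "u \<in> ?H"
    then obtain p f where pf: "u = (\<Sum>v\<in>V. p v *\<^sub>R rvec v) + (\<Sum>i\<in>J. f i *\<^sub>R divisorial i)"
      "\<forall>v\<in>V. 0 \<le> p v" "\<forall>i\<in>J. 0 \<le> f i" "(\<Sum>v\<in>V. p v) = 1" by blast
    define \<alpha> where "\<alpha> = (\<lambda>q. case q of Vertex v \<Rightarrow> p v | Divisorial i \<Rightarrow> f i)"
    have "0 \<le> \<alpha> q" if "q \<in> Q" for q
      using that pf by (cases q) (auto simp: \<alpha>_def V_def J_def)
    then show "u \<in> gen_hull Q" unfolding gen_hull_def using pf
      by (intro CollectI exI[of _ \<alpha>]) (auto simp: sum_gens[OF Q(1)] V_def J_def \<alpha>_def)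
  qed
  have hullW: "gen_hull (Vertex ` W) = {\<Sum>v\<in>V. p v *\<^sub>R rvec (g v) | p. (\<forall>v\<in>V. 0 \<le> p v) \<and> (\<Sum>v\<in>V. p v) = 1}"
    (is "_ = ?H")
  proof (intro subset_antisym subsetI)
    fix u assume "u \<in> gen_hull (Vertex ` W)"
    then obtain \<alpha> where "u = (\<Sum>q\<in>Vertex ` W. \<alpha> q *\<^sub>R gen_vec q)" "\<forall>q\<in>Vertex ` W. 0 \<le> \<alpha> q"
      "(\<Sum>q\<in>Vertex ` W. gen_deg q * \<alpha> q) = 1" unfolding gen_hull_def by blast
    then show "u \<in> ?H" by (intro CollectI exI[of _ "\<lambda>v. \<alpha> (Vertex (g v))"]) (simp add: sumW, simp add: W_def)
  next
    fix u assume "u \<in> ?H"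
    then obtain p where p: "u = (\<Sum>v\<in>V. p v *\<^sub>R rvec (g v))" "\<forall>v\<in>V. 0 \<le> p v" "(\<Sum>v\<in>V. p v) = 1" by blast
    define \<alpha> where "\<alpha> = (\<lambda>q. case q of Vertex x \<Rightarrow> p (inv_into V g x) | Divisorial i \<Rightarrow> 0)"
    have "\<alpha> (Vertex (g v)) = p v" if "v \<in> V" for v using that inj by (simp add: \<alpha>_def)
    then show "u \<in> gen_hull (Vertex ` W)" unfolding gen_hull_def using p
      by (intro CollectI exI[of _ \<alpha>]) (simp add: sumW, simp add: W_def)
  qed
  have "stratum_point T ` gen_hull Q = stratum_point T ` gen_hull (Vertex ` W)"
  proof (intro subset_antisym subsetI)
    fix x assume "x \<in> stratum_point T ` gen_hull Q"
    then obtain p f where "x = stratum_point T ((\<Sum>v\<in>V. p v *\<^sub>R rvec v) + (\<Sum>i\<in>J. f i *\<^sub>R divisorial i))"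
      "\<forall>v\<in>V. 0 \<le> p v" "(\<Sum>v\<in>V. p v) = 1" unfolding hullQ by blast
    then show "x \<in> stratum_point T ` gen_hull (Vertex ` W)" unfolding hullW diff by blast
  next
    fix x assume "x \<in> stratum_point T ` gen_hull (Vertex ` W)"
    then obtain p where p: "x = stratum_point T (\<Sum>v\<in>V. p v *\<^sub>R rvec (g v))"
      "\<forall>v\<in>V. 0 \<le> p v" "(\<Sum>v\<in>V. p v) = 1" unfolding hullW by blast
    have "(\<Sum>v\<in>V. p v *\<^sub>R rvec v) + (\<Sum>i\<in>J. 0 *\<^sub>R divisorial i) \<in> gen_hull Q"
      unfolding hullQ using p(2,3)
      by (intro CollectI exI[of _ p] exI[of _ "\<lambda>_. 0"]) auto
    then show "x \<in> stratum_point T ` gen_hull Q" unfolding p(1) diff[of p "\<lambda>_. 0", symmetric] by blast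
  qed
  then show ?thesis
    unfolding most_sedentary_gen_cell[OF c] T_def[symmetric] eqW by (simp add: W_def g_def V_def)
qed

text \<open>The simplex is a continuous image of the convex hull of finitely many lifts. This serves
  to recognise most sedentary faces as finite faces.\<close>

lemma compact_simplex:
  assumes "cell_gens T (Vertex ` W)" shows "compact (tcell W {})"
proof -
  have W: "finite W" "\<And>x. x \<in> W \<Longrightarrow> x \<in> tproj \<and> sed x = T"
    using assms by (auto simp: cell_gens_def inj_on_def dest: finite_imageD)
  have T: "T \<noteq> UNIV" using assms by (auto simp: cell_gens_def)
  have inj: "inj_on rvec W"
    using W(2) stratum_point_rvec by (metis inj_onI)
  have hull: "gen_hull (Vertex ` W) = convex hull (rvec ` W)"
  proof -
    have sW: "(\<Sum>q\<in>Vertex ` W. f q) = (\<Sum>v\<in>W. f (Vertex v))" for f :: "'a generator \<Rightarrow> 'b::comm_monoid_add"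
      by (simp add: sum.reindex inj_on_def)
    have sR: "(\<Sum>x\<in>rvec ` W. f x) = (\<Sum>v\<in>W. f (rvec v))" for f :: "(real, 'a) vec \<Rightarrow> 'b::comm_monoid_add"
      using inj by (simp add: sum.reindex)
    show ?thesis
      unfolding convex_hull_finite[OF finite_imageI[OF W(1)]] gen_hull_def sW sR
    proof (intro subset_antisym subsetI; clarsimp)
      fix \<alpha> :: "'a generator \<Rightarrow> real" assume "\<forall>v\<in>W. 0 \<le> \<alpha> (Vertex v)" "(\<Sum>v\<in>W. \<alpha> (Vertex v)) = 1"
      then show "\<exists>u. (\<forall>v\<in>W. 0 \<le> u (rvec v)) \<and> (\<Sum>v\<in>W. u (rvec v)) = 1 \<and>
        (\<Sum>v\<in>W. u (rvec v) *\<^sub>R rvec v) = (\<Sum>v\<in>W. \<alpha> (Vertex v) *\<^sub>R rvec v)"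
        using inj by (intro exI[of _ "\<lambda>x. \<alpha> (Vertex (inv_into W rvec x))"]) simp
    next
      fix u :: "(real, 'a) vec \<Rightarrow> real" assume "\<forall>v\<in>W. 0 \<le> u (rvec v)" "(\<Sum>v\<in>W. u (rvec v)) = 1"
      then show "\<exists>\<alpha>. (\<Sum>v\<in>W. u (rvec v) *\<^sub>R rvec v) = (\<Sum>v\<in>W. \<alpha> (Vertex v) *\<^sub>R rvec v) \<and>
          (\<forall>v\<in>W. 0 \<le> \<alpha> (Vertex v)) \<and> (\<Sum>v\<in>W. \<alpha> (Vertex v)) = 1"
        by (intro exI[of _ "\<lambda>q. case q of Vertex v \<Rightarrow> u (rvec v) | Divisorial i \<Rightarrow> 0"]) simp
    qed
  qed
  have "tcell W {} = stratum_point T ` (convex hull (rvec ` W))"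
    using gen_cell_eq[OF assms] gen_cell_tcell[of W "{}"] hull by (auto simp: image_def)
  moreover have "compact (stratum_point T ` (convex hull (rvec ` W)))"
    using continuous_on_subset[OF continuous_stratum_point[OF T]] W(1)
    by (intro compact_continuous_image finite_imp_compact_convex_hull) auto
  ultimately show ?thesis by simp
qed

section \<open>Cells of a triangulation\<close>

text \<open>Proved directly from \<open>tcell\<close>, because it is applied to joins whose
  generators are not yet known to satisfy \<open>cell_gens\<close>. The point is obtained by putting
  all weight on \<open>x\<close> and infinite coefficients on \<open>A\<close>.\<close>

lemma tsend_in_tcell:
  fixes x :: "ereal ^ 'a::finite"
  assumes "finite V" "x \<in> V" "x \<in> tproj" "A \<subseteq> J" "i \<notin> A" "x $ i \<noteq> - \<infinity>"
  shows "tsend A x \<in> tcell V J"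
proof -
  define z :: "ereal ^ 'a" where "z = (\<chi> i. if i \<in> A then - \<infinity> else x $ i)"
  define p :: "ereal ^ 'a \<Rightarrow> real" where "p = (\<lambda>v. if v = x then 1 else 0)"
  define \<mu> :: "'a \<Rightarrow> ereal" where "\<mu> = (\<lambda>i. if i \<in> A then \<infinity> else 0)"
  have s: "(\<Sum>v\<in>V. ereal (p v) * v $ k) = x $ k" for k
  proof -
    have "(\<Sum>v\<in>V. ereal (p v) * v $ k) = (\<Sum>v\<in>V. if v = x then x $ k else 0)"
      by (intro sum.cong) (auto simp: p_def)
    then show ?thesis using assms(1,2) by simp
  qed
  show ?thesis unfolding tcell_def tsend_def z_def[symmetric]
  proof (intro CollectI exI[of _ z] conjI exI[of _ p] exI[of _ \<mu>] refl ballI allI)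
    show "\<exists>i. z $ i \<noteq> - \<infinity>" using assms(5,6) by (auto simp: z_def)
    show "0 \<le> p v" for v by (simp add: p_def)
    show "sum p V = 1" using assms(1,2) by (simp add: p_def)
    show "0 \<le> \<mu> i" for i by (simp add: \<mu>_def)
    show "z $ k = (\<Sum>v\<in>V. ereal (p v) * v $ k) - (if k \<in> J then \<mu> k else 0)" for k
    proof -
      have "x $ k \<le> 0" using assms(3) by (simp add: tproj_def)
      then have "x $ k \<noteq> \<infinity>" by auto
      then show ?thesis unfolding s using assms(4) by (auto simp: z_def \<mu>_def minus_ereal_def)
    qed
  qed
qed

lemma tsend_empty: "x \<in> tproj \<Longrightarrow> tsend {} x = x"
  by (simp add: tsend_eq stratum_point_rvec)

locale triangulated_complex =
  fixes K :: "(ereal ^ 'n::finite) set set" and b :: "(ereal ^ 'n) set \<Rightarrow> ereal ^ 'n"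
  assumes finite_K: "finite K"
    and cells: "F \<in> K \<Longrightarrow> \<exists>V J. unimodular_cell V J \<and> F = tcell V J \<and> tcell_faces V J \<subseteq> K \<and>
      (\<forall>G\<in>K. F \<inter> G \<noteq> {} \<longrightarrow> F \<inter> G \<in> tcell_faces V J)"
    and barycenters: "barycenters K b"
begin

lemma cell_data:
  assumes "F \<in> K"
  obtains Q where "unimodular_gens (csed F) Q" "F = gen_cell Q"
    "tcell_faces (gen_verts Q) (gen_divs Q) \<subseteq> K"
    "\<And>G. G \<in> K \<Longrightarrow> F \<inter> G \<noteq> {} \<Longrightarrow> F \<inter> G \<in> tcell_faces (gen_verts Q) (gen_divs Q)"
proof -
  obtain V J where VJ: "unimodular_cell V J" "F = tcell V J" "tcell_faces V J \<subseteq> K"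
    "\<forall>G\<in>K. F \<inter> G \<noteq> {} \<longrightarrow> F \<inter> G \<in> tcell_faces V J" using cells[OF assms] by blast
  define Q where "Q = Vertex ` V \<union> Divisorial ` J"
  have u: "unimodular_gens (csed V) Q" using unimodular_cell_gens[OF VJ(1)] by (simp add: Q_def)
  have g: "gen_verts Q = V" "gen_divs Q = J" "F = gen_cell Q"
    using VJ(2) by (auto simp: Q_def gen_cell_tcell)
  have "csed F = csed V" unfolding g(3) using u csed_gen_cell unfolding unimodular_gens_def by blast
  then show ?thesis using that[of Q] u g VJ(3,4) by simp
qed

lemma cell_nonempty: "F \<in> K \<Longrightarrow> F \<noteq> {}"
  by (metis cell_data gen_cell_nonempty(2) unimodular_gens_def)

text \<open>As \<open>F\<close> is its own intersection with \<open>G\<close>, it is one of the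
  listed faces of \<open>G\<close>. Sedentarity \<open>{}\<close> forces the set \<open>A\<close> of
  directions at infinity to be empty, so the vertices are not moved.\<close>

lemma face_gens_exist:
  assumes "G \<in> K" "csed G = {}" "unimodular_gens {} Q" "G = gen_cell Q"
    "\<And>F. F \<in> K \<Longrightarrow> G \<inter> F \<noteq> {} \<Longrightarrow> G \<inter> F \<in> tcell_faces (gen_verts Q) (gen_divs Q)"
    "F \<in> K" "F \<subseteq> G" "csed F = {}"
  obtains Q' where "Q' \<subseteq> Q" "gen_verts Q' \<noteq> {}" "F = gen_cell Q'"
proof -
  have c: "cell_gens {} Q" using assms(3) by (simp add: unimodular_gens_def)
  have "F \<in> tcell_faces (gen_verts Q) (gen_divs Q)"
    using assms(5)[OF assms(6)] assms(7) cell_nonempty[OF assms(6)] by (simp add: Int_absorb1)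
  then obtain V' J' A where f: "F = tcell (tsend A ` V') J'" "V' \<subseteq> gen_verts Q" "V' \<noteq> {}"
    "J' \<subseteq> gen_divs Q" "A \<subseteq> gen_divs Q" "A \<inter> J' = {}" unfolding tcell_faces_def by blast
  have "cell_gens ({} \<union> A) (Vertex ` tsend A ` V' \<union> Divisorial ` J')"
    using cell_gens_tsend[OF c f(5,2,3,4,6)] .
  from csed_gen_cell[OF this] have "A = {}" using f(1) assms(8) by (simp add: gen_cell_tcell)
  moreover have "tsend {} v = v" if "v \<in> V'" for v
    using that f(2) c by (intro tsend_empty) (auto simp: cell_gens_def)
  ultimately have "F = tcell V' J'" using f(1) by (simp add: image_def)
  then show ?thesis using f
    by (intro that[of "Vertex ` V' \<union> Divisorial ` J'"]) (auto simp: gen_cell_tcell)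
qed

text \<open>For a cell of sedentarity \<open>{}\<close> this recovers the generators from the point set.\<close>

definition gens :: "(ereal ^ 'n) set \<Rightarrow> 'n generator set" where
  "gens F = Vertex ` {x \<in> F. {x} \<in> K \<and> sed x = {}} \<union> Divisorial ` (\<Union>x\<in>F. sed x)"

text \<open>A singleton cell inside the face is a face of \<open>G\<close>, so its point is a vertex
  of \<open>Q\<close>, and \<open>vertex_in_face\<close> places it in \<open>Q'\<close>. The
  coordinates infinite somewhere are the recession directions, since each of these can be sent to
  infinity by itself.\<close>

lemma gens_face:
  assumes "G \<in> K" "csed G = {}" "unimodular_gens {} Q" "G = gen_cell Q"
    "tcell_faces (gen_verts Q) (gen_divs Q) \<subseteq> K"
    "\<And>F. F \<in> K \<Longrightarrow> G \<inter> F \<noteq> {} \<Longrightarrow> G \<inter> F \<in> tcell_faces (gen_verts Q) (gen_divs Q)"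
    "Q' \<subseteq> Q" "gen_verts Q' \<noteq> {}"
  shows "gen_cell Q' \<in> K" "gens (gen_cell Q') = Q'"
proof -
  have c: "cell_gens {} Q" using assms(3) by (simp add: unimodular_gens_def)
  have inK: "gen_cell R \<in> K" if R: "R \<subseteq> Q" "gen_verts R \<noteq> {}" for R
  proof -
    have "tsend {} v = v" if "v \<in> gen_verts R" for v
      using that R c by (intro tsend_empty) (auto simp: cell_gens_def)
    then have "tsend {} ` gen_verts R = gen_verts R" by (simp add: image_def)
    moreover have "tcell (tsend {} ` gen_verts R) (gen_divs R) \<in> tcell_faces (gen_verts Q) (gen_divs Q)"
      unfolding tcell_faces_def using R by blast
    ultimately show ?thesis using assms(5) by (auto simp: gen_cell_def)
  qed
  show "gen_cell Q' \<in> K" using inK[OF assms(7,8)] .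
  have c': "cell_gens {} Q'" using cell_gens_subset[OF c assms(7,8)] .
  have v: "x \<in> gen_cell Q' \<and> {x} \<in> K \<and> sed x = {} \<longleftrightarrow> Vertex x \<in> Q'" for x
  proof
    assume x: "Vertex x \<in> Q'"
    then have "x \<in> tproj" "sed x = {}" using c' by (auto simp: cell_gens_def)
    moreover have "gen_cell {Vertex x} \<in> K" using x assms(7) by (intro inK) auto
    ultimately show "x \<in> gen_cell Q' \<and> {x} \<in> K \<and> sed x = {}"
      using vertex_in_gen_cell[OF c' x] gen_cell_singleton(2) by metis
  next
    assume x: "x \<in> gen_cell Q' \<and> {x} \<in> K \<and> sed x = {}"
    then have "{x} \<subseteq> G" using gen_cell_mono[OF c assms(7,8)] assms(4) by auto
    moreover have "csed {x} = {}" using x by (simp add: csed_def)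
    ultimately obtain R where R: "R \<subseteq> Q" "gen_verts R \<noteq> {}" "{x} = gen_cell R"
      using face_gens_exist[OF assms(1-4,6), of "{x}"] x by blast
    then obtain w where w: "Vertex w \<in> R" by blast
    then have "w \<in> gen_cell R" using vertex_in_gen_cell[OF cell_gens_subset[OF c R(1,2)]] by blast
    then have "w = x" using R(3) by (metis singletonD)
    then have "Vertex x \<in> Q" using w R(1) by auto
    then show "Vertex x \<in> Q'" using vertex_in_face[OF assms(3,7,8)] x by blast
  qed
  have d: "i \<in> (\<Union>x\<in>gen_cell Q'. sed x) \<longleftrightarrow> Divisorial i \<in> Q'" for i
  proof
    assume "i \<in> (\<Union>x\<in>gen_cell Q'. sed x)"
    then obtain x where x: "x \<in> gen_cell Q'" "i \<in> sed x" by blast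
    obtain A where "A \<subseteq> gen_divs Q'" "sed x = {} \<union> A" using gen_cell_sed_cases[OF c' x(1)] .
    then show "Divisorial i \<in> Q'" using x(2) by auto
  next
    assume i: "Divisorial i \<in> Q'"
    obtain u where "u \<in> gen_hull Q'" using gen_cell_nonempty[OF c'] by auto
    then have "stratum_point ({} \<union> {i}) u \<in> {x \<in> gen_cell Q'. sed x = {} \<union> {i}}"
      using gen_cell_sed[OF c', of "{i}"] i by blast
    then show "i \<in> (\<Union>x\<in>gen_cell Q'. sed x)" by auto
  qed
  have "q \<in> gens (gen_cell Q') \<longleftrightarrow> q \<in> Q'" for q
    using v d by (cases q) (auto simp: gens_def image_iff)
  then show "gens (gen_cell Q') = Q'" by blast
qed

lemma gens_cell:
  assumes "F \<in> K" "csed F = {}"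
  shows "unimodular_gens {} (gens F)" "gen_cell (gens F) = F"
    "\<And>Q. Q \<subseteq> gens F \<Longrightarrow> gen_verts Q \<noteq> {} \<Longrightarrow> gen_cell Q \<in> K"
    "\<And>Q. Q \<subseteq> gens F \<Longrightarrow> gen_verts Q \<noteq> {} \<Longrightarrow> gens (gen_cell Q) = Q"
    "\<And>F'. F' \<in> K \<Longrightarrow> csed F' = {} \<Longrightarrow> F' \<subseteq> F \<Longrightarrow> gens F' \<subseteq> gens F"
proof -
  obtain Q where Q: "unimodular_gens {} Q" "F = gen_cell Q"
    "tcell_faces (gen_verts Q) (gen_divs Q) \<subseteq> K"
    "\<And>G. G \<in> K \<Longrightarrow> F \<inter> G \<noteq> {} \<Longrightarrow> F \<inter> G \<in> tcell_faces (gen_verts Q) (gen_divs Q)"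
    using cell_data[OF assms(1)] assms(2) by metis
  note face = gens_face[OF assms Q]
  have "gen_verts Q \<noteq> {}" using Q(1) by (auto simp: unimodular_gens_def cell_gens_def)
  then have g: "gens F = Q" using face(2)[of Q] Q(2) by simp
  show "unimodular_gens {} (gens F)" "gen_cell (gens F) = F" unfolding g using Q(1,2) by auto
  show "gen_cell Q' \<in> K" "gens (gen_cell Q') = Q'" if "Q' \<subseteq> gens F" "gen_verts Q' \<noteq> {}" for Q'
    using face that by (simp_all add: g)
  show "gens F' \<subseteq> gens F" if F': "F' \<in> K" "csed F' = {}" "F' \<subseteq> F" for F'
  proof -
    obtain Q' where "Q' \<subseteq> Q" "gen_verts Q' \<noteq> {}" "F' = gen_cell Q'"
      using face_gens_exist[OF assms Q(1,2,4) F'(1,3,2)] by blast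
    then show ?thesis using face(2) g by simp
  qed
qed

lemma cell_gens_gens: "F \<in> K \<Longrightarrow> csed F = {} \<Longrightarrow> cell_gens {} (gens F)"
  using gens_cell(1) by (simp add: unimodular_gens_def)

lemma finite_gens_cell: "F \<in> K \<Longrightarrow> csed F = {} \<Longrightarrow> finite (gens F)"
  using cell_gens_gens by (simp add: cell_gens_def)

lemma card_gens: "F \<in> K \<Longrightarrow> csed F = {} \<Longrightarrow> card (gens F) = tdim F + 1"
  using tdim_gen_cell[OF gens_cell(1)] gens_cell(2) by simp

lemma tdim_strict_mono:
  assumes "F \<in> K" "csed F = {}" "G \<in> K" "csed G = {}" "F \<subset> G"
  shows "tdim F < tdim G"
proof -
  have "gens F \<subseteq> gens G" using gens_cell(5)[OF assms(3,4,1,2)] assms(5) by blast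
  moreover have "gens F \<noteq> gens G"
    using gens_cell(2)[OF assms(1,2)] gens_cell(2)[OF assms(3,4)] assms(5) by (metis less_irrefl)
  ultimately have "card (gens F) < card (gens G)"
    using finite_gens_cell[OF assms(3,4)] by (intro psubset_card_mono) auto
  then show ?thesis using card_gens assms by simp
qed

section \<open>Most sedentary faces and barycenters\<close>

lemma csed_antimono: "F \<subseteq> G \<Longrightarrow> csed G \<subseteq> csed F"
  by (auto simp: csed_def)

lemma most_sedentary_in_K:
  assumes "F \<in> K"
  shows "most_sedentary F \<in> K" "finite_face K (most_sedentary F)" "tangent (most_sedentary F) = tangent F"
    "csed F \<subseteq> csed (most_sedentary F)"
    "most_sedentary F \<noteq> {}" "\<And>x. x \<in> most_sedentary F \<Longrightarrow> sed x = csed (most_sedentary F)"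
proof -
  obtain Q where Q: "unimodular_gens (csed F) Q" "F = gen_cell Q"
    "tcell_faces (gen_verts Q) (gen_divs Q) \<subseteq> K" using cell_data[OF assms] by metis
  have c: "cell_gens (csed F) Q" using Q(1) by (simp add: unimodular_gens_def)
  have t: "most_sedentary F = tcell (tsend (gen_divs Q) ` gen_verts Q) {}"
    using most_sedentary_tcell[OF Q(1)] Q(2) by simp
  have vne: "gen_verts Q \<noteq> {}" using c by (simp add: cell_gens_def)
  have "most_sedentary F \<in> tcell_faces (gen_verts Q) (gen_divs Q)"
    unfolding t tcell_faces_def using vne by blast
  then show inK: "most_sedentary F \<in> K" using Q(3) by blast
  show "tangent (most_sedentary F) = tangent F" using tangent_most_sedentary[OF c] Q(2) by simp
  show "csed F \<subseteq> csed (most_sedentary F)" by (intro csed_antimono) (auto simp: most_sedentary_def)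
  show ne: "most_sedentary F \<noteq> {}" using cell_nonempty[OF inK] .
  show sed: "sed x = csed (most_sedentary F)" if "x \<in> most_sedentary F" for x
    using sed_most_sedentary[OF c] csed_most_sedentary[OF c] that Q(2) by simp
  have "cell_gens (csed F \<union> gen_divs Q) (Vertex ` (tsend (gen_divs Q) ` gen_verts Q))"
    using cell_gens_tsend[OF c subset_refl subset_refl vne, of "{}"] by simp
  then have "compact (most_sedentary F)" unfolding t by (rule compact_simplex)
  moreover have "csed G = csed (most_sedentary F)" if "G \<in> K" "G \<subseteq> most_sedentary F" for G
  proof -
    have "sed x = csed (most_sedentary F)" if "x \<in> G" for x
      using sed that \<open>G \<subseteq> _\<close> by blast
    then show ?thesis using cell_nonempty[OF that(1)] by (auto simp: csed_def)
  qed
  ultimately show "finite_face K (most_sedentary F)" by (simp add: finite_face_def)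
qed

text \<open>The most sedentary part of \<open>F\<close> is a cell contained in \<open>F\<close>, so
  finiteness gives it the generic sedentarity of \<open>F\<close>. No point of \<open>F\<close> can
  then be more sedentary than generic.\<close>

lemma finite_face_sed:
  assumes "F \<in> K" "finite_face K F" "x \<in> F" shows "sed x = csed F"
proof -
  have "most_sedentary F \<subseteq> F" by (auto simp: most_sedentary_def)
  then have e: "csed (most_sedentary F) = csed F"
    using assms(2) most_sedentary_in_K(1)[OF assms(1)] by (simp add: finite_face_def)
  obtain z where z: "z \<in> most_sedentary F" using most_sedentary_in_K(5)[OF assms(1)] by blast
  then have "sed x \<subseteq> sed z" using assms(3) by (auto simp: most_sedentary_def)
  also have "sed z = csed F" using most_sedentary_in_K(6)[OF assms(1) z] e by simp
  finally show ?thesis using assms(3) by (auto simp: csed_def)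
qed

lemma barycenter_relint:
  assumes "F \<in> K" shows "b F \<in> relint K (most_sedentary F)"
proof (cases "finite_face K F")
  case True
  then have "most_sedentary F = F"
    using finite_face_sed[OF assms True] by (auto simp: most_sedentary_def)
  then show ?thesis using barycenters assms True by (auto simp: barycenters_def)
next
  case False
  then have "b F = b (most_sedentary F)" using barycenters assms by (auto simp: barycenters_def)
  then show ?thesis using barycenters most_sedentary_in_K(1,2)[OF assms] by (auto simp: barycenters_def)
qed

lemma barycenter_in:
  assumes "F \<in> K" shows "b F \<in> F" "sed (b F) = csed (most_sedentary F)"
proof -
  have "b F \<in> most_sedentary F" using barycenter_relint[OF assms] by (auto simp: relint_def)
  then show "b F \<in> F" by (auto simp: most_sedentary_def)
  show "sed (b F) = csed (most_sedentary F)"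
    using most_sedentary_in_K(6)[OF assms \<open>b F \<in> most_sedentary F\<close>] .
qed

text \<open>The intersection of the two cells is again a cell and contains \<open>x\<close>, so it
  is a proper face of neither.\<close>

lemma relint_disjoint:
  assumes "P \<in> K" "P' \<in> K" "x \<in> relint K P" "x \<in> relint K P'"
  shows "P = P'"
proof -
  have x: "x \<in> P \<inter> P'" using assms(3,4) by (auto simp: relint_def)
  obtain Q where "tcell_faces (gen_verts Q) (gen_divs Q) \<subseteq> K"
    "\<And>G. G \<in> K \<Longrightarrow> P \<inter> G \<noteq> {} \<Longrightarrow> P \<inter> G \<in> tcell_faces (gen_verts Q) (gen_divs Q)"
    using cell_data[OF assms(1)] by metis
  then have "P \<inter> P' \<in> K" using x assms(2) by blast
  then have "\<not> P \<inter> P' \<subset> P" "\<not> P \<inter> P' \<subset> P'" using assms(3,4) x by (auto simp: relint_def)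
  then show ?thesis by blast
qed

text \<open>Cells with a common barycenter have the same most sedentary face, hence the same \<open>tangent\<close>
  (a full preimage), and their dimensions differ only through \<open>divker\<close>.\<close>

lemma tdim_le_barycenter:
  assumes "F \<in> K" "csed F = {}" "F' \<in> K" "b F' = b F"
  shows "tdim F' \<le> tdim F"
proof -
  have "most_sedentary F' = most_sedentary F"
    using relint_disjoint barycenter_relint most_sedentary_in_K(1) assms by metis
  then have "tangent F' = tangent F" using most_sedentary_in_K(3) assms(1,3) by metis
  moreover have "dim (divker {} :: (real ^ 'n) set) \<le> dim (divker (csed F'))"
    by (intro dim_subset divker_mono) auto
  ultimately show ?thesis unfolding tdim_def assms(2) by simp
qed

text \<open>A barycenter at infinity is shared by several cells. By
  \<open>tdim_le_barycenter\<close> none of them exceeds a cell of generic sedentarity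
  \<open>{}\<close> in dimension, so \<open>level\<close> still reads off the dimension along the
  flags considered here.\<close>

lemma level_barycenter:
  assumes "F \<in> K" "csed F = {}" shows "level K b (b F) = tdim F"
  unfolding level_def
proof (rule Max_eqI)
  have "{tdim F' | F'. F' \<in> K \<and> b F' = b F} \<subseteq> tdim ` K" by auto
  then show "finite {tdim F' | F'. F' \<in> K \<and> b F' = b F}" using finite_K finite_subset by blast
  show "y \<le> tdim F" if "y \<in> {tdim F' | F'. F' \<in> K \<and> b F' = b F}" for y
    using that tdim_le_barycenter[OF assms] by auto
  show "tdim F \<in> {tdim F' | F'. F' \<in> K \<and> b F' = b F}" using assms by auto
qed

section \<open>Flags of cells of generic sedentarity \<open>{}\<close>\<close>

definition open_flag :: "(ereal ^ 'n) set list \<Rightarrow> bool" where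
  "open_flag Fs \<longleftrightarrow> Fs \<noteq> [] \<and> sorted_wrt (\<subset>) Fs \<and> set Fs \<subseteq> {F \<in> K. csed F = {}}"

lemma open_flag_Cons:
  "open_flag (F # Fs) \<longleftrightarrow> F \<in> K \<and> csed F = {} \<and> (\<forall>G\<in>set Fs. F \<subset> G) \<and> (Fs = [] \<or> open_flag Fs)"
  by (auto simp: open_flag_def)

text \<open>Along such a flag \<open>level\<close> is the dimension and increases strictly. Hence
  \<open>b\<close> is injective on the flag, and the vertex of least level is the barycenter of the
  first cell.\<close>

lemma open_flag_bary:
  assumes "open_flag Fs"
  shows "card (b ` set Fs) = length Fs" "first_vertex K b (b ` set Fs) = b (hd Fs)"
    "b ` set Fs - {b (hd Fs)} = b ` set (tl Fs)" "b ` set Fs \<in> bary_simplices K b"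
proof -
  obtain F Gs where Fs: "Fs = F # Gs" using assms by (cases Fs) (auto simp: open_flag_def)
  have K: "G \<in> K" "csed G = {}" if "G \<in> set Fs" for G using assms that by (auto simp: open_flag_def)
  have cmp: "G \<subset> H \<or> H \<subset> G \<or> G = H" if "G \<in> set Fs" "H \<in> set Fs" for G H
    using that assms unfolding open_flag_def sorted_wrt_iff_nth_less
    by (metis in_set_conv_nth linorder_neqE_nat)
  have dist: "distinct Fs"
    using assms unfolding open_flag_def sorted_wrt_iff_nth_less distinct_conv_nth
    by (metis linorder_neqE_nat psubset_eq)
  have inj: "inj_on b (set Fs)"
  proof (rule inj_onI)
    fix G H assume GH: "G \<in> set Fs" "H \<in> set Fs" "b G = b H"
    then have "tdim G = tdim H" using level_barycenter K by metis
    then show "G = H" using cmp[OF GH(1,2)] tdim_strict_mono K GH(1,2) by (metis less_irrefl)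
  qed
  show "card (b ` set Fs) = length Fs" using card_image[OF inj] distinct_card[OF dist] by simp
  have lt: "level K b (b F) < level K b (b G)" if "G \<in> set Gs" for G
  proof -
    have "F \<subset> G" using assms that by (auto simp: Fs open_flag_Cons)
    then show ?thesis using level_barycenter K tdim_strict_mono that by (simp add: Fs)
  qed
  have "arg_min_on (level K b) (b ` set Fs) = b F"
    unfolding arg_min_on_def arg_min_def
  proof (rule some_equality)
    show "is_arg_min (level K b) (\<lambda>x. x \<in> b ` set Fs) (b F)"
      using lt by (auto simp: is_arg_min_def Fs dest: less_asym)
    show "x = b F" if "is_arg_min (level K b) (\<lambda>x. x \<in> b ` set Fs) x" for x
      using that lt by (auto simp: is_arg_min_def Fs)
  qed
  then show "first_vertex K b (b ` set Fs) = b (hd Fs)" by (simp add: first_vertex_def Fs)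
  show "b ` set Fs - {b (hd Fs)} = b ` set (tl Fs)"
    using inj dist by (auto simp: Fs)
  show "b ` set Fs \<in> bary_simplices K b"
    unfolding bary_simplices_def
  proof (intro CollectI exI[of _ "set Fs"] conjI refl ballI)
    show "set Fs \<subseteq> K" using K by blast
    show "set Fs \<noteq> {}" by (simp add: Fs)
    fix G H assume GH: "G \<in> set Fs" "H \<in> set Fs"
    show "G \<subseteq> H \<or> H \<subseteq> G" using cmp[OF GH] by blast
    show "csed G = csed H" using K(2)[OF GH(1)] K(2)[OF GH(2)] by simp
  qed
qed

text \<open>Dimensions increase strictly along a flag. If the bound is attained, every step has
  dimension one.\<close>

lemma open_flag_length:
  assumes "open_flag Fs" shows "length Fs + tdim (hd Fs) \<le> tdim (last Fs) + 1"
  using assms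
proof (induction Fs)
  case (Cons F Fs)
  show ?case
  proof (cases "Fs = []")
    case False
    then have o: "open_flag Fs" "F \<subset> hd Fs" "F \<in> K" "csed F = {}" "hd Fs \<in> K" "csed (hd Fs) = {}"
      using Cons.prems False hd_in_set[OF False] unfolding open_flag_Cons
      by (simp_all add: open_flag_def subset_iff)
    have "tdim F < tdim (hd Fs)" using tdim_strict_mono[OF o(3,4,5,6,2)] .
    then show ?thesis using Cons.IH[OF o(1)] False by simp
  qed simp
qed (simp add: open_flag_def)

lemma dual_flags_open:
  assumes "Fs \<in> dual_flags K D' G" shows "open_flag Fs" "hd Fs = D'" "last Fs = G"
    "length Fs = tdim G - tdim D' + 1"
  using assms by (auto simp: dual_flags_def open_flag_def)

text \<open>The tail of a maximal flag has length \<open>tdim G - tdim D'\<close>. By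
  \<open>open_flag_length\<close> its first cell is then at most one dimension above
  \<open>D'\<close>, hence exactly one, and the tail is maximal again.\<close>

lemma dual_flags_Cons:
  assumes "D' \<in> K" "csed D' = {}" "Ts \<noteq> []" "tdim D' \<le> tdim G"
  shows "D' # Ts \<in> dual_flags K D' G \<longleftrightarrow>
    tdim (hd Ts) = tdim D' + 1 \<and> D' \<subset> hd Ts \<and> Ts \<in> dual_flags K (hd Ts) G"
proof
  assume a: "D' # Ts \<in> dual_flags K D' G"
  have o: "open_flag Ts" "D' \<subset> hd Ts" "hd Ts \<in> K" "csed (hd Ts) = {}"
    using dual_flags_open(1)[OF a] assms(3) hd_in_set[OF assms(3)] unfolding open_flag_Cons
    by (simp_all add: open_flag_def subset_iff)
  have "tdim D' < tdim (hd Ts)" using tdim_strict_mono[OF assms(1,2) o(3,4,2)] .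
  moreover have "length Ts = tdim G - tdim D'" "last Ts = G" using a assms(3) by (auto simp: dual_flags_def)
  moreover have "length Ts + tdim (hd Ts) \<le> tdim (last Ts) + 1" using open_flag_length[OF o(1)] .
  moreover have "length Ts > 0" using assms(3) by simp
  ultimately have "tdim (hd Ts) = tdim D' + 1 \<and> length Ts = tdim G - tdim (hd Ts) + 1 \<and> last Ts = G"
    using assms(4) by auto
  then show "tdim (hd Ts) = tdim D' + 1 \<and> D' \<subset> hd Ts \<and> Ts \<in> dual_flags K (hd Ts) G"
    using o by (auto simp: dual_flags_def open_flag_def)
next
  assume a: "tdim (hd Ts) = tdim D' + 1 \<and> D' \<subset> hd Ts \<and> Ts \<in> dual_flags K (hd Ts) G"
  then have d: "length Ts = tdim G - tdim (hd Ts) + 1" "sorted_wrt (\<subset>) Ts" "set Ts \<subseteq> {F \<in> K. csed F = {}}"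
    "last Ts = G" by (auto simp: dual_flags_def)
  have "length Ts + tdim (hd Ts) \<le> tdim (last Ts) + 1"
    using a dual_flags_open(1) open_flag_length by blast
  then have "length (D' # Ts) = tdim G - tdim D' + 1" using a d by simp
  moreover have "D' \<subset> F" if "F \<in> set Ts" for F
    using a d(2) that assms(3) by (cases Ts) auto
  ultimately show "D' # Ts \<in> dual_flags K D' G"
    using assms d by (auto simp: dual_flags_def)
qed

lemma finite_dual_flags: "finite (dual_flags K D' G)"
proof (rule finite_subset)
  show "dual_flags K D' G \<subseteq> {Fs. set Fs \<subseteq> K \<and> length Fs = tdim G - tdim D' + 1}"
    by (auto simp: dual_flags_def)
qed (use finite_K finite_lists_length_eq in blast)

text \<open>A lift of \<open>b F\<close> is determined modulo \<open>divker (sed (b F))\<close>.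
  Since \<open>b F\<close> lies in \<open>F\<close>, the divisorial vectors concerned are recession
  directions of \<open>F\<close> and so tangent to it; all admissible lifts behave alike.\<close>

lemma lift_in_tangent:
  assumes "F \<in> K" "csed F = {}" "Vertex x0 \<in> gens F" "stratum_point (sed (b F)) v = b F"
  shows "v - rvec x0 \<in> tangent F"
proof -
  have c: "cell_gens {} (gens F)" using cell_gens_gens[OF assms(1,2)] .
  obtain A u where Au: "b F = stratum_point A u" "A \<subseteq> gen_divs (gens F)" "u \<in> gen_hull (gens F)"
  proof -
    have "b F \<in> {stratum_point ({} \<union> A) u | A u. A \<subseteq> gen_divs (gens F) \<and> u \<in> gen_hull (gens F)}"
      using barycenter_in(1)[OF assms(1)] gens_cell(2)[OF assms(1,2)] gen_cell_eq[OF c] by simp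
    then show ?thesis using that by auto
  qed
  have U: "A \<noteq> UNIV" using cell_gens_not_UNIV[OF c Au(2)] by simp
  then have "sed (b F) = A" using Au(1) by (simp add: sed_stratum_point)
  then have "v - u \<in> divker A" using assms(4) Au(1) stratum_point_eq_iff[OF U] by simp
  have tan: "tangent F = span (dir_vec x0 ` gens F \<union> divker {})"
    using tangent_gen_cell[OF c assms(3)] gens_cell(2)[OF assms(1,2)] by simp
  have "divker A \<subseteq> tangent F"
    unfolding divker_def[of A] tan
  proof (rule span_minimal[OF _ subspace_span], rule subsetI)
    fix z assume "z \<in> insert 1 (divisorial ` A)"
    then consider "z = 1" | i where "z = divisorial i" "Divisorial i \<in> gens F" using Au(2) by auto
    then show "z \<in> span (dir_vec x0 ` gens F \<union> divker {})"
    proof cases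
      case 1
      then show ?thesis by (intro span_base) (simp add: divker_empty span_base)
    next
      case 2
      then have "z = dir_vec x0 (Divisorial i)" by simp
      then show ?thesis using 2(2) by (intro span_base) blast
    qed
  qed
  moreover have "u - rvec x0 \<in> tangent F"
  proof -
    obtain \<alpha> where "u = (\<Sum>q\<in>gens F. \<alpha> q *\<^sub>R gen_vec q)" "(\<Sum>q\<in>gens F. gen_deg q * \<alpha> q) = 1"
      using Au(3) unfolding gen_hull_def by blast
    then have "u - rvec x0 = (\<Sum>q\<in>gens F. \<alpha> q *\<^sub>R dir_vec x0 q)" by (simp add: sum_dir_vec)
    also have "\<dots> \<in> tangent F" unfolding tan by (intro span_sum span_scale span_base) auto
    finally show ?thesis .
  qed
  moreover have "v - rvec x0 = (v - u) + (u - rvec x0)" by simp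
  ultimately show ?thesis using \<open>v - u \<in> divker A\<close> by (metis span_add subsetD tan)
qed

text \<open>If a weight vanished, the barycenter would lie in the proper face spanned by the other
  vertices, against its position in the relative interior.\<close>

lemma barycentric_coordinates:
  assumes "F \<in> K" "csed F = {}" "gens F = Vertex ` V"
  obtains p where "\<And>v. v \<in> V \<Longrightarrow> p v > 0" "(\<Sum>v\<in>V. p v) = 1" "sed (b F) = {}"
    "b F = stratum_point {} (\<Sum>v\<in>V. p v *\<^sub>R rvec v)"
proof -
  have c: "cell_gens {} (gens F)" using cell_gens_gens[OF assms(1,2)] .
  have fin: "finite V" using c assms(3) by (auto simp: cell_gens_def inj_on_def dest: finite_imageD)
  have sV: "(\<Sum>q\<in>Vertex ` W. f q) = (\<Sum>v\<in>W. f (Vertex v))"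
    for f :: "'n generator \<Rightarrow> 'b::comm_monoid_add" and W
    by (simp add: sum.reindex inj_on_def)
  have sedF: "sed x = {}" if "x \<in> F" for x
    using gen_cell_sed_cases[OF c, of x] that gens_cell(2)[OF assms(1,2)] assms(3) by auto
  have sb: "sed (b F) = {}" using sedF barycenter_in(1)[OF assms(1)] .
  have bin: "b F \<in> relint K F"
  proof -
    have "most_sedentary F = F" using sedF by (auto simp: most_sedentary_def)
    then show ?thesis using barycenter_relint[OF assms(1)] by simp
  qed
  obtain u where u: "u \<in> gen_hull (gens F)" "b F = stratum_point {} u"
    using gen_cell_sed_empty[OF c _ sb] barycenter_in(1)[OF assms(1)] gens_cell(2)[OF assms(1,2)] by auto
  then obtain \<alpha> where \<alpha>: "u = (\<Sum>v\<in>V. \<alpha> (Vertex v) *\<^sub>R rvec v)" "\<forall>v\<in>V. 0 \<le> \<alpha> (Vertex v)"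
    "(\<Sum>v\<in>V. \<alpha> (Vertex v)) = 1"
    unfolding gen_hull_def assms(3) by (auto simp: sV)
  have "\<alpha> (Vertex v) > 0" if v: "v \<in> V" for v
  proof (rule ccontr)
    assume "\<not> \<alpha> (Vertex v) > 0"
    then have 0: "\<alpha> (Vertex v) = 0" using \<alpha>(2) v by force
    define W where "W = V - {v}"
    have s: "(\<Sum>v\<in>V. f v) = f v + (\<Sum>v\<in>W. f v)" for f :: "(ereal, 'n) vec \<Rightarrow> 'b::comm_monoid_add"
      unfolding W_def using fin v by (rule sum.remove)
    have "W \<noteq> {}" using \<alpha>(3) 0 s[of "\<lambda>v. \<alpha> (Vertex v)"] by auto
    then have W: "Vertex ` W \<subseteq> gens F" "gen_verts (Vertex ` W) \<noteq> {}" using assms(3) by (auto simp: W_def)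
    have "u \<in> gen_hull (Vertex ` W)"
      unfolding gen_hull_def using \<alpha> 0 s[of "\<lambda>v. \<alpha> (Vertex v)"] s[of "\<lambda>v. \<alpha> (Vertex v) *\<^sub>R rvec v"]
      by (intro CollectI exI[of _ \<alpha>]) (simp add: sV, simp add: W_def)
    then have "b F \<in> gen_cell (Vertex ` W)"
      unfolding gen_cell_eq[OF cell_gens_subset[OF c W]] u(2) by (intro CollectI exI[of _ "{}"] exI[of _ u]) simp
    moreover have "gen_cell (Vertex ` W) \<subset> F"
    proof -
      have "gen_cell (Vertex ` W) \<subseteq> F" using gen_cell_mono[OF c W] gens_cell(2)[OF assms(1,2)] by simp
      moreover have "gen_cell (Vertex ` W) \<noteq> F"
        using gens_cell(4)[OF assms(1,2) W] assms(3) v by (auto simp: W_def)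
      ultimately show ?thesis by blast
    qed
    ultimately show False using bin gens_cell(3)[OF assms(1,2) W] by (auto simp: relint_def)
  qed
  then show ?thesis using that[of "\<lambda>v. \<alpha> (Vertex v)"] \<alpha> u(2) sb by simp
qed

end

section \<open>Frames and joins\<close>

lemma frame_append: "frame xs qs = frame xs [] @ map (dir_vec (hd xs)) qs"
  by (simp add: frame_def)

lemma frame_Cons_Cons: "frame (x # v # xs) qs = (rvec v - rvec x) # frame (x # xs) qs"
  by (simp add: frame_def)

text \<open>With equal heads this is a permutation of the frame. Otherwise one passes through
  orderings that begin with the two heads: exchanging them reverses the vector between them, and the
  change of base vertex alters the other vectors by a multiple of it, which is absorbed.\<close>

lemma wedges_frame_permute:
  assumes "distinct xs" "distinct ys" "set xs = set ys" "xs \<noteq> []"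
  shows "\<exists>\<epsilon>\<in>{1, -1}. \<forall>\<beta>. wedges (frame xs []) \<beta> = (\<lambda>js. \<epsilon> * wedges (frame ys []) \<beta> js)"
proof -
  have same_hd: "\<exists>\<epsilon>\<in>{1, -1}. \<forall>\<beta>. wedges (frame xs []) \<beta> = (\<lambda>js. \<epsilon> * wedges (frame ys []) \<beta> js)"
    if l: "distinct xs" "distinct ys" "set xs = set ys" "xs \<noteq> []" "hd xs = hd ys" for xs ys :: "(ereal ^ 'a) list"
  proof -
    obtain x xs' ys' where e: "xs = x # xs'" "ys = x # ys'"
      using l(3-5) by (cases xs; cases ys) auto
    then have "mset xs' = mset ys'" using l(1-3)
      by (metis distinct.simps(2) insert_ident list.simps(15) set_eq_iff_mset_eq_distinct)
    then have "mset (frame xs []) = mset (frame ys [])" by (simp add: frame_def e)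
    then show ?thesis by (rule wedges_permute)
  qed
  show ?thesis
  proof (cases "hd xs = hd ys")
    case True
    then show ?thesis using same_hd assms by blast
  next
    case False
    define x0 y0 where "x0 = hd xs" and "y0 = hd ys"
    have ne: "ys \<noteq> []" using assms(3,4) by (metis set_empty)
    have in': "x0 \<in> set xs" "y0 \<in> set xs" "x0 \<noteq> y0"
      using hd_in_set[OF assms(4)] hd_in_set[OF ne, folded assms(3)] False by (simp_all only: x0_def y0_def not_False_eq_True)
    obtain zs where zs: "set zs = set xs - {x0, y0}" "distinct zs"
      using finite_distinct_list[of "set xs - {x0, y0}"] by auto
    have l: "distinct (x0 # y0 # zs)" "distinct (y0 # x0 # zs)" "set xs = set (x0 # y0 # zs)"
      "set (y0 # x0 # zs) = set ys"
      using zs in' assms(3) by auto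
    have h: "hd xs = hd (x0 # y0 # zs)" "hd (y0 # x0 # zs) = hd ys" by (simp_all add: x0_def y0_def)
    obtain \<epsilon>1 where \<epsilon>1: "\<epsilon>1 \<in> {1, -1}"
      "\<And>\<beta>. wedges (frame xs []) \<beta> = (\<lambda>js. \<epsilon>1 * wedges (frame (x0 # y0 # zs) []) \<beta> js)"
      using same_hd[OF assms(1) l(1,3) assms(4) h(1)] by blast
    obtain \<epsilon>2 where \<epsilon>2: "\<epsilon>2 \<in> {1, -1}"
      "\<And>\<beta>. wedges (frame (y0 # x0 # zs) []) \<beta> = (\<lambda>js. \<epsilon>2 * wedges (frame ys []) \<beta> js)"
      using same_hd[OF l(2) assms(2) l(4) _ h(2)] by blast
    have swap: "wedges (frame (x0 # y0 # zs) []) \<beta> = (\<lambda>js. - wedges (frame (y0 # x0 # zs) []) \<beta> js)" for \<beta>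
    proof -
      have "list_all2 (\<lambda>v w. v - w \<in> span (set [rvec y0 - rvec x0]))
        (map (\<lambda>z. rvec z - rvec x0) zs) (map (\<lambda>z. rvec z - rvec y0) zs)"
        by (auto simp: list_all2_conv_all_nth intro: span_base)
      from wedges_absorb[OF this, of \<beta>]
      have "wedges (frame (x0 # y0 # zs) []) \<beta> =
        vwedge (rvec y0 - rvec x0) (wedges (map (\<lambda>z. rvec z - rvec y0) zs) \<beta>)"
        by (simp add: frame_def)
      also have "rvec y0 - rvec x0 = (-1) *\<^sub>R (rvec x0 - rvec y0)" by simp
      finally show ?thesis unfolding vwedge_scale_left by (simp add: frame_def)
    qed
    have "wedges (frame xs []) \<beta> = (\<lambda>js. (- \<epsilon>1 * \<epsilon>2) * wedges (frame ys []) \<beta> js)" for \<beta>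
      unfolding \<epsilon>1(2) swap \<epsilon>2(2) by (simp add: mult.assoc)
    moreover have "- \<epsilon>1 * \<epsilon>2 \<in> {1, -1}" using \<epsilon>1(1) \<epsilon>2(1) by auto
    ultimately show ?thesis by blast
  qed
qed

text \<open>The sign is uniform in \<open>H\<close> and \<open>qs\<close>. It will be used both for
  the volume element, with \<open>qs\<close> listing the link and \<open>H\<close> empty, and for
  the orientation of a flag, with \<open>H\<close> its edges and \<open>qs\<close> empty.\<close>

lemma wedge_frame_permute:
  assumes "distinct xs" "distinct ys" "set xs = set ys" "xs \<noteq> []"
  shows "\<exists>\<epsilon>\<in>{1, -1}. \<forall>H qs. wedge (H @ frame xs qs) = (\<lambda>js. \<epsilon> * wedge (H @ frame ys qs) js)"
proof -
  obtain \<epsilon> where \<epsilon>: "\<epsilon> \<in> {1, -1}"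
    "\<And>\<beta>. wedges (frame xs []) \<beta> = (\<lambda>js. \<epsilon> * wedges (frame ys []) \<beta> js)"
    using wedges_frame_permute[OF assms] by blast
  have ys: "ys = hd ys # tl ys" using assms(3,4) by (cases ys) auto
  have "rvec (hd ys) - rvec (hd xs) \<in> span (set (frame ys []))"
  proof -
    have "hd xs \<in> set ys" using assms(3,4) hd_in_set by blast
    then have "rvec (hd xs) - rvec (hd ys) = 0 \<or> rvec (hd xs) - rvec (hd ys) \<in> set (frame ys [])"
      using ys by (metis (no_types, lifting) append_Nil2 diff_self frame_def image_eqI list.set_map list.simps(8) set_ConsD)
    then have "rvec (hd xs) - rvec (hd ys) \<in> span (set (frame ys []))" by (auto intro: span_base span_zero)
    then show ?thesis using span_neg by fastforce
  qed
  then have "dir_vec (hd xs) q - dir_vec (hd ys) q \<in> span (set (frame ys []))" for q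
  proof -
    have "dir_vec (hd xs) q - dir_vec (hd ys) q = gen_deg q *\<^sub>R (rvec (hd ys) - rvec (hd xs))"
      by (simp add: dir_vec_eq scaleR_diff_right)
    then show ?thesis using \<open>rvec (hd ys) - rvec (hd xs) \<in> _\<close> by (simp add: span_scale)
  qed
  then have abs: "wedges (frame ys []) (wedges (map (dir_vec (hd xs)) qs) \<beta>) =
      wedges (frame ys []) (wedges (map (dir_vec (hd ys)) qs) \<beta>)" for qs \<beta>
    by (intro wedges_absorb) (auto simp: list_all2_conv_all_nth)
  have "wedges (frame xs qs) \<beta> = (\<lambda>js. \<epsilon> * wedges (frame ys qs) \<beta> js)" for qs \<beta>
    unfolding frame_append[of xs qs] frame_append[of ys qs] wedges_simps(3) \<epsilon>(2) abs ..
  then have "wedge (H @ frame xs qs) = (\<lambda>js. \<epsilon> * wedge (H @ frame ys qs) js)" for H qs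
    unfolding wedge_wedges wedges_simps(3) by (simp only: wedges_scale) (simp add: pv_project_def fun_eq_iff)
  then show ?thesis using \<epsilon>(1) by blast
qed

text \<open>A factor standing in front of \<open>us\<close> matters only modulo the span of
  \<open>us\<close> and the line through \<open>1\<close>. It replaces the first edge of a flag by a
  multiple of the vector towards the new vertex.\<close>

lemma wedge_replace:
  assumes "t \<in> span (set us)" "w - (c *\<^sub>R u + t) \<in> span {1}"
  shows "wedge (H @ w # us) = (\<lambda>js. c * wedge (H @ u # us) js)"
proof -
  have "list_all2 (\<lambda>v w. v - w \<in> span {1}) (H @ w # us) (H @ (c *\<^sub>R u + t) # us)"
    using assms(2) by (auto simp: list_all2_conv_all_nth nth_append nth_Cons span_zero split: nat.split)
  then have "wedge (H @ w # us) = wedge (H @ (c *\<^sub>R u + t) # us)" by (rule wedge_cong)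
  also have "\<dots> = (\<lambda>js. c * wedge (H @ u # us) js)"
    using wedges_in_span[OF assms(1)]
    by (simp add: wedge_wedges vwedge_add_left vwedge_scale_left wedges_scale pv_project_def fun_eq_iff)
  finally show ?thesis .
qed

lemma listing_finite:
  assumes "finite A" shows "distinct (listing A)" "set (listing A) = A"
proof -
  have "\<exists>xs. distinct xs \<and> set xs = A" using finite_distinct_list[OF assms] by blast
  from someI_ex[OF this] show "distinct (listing A)" "set (listing A) = A" by (simp_all add: listing_def)
qed

context triangulated_complex
begin

lemma cell_mono:
  assumes "F \<in> K" "csed F = {}" "G \<in> K" "csed G = {}"
  shows "F \<subseteq> G \<longleftrightarrow> gens F \<subseteq> gens G"
proof
  show "gens F \<subseteq> gens G" if "F \<subseteq> G" using gens_cell(5)[OF assms(3,4,1,2) that] .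
  assume s: "gens F \<subseteq> gens G"
  have "gen_verts (gens F) \<noteq> {}" using cell_gens_gens[OF assms(1,2)] by (simp add: cell_gens_def)
  from gen_cell_mono[OF cell_gens_gens[OF assms(3,4)] s this]
  show "F \<subseteq> G" using gens_cell(2) assms by simp
qed

lemma gens_simplex_face:
  assumes "D \<in> K" "finite_face K D" "csed D = {}" "D' \<in> K" "D' \<subseteq> D"
  shows "csed D' = {}" "gens D' = Vertex ` vertices_of K D'" "finite (vertices_of K D')"
    "vertices_of K D' \<noteq> {}" "vertices_of K D' \<subseteq> vertices_of K D" "card (vertices_of K D') = tdim D' + 1"
proof -
  show c: "csed D' = {}" using assms by (simp add: finite_face_def)
  have "sed x = {}" if "x \<in> D'" for x using finite_face_sed[OF assms(1,2), of x] that assms(3,5) by auto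
  then show g: "gens D' = Vertex ` vertices_of K D'" by (auto simp: gens_def vertices_of_def)
  show "finite (vertices_of K D')"
    using finite_gens_cell[OF assms(4) c] unfolding g by (auto simp: inj_on_def dest: finite_imageD)
  show "vertices_of K D' \<noteq> {}" using cell_gens_gens[OF assms(4) c] unfolding g by (auto simp: cell_gens_def)
  show "vertices_of K D' \<subseteq> vertices_of K D" using assms(5) by (auto simp: vertices_of_def)
  show "card (vertices_of K D') = tdim D' + 1"
    using card_gens[OF assms(4) c] unfolding g by (simp add: card_image inj_on_def)
qed

lemma joined_gen_cell: "joined K D qb = gen_cell (Vertex ` vertices_of K D \<union> qb)"
proof -
  have "gen_verts (Vertex ` vertices_of K D \<union> qb) = vertices_of K D \<union> {x. Vertex x \<in> qb}"
    "gen_divs (Vertex ` vertices_of K D \<union> qb) = {i. Divisorial i \<in> qb}" by auto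
  then show ?thesis by (simp add: joined_def gen_cell_def)
qed

text \<open>\<open>Link\<close> only says that the join is a cell of the right dimension. Its
  generators contain those of \<open>D\<close> and \<open>qb\<close>, as singleton cells and as
  points at infinity show, and they are no more, because these already span the cell.\<close>

lemma gens_joined:
  assumes D: "D \<in> K" "finite_face K D" "csed D = {}" and qb: "qb \<in> Link K D l"
  shows "joined K D qb \<in> K" "csed (joined K D qb) = {}"
    "gens (joined K D qb) = Vertex ` vertices_of K D \<union> qb" "Vertex ` vertices_of K D \<inter> qb = {}"
    "finite qb" "tdim (joined K D qb) = tdim D + l"
proof -
  note DD = gens_simplex_face[OF D D(1) subset_refl]
  let ?G = "joined K D qb" and ?Q = "Vertex ` vertices_of K D \<union> qb"
  show inK: "?G \<in> K" and fin: "finite qb" and dim: "tdim ?G = tdim D + l"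
    using qb by (auto simp: Link_def)
  have card: "card qb = l" and vert: "\<And>x. Vertex x \<in> qb \<Longrightarrow> {x} \<in> K \<and> sed x = {}"
    using qb by (auto simp: Link_def)
  have tp: "x \<in> tproj" if x: "{x} \<in> K" for x
  proof -
    obtain R where R: "unimodular_gens (csed {x}) R" "{x} = gen_cell R" using cell_data[OF x] by metis
    then obtain w where w: "Vertex w \<in> R" "w \<in> tproj"
      using cell_gens_obtain unfolding unimodular_gens_def by metis
    then have "w \<in> {x}" using vertex_in_gen_cell R unfolding unimodular_gens_def by metis
    then show ?thesis using w(2) by simp
  qed
  have vs: "x \<in> tproj \<and> sed x = {} \<and> {x} \<in> K" if "x \<in> gen_verts ?Q" for x
  proof (cases "Vertex x \<in> qb")
    case False
    then have "x \<in> vertices_of K D" using that by auto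
    then show ?thesis using tp finite_face_sed[OF D(1,2)] D(3) by (auto simp: vertices_of_def)
  qed (use tp vert in auto)
  have finQ: "finite ?Q" using fin DD(3) by simp
  have tc: "?G = tcell (gen_verts ?Q) (gen_divs ?Q)" by (simp add: joined_gen_cell gen_cell_def)
  have gen: "tsend A x \<in> ?G" if "x \<in> gen_verts ?Q" "A \<subseteq> gen_divs ?Q" "i \<notin> A" for A x i
  proof -
    have "x $ i \<noteq> - \<infinity>" using vs[OF that(1)] by (auto simp: sed_def)
    then show ?thesis unfolding tc
      using tsend_in_tcell[OF finite_gens(1)[OF finQ] that(1) _ that(2,3)] vs[OF that(1)] by blast
  qed
  have vin: "x \<in> ?G" if "x \<in> gen_verts ?Q" for x
    using gen[OF that, of "{}"] vs[OF that] by (simp add: tsend_empty)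
  obtain x0 where x0: "x0 \<in> gen_verts ?Q" using DD(4) by auto
  have "csed ?G \<subseteq> sed x0" using vin[OF x0] by (auto simp: csed_def)
  then show cs: "csed ?G = {}" using vs[OF x0] by simp
  note u = gens_cell(1,2)[OF inK cs] and c = cell_gens_gens[OF inK cs]
  have "?Q \<subseteq> gens ?G"
  proof
    fix q assume q: "q \<in> ?Q"
    show "q \<in> gens ?G"
    proof (cases q)
      case (Vertex x)
      then have "x \<in> gen_verts ?Q" using q by simp
      then show ?thesis using vin vs Vertex by (auto simp: gens_def)
    next
      case (Divisorial i)
      show ?thesis
      proof (cases "\<exists>j. j \<noteq> i")
        case True
        then obtain j where "j \<notin> {i}" by auto
        then have "tsend {i} x0 \<in> ?G" using gen[OF x0, of "{i}"] q Divisorial by auto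
        moreover have "tsend {i} x0 = stratum_point {i} (rvec x0)" "{i} \<noteq> UNIV"
          using tsend_eq[of x0 "{i}"] vs[OF x0] True by auto
        then have "i \<in> sed (tsend {i} x0)" by (simp add: sed_stratum_point)
        ultimately show ?thesis using Divisorial by (auto simp: gens_def)
      next
        case False
        \<comment> \<open>With a single homogeneous coordinate \<open>tproj\<close> is one point and
          cannot be sent to infinity. The cell then has at most one generator, so the dimension
          clause of \<open>Link\<close> forces \<open>qb\<close> to be empty.\<close>
        then have U: "UNIV = {i}" by auto
        define z0 :: "ereal ^ 'n" where "z0 = (\<chi> i. 0)"
        have zero: "v = z0" if "v \<in> tproj" for v :: "ereal ^ 'n"
          using that U by (auto simp: z0_def tproj_def vec_eq_iff) (metis UNIV_I singletonD)
        have "gens ?G \<subseteq> {Vertex z0}"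
        proof
          fix p assume p: "p \<in> gens ?G"
          show "p \<in> {Vertex z0}"
          proof (cases p)
            case (Vertex x)
            then show ?thesis using zero p c by (auto simp: cell_gens_def)
          next
            case (Divisorial j)
            then have "j = i" using U by auto
            then have "gen_divs (gens ?G) = UNIV" using U p Divisorial by auto
            then show ?thesis using c by (simp add: cell_gens_def)
          qed
        qed
        then have "card (gens ?G) \<le> 1" using card_mono[of "{Vertex z0}"] by force
        then have "l = 0" using card_gens[OF inK cs] dim by simp
        then have "qb = {}" using card fin by simp
        then show ?thesis using q Divisorial by auto
      qed
    qed
  qed
  moreover have "gens ?G \<subseteq> ?Q"
  proof -
    have ne: "gen_verts (gens ?G) \<noteq> {}" using c by (simp add: cell_gens_def)
    have "gen_cell (gens ?G) \<subseteq> gen_cell ?Q" using u(2) joined_gen_cell by simp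
    then show ?thesis
      using gen_cell_subset_iff[OF u(1) subset_refl ne \<open>?Q \<subseteq> gens ?G\<close>] x0 by blast
  qed
  ultimately show g: "gens ?G = ?Q" by blast
  \<comment> \<open>The dimension of the join gives the union as many elements as both parts have
    together, so the parts cannot overlap.\<close>
  have "card ?Q = card (Vertex ` vertices_of K D) + card qb"
    using card_gens[OF inK cs] g dim card DD(6) by (simp add: card_image inj_on_def)
  moreover have "card ?Q + card (Vertex ` vertices_of K D \<inter> qb) = card (Vertex ` vertices_of K D) + card qb"
    using card_Un_Int[of "Vertex ` vertices_of K D" qb] fin DD(3) by simp
  ultimately show "Vertex ` vertices_of K D \<inter> qb = {}" using fin by simp
qed

lemma gens_joined_face:
  assumes D: "D \<in> K" "finite_face K D" "csed D = {}" and qb: "qb \<in> Link K D l" and D': "D' \<in> K" "D' \<subseteq> D"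
  shows "joined K D' qb \<in> K" "csed (joined K D' qb) = {}"
    "gens (joined K D' qb) = Vertex ` vertices_of K D' \<union> qb" "Vertex ` vertices_of K D' \<inter> qb = {}"
    "joined K D' qb \<subseteq> joined K D qb"
proof -
  note G = gens_joined[OF D qb]
  note f = gens_simplex_face[OF D D']
  have s: "Vertex ` vertices_of K D' \<union> qb \<subseteq> gens (joined K D qb)" using G(3) f(5) by auto
  have ne: "gen_verts (Vertex ` vertices_of K D' \<union> qb) \<noteq> {}" using f(4) by auto
  show "joined K D' qb \<in> K" "gens (joined K D' qb) = Vertex ` vertices_of K D' \<union> qb"
    unfolding joined_gen_cell[of D'] using gens_cell(3,4)[OF G(1,2) s ne] by auto
  show "csed (joined K D' qb) = {}"
    unfolding joined_gen_cell[of D']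
    using csed_gen_cell[OF cell_gens_subset[OF cell_gens_gens[OF G(1,2)] s ne]] .
  show "Vertex ` vertices_of K D' \<inter> qb = {}" using G(4) f(5) by auto
  show "joined K D' qb \<subseteq> joined K D qb"
    using gen_cell_mono[OF cell_gens_gens[OF G(1,2)] s ne] gens_cell(2)[OF G(1,2)]
    unfolding joined_gen_cell[of D'] by simp
qed

lemma frame_cell:
  assumes "F \<in> K" "csed F = {}" "gens F = Vertex ` V \<union> set qs" "Vertex ` V \<inter> set qs = {}"
    "distinct xs" "set xs = V" "V \<noteq> {}" "distinct qs"
  shows "lattice_basis F (frame xs qs)" "independent_list (frame xs qs)"
    "volume_element F (frame xs qs) = wedge (frame xs qs)"
    "tangent F = span (insert 1 (set (frame xs qs)))" "length (frame xs qs) = tdim F"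
proof -
  obtain x0 xs' where xs: "xs = x0 # xs'" using assms(6,7) by (cases xs) auto
  define gs where "gs = map Vertex xs' @ qs"
  have fr: "frame xs qs = map (dir_vec x0) gs" by (simp add: frame_def gs_def xs)
  have gs: "distinct gs" "Vertex x0 \<notin> set gs" "gens F = insert (Vertex x0) (set gs)"
    using assms(3-6,8) by (auto simp: gs_def xs distinct_map inj_on_def)
  note u = gens_cell(1,2)[OF assms(1,2)]
  show lb: "lattice_basis F (frame xs qs)" and "independent_list (frame xs qs)"
    using unimodular_gens_frame[OF u(1) gs] u(2) fr by auto
  show "volume_element F (frame xs qs) = wedge (frame xs qs)" using volume_element_eq[OF assms(2) lb] .
  have "span (dir_vec x0 ` gens F \<union> divker {}) = span (insert 1 (set (frame xs qs)))"
  proof (rule subset_antisym; rule span_minimal[OF _ subspace_span]; rule subsetI)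
    fix z assume "z \<in> dir_vec x0 ` gens F \<union> divker {}"
    moreover have "divker {} \<subseteq> span (insert 1 (set (frame xs qs)))" unfolding divker_empty by (intro span_mono) auto
    ultimately show "z \<in> span (insert 1 (set (frame xs qs)))"
      unfolding gs(3) fr by (auto simp: span_zero intro: span_base)
  next
    fix z assume "z \<in> insert 1 (set (frame xs qs))"
    then show "z \<in> span (dir_vec x0 ` gens F \<union> divker {})"
      unfolding gs(3) fr divker_empty by (auto intro: span_base)
  qed
  then show "tangent F = span (insert 1 (set (frame xs qs)))"
    using tangent_gen_cell[OF cell_gens_gens[OF assms(1,2)], of x0] u(2) gs(3) by simp
  show "length (frame xs qs) = tdim F"
    using card_gens[OF assms(1,2)] gs distinct_card[OF gs(1)] by (simp add: fr)
qed

lemma tangent_mono: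
  assumes "F \<in> K" "csed F = {}" "G \<in> K" "csed G = {}" "F \<subseteq> G"
  shows "tangent F \<subseteq> tangent G"
proof -
  obtain x0 where x0: "Vertex x0 \<in> gens F" using cell_gens_obtain[OF cell_gens_gens[OF assms(1,2)]] by blast
  have s: "gens F \<subseteq> gens G" using cell_mono assms by blast
  then have "span (dir_vec x0 ` gens F \<union> divker {}) \<subseteq> span (dir_vec x0 ` gens G \<union> divker {})"
    by (intro span_mono) auto
  then show ?thesis
    using tangent_gen_cell[OF cell_gens_gens[OF assms(1,2)] x0] gens_cell(2)[OF assms(1,2)]
      gens_cell(2)[OF assms(3,4)] tangent_gen_cell[OF cell_gens_gens[OF assms(3,4)], of x0] s x0
    by (simp add: subsetD)
qed

text \<open>Both lifts are measured from a common vertex of \<open>D'\<close>, and from there each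
  is tangent to its own cell.\<close>

lemma lift_difference_tangent:
  assumes "F \<in> K" "csed F = {}" "D' \<in> K" "csed D' = {}" "D' \<subseteq> F"
    "stratum_point (sed (b F)) v = b F" "stratum_point (sed (b D')) w = b D'"
  shows "v - w \<in> tangent F"
proof -
  obtain x0 where x0: "Vertex x0 \<in> gens D'" using cell_gens_obtain[OF cell_gens_gens[OF assms(3,4)]] by blast
  have "Vertex x0 \<in> gens F" using x0 assms cell_mono by blast
  then have 1: "v - rvec x0 \<in> tangent F" using lift_in_tangent[OF assms(1,2)] assms(6) by blast
  have "w - rvec x0 \<in> tangent D'" using lift_in_tangent[OF assms(3,4) x0 assms(7)] .
  then have 2: "w - rvec x0 \<in> tangent F" using tangent_mono assms(1-5) by blast
  have "(v - rvec x0) - (w - rvec x0) \<in> tangent F"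
    using 1 2 unfolding tangent_def by (rule span_diff)
  then show ?thesis by simp
qed

text \<open>A simplex without recession directions has its barycenter in its relative interior and
  in the stratum of sedentarity \<open>{}\<close>. So the choice in \<open>inner_lift\<close> is
  possible, and its outcome is fixed modulo \<open>1\<close>.\<close>

lemma inner_lift_finite:
  assumes "F \<in> K" "csed F = {}" "gens F = Vertex ` V"
  shows "stratum_point {} (inner_lift K b F) = b F"
proof -
  obtain p where sb: "sed (b F) = {}" and p: "b F = stratum_point {} p"
    using barycentric_coordinates[OF assms] by metis
  have "sed x = {}" if x: "x \<in> F" for x
  proof -
    obtain A where "A \<subseteq> gen_divs (gens F)" "sed x = {} \<union> A"
      using gen_cell_sed_cases[OF cell_gens_gens[OF assms(1,2)]] x gens_cell(2)[OF assms(1,2)] by metis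
    then show ?thesis using assms(3) by auto
  qed
  then have "most_sedentary F = F" by (auto simp: most_sedentary_def)
  then have "b F \<in> relint K F" using barycenter_relint[OF assms(1)] by simp
  moreover have "tpoint p = stratum_point {} p" by (simp add: tpoint_def stratum_point_def tsend_def)
  ultimately have "\<exists>v. tpoint v \<in> relint K F \<and> tsend (sed (b F)) (emb v) = b F"
    using p sb by (intro exI[of _ p]) (simp add: stratum_point_def)
  from someI_ex[OF this] show ?thesis by (simp add: inner_lift_def sb stratum_point_def)
qed

text \<open>Modulo the tangent space of \<open>D'\<close>, the first edge of a flag is the vector towards the new
  vertex, scaled by the barycentric coordinate of that vertex in \<open>b D''\<close>.\<close>

lemma facet_edge:
  assumes D'': "D'' \<in> K" "csed D'' = {}" "gens D'' = Vertex ` V" "finite V"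
    and D': "D' \<in> K" "csed D' = {}" "gens D' = Vertex ` (V - {v0})" and v0: "v0 \<in> V" "V - {v0} \<noteq> {}"
    and xs: "distinct xs" "set xs = V - {v0}"
    and p: "(\<Sum>v\<in>V. p v) = 1" "b D'' = stratum_point {} (\<Sum>v\<in>V. p v *\<^sub>R rvec v)"
    and lift: "stratum_point {} w'' = b D''" "stratum_point {} w' = b D'"
  obtains t where "t \<in> span (set (frame xs []))"
    "(w'' - w') - (p v0 *\<^sub>R (rvec v0 - rvec (hd xs)) + t) \<in> span {1}"
proof -
  define x0 where "x0 = hd xs"
  have "xs \<noteq> []" using xs(2) v0(2) by (metis set_empty2)
  then have x0: "x0 \<in> set xs" by (simp add: x0_def)
  have 1: "w'' - (\<Sum>v\<in>V. p v *\<^sub>R rvec v) \<in> span {1}"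
    using lift(1) p(2) stratum_point_eq_iff[of "{}" w''] by (simp add: divker_empty)
  have sb: "sed (b D') = {}" using barycentric_coordinates[OF D'] by metis
  have fr: "frame xs [] = map (\<lambda>x. rvec x - rvec x0) (tl xs)" by (simp add: frame_def x0_def)
  have xsc: "xs = x0 # tl xs" using x0 by (cases xs) (auto simp: x0_def)
  have tan: "tangent D' = span (insert 1 (set (frame xs [])))"
    using frame_cell(4)[OF D'(1,2), of "V - {v0}" "[]" xs] D'(3) xs v0(2) by simp
  have "w' - rvec x0 \<in> tangent D'"
    using lift_in_tangent[OF D'(1,2), of x0 w'] x0 xs(2) D'(3) sb lift(2) by auto
  then obtain s where s: "w' - rvec x0 - s *\<^sub>R 1 \<in> span (set (frame xs []))"
    unfolding tan by (auto simp: span_insert)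
  define t' where "t' = (\<Sum>v\<in>V - {v0}. p v *\<^sub>R (rvec v - rvec x0))"
  have t': "t' \<in> span (set (frame xs []))"
    unfolding t'_def
  proof (intro span_sum span_scale)
    fix v assume "v \<in> V - {v0}"
    then have "v = x0 \<or> v \<in> set (tl xs)" using xs(2) xsc by (metis set_ConsD)
    then show "rvec v - rvec x0 \<in> span (set (frame xs []))"
      unfolding fr by (auto simp: span_zero intro: span_base)
  qed
  have "(\<Sum>v\<in>V. p v *\<^sub>R rvec v) - rvec x0 = (\<Sum>v\<in>V. p v *\<^sub>R (rvec v - rvec x0))"
    using p(1) by (simp add: scaleR_diff_right sum_subtractf scaleR_sum_left[symmetric])
  also have "\<dots> = p v0 *\<^sub>R (rvec v0 - rvec x0) + t'"
    unfolding t'_def using D''(4) v0(1) by (rule sum.remove)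
  finally have 2: "(\<Sum>v\<in>V. p v *\<^sub>R rvec v) = rvec x0 + (p v0 *\<^sub>R (rvec v0 - rvec x0) + t')"
    by (simp add: algebra_simps)
  define t where "t = t' - (w' - rvec x0 - s *\<^sub>R 1)"
  have "(w'' - w') - (p v0 *\<^sub>R (rvec v0 - rvec x0) + t) = (w'' - (\<Sum>v\<in>V. p v *\<^sub>R rvec v)) - s *\<^sub>R 1"
    unfolding 2 t_def by (simp add: algebra_simps)
  also have "\<dots> \<in> span {1}" by (rule span_diff[OF 1 span_scale[OF span_base]]) simp
  finally have "(w'' - w') - (p v0 *\<^sub>R (rvec v0 - rvec x0) + t) \<in> span {1}" .
  moreover have "t \<in> span (set (frame xs []))" unfolding t_def using t' s by (rule span_diff)
  ultimately show ?thesis using that by (simp add: x0_def)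
qed

end

section \<open>The action of the eigenwave\<close>

lemma Fp_zero: "(\<lambda>js. 0) \<in> Fp K p F"
  unfolding Fp_def by (intro CollectI exI[of _ "0 :: nat"]) simp

lemma sum_lessThan_add: "(\<Sum>k<m + n. f k) = (\<Sum>k<m. f k) + (\<Sum>k<n. f (m + k))"
  for f :: "nat \<Rightarrow> 'a::comm_monoid_add"
  by (induction n) (simp_all add: add.assoc)

lemma Fp_add:
  assumes "\<beta> \<in> Fp K p F" "\<gamma> \<in> Fp K p F" shows "(\<lambda>js. \<beta> js + \<gamma> js) \<in> Fp K p F"
proof -
  let ?ok = "\<lambda>ws. length ws = p \<and> (\<exists>G\<in>K. F \<subseteq> G \<and> csed G = csed F \<and> set ws \<subseteq> tlattice G)"
  obtain m :: nat and a vs where 1: "\<And>k. k < m \<Longrightarrow> ?ok (vs k)"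
    "\<beta> = (\<lambda>js. \<Sum>k<m. a k * pv_project (csed F) (wedge (vs k)) js)"
    using assms(1) unfolding Fp_def by blast
  obtain n :: nat and c ws where 2: "\<And>k. k < n \<Longrightarrow> ?ok (ws k)"
    "\<gamma> = (\<lambda>js. \<Sum>k<n. c k * pv_project (csed F) (wedge (ws k)) js)"
    using assms(2) unfolding Fp_def by blast
  define d where "d = (\<lambda>k. if k < m then a k else c (k - m))"
  define us where "us = (\<lambda>k. if k < m then vs k else ws (k - m))"
  have "?ok (us k)" if "k < m + n" for k
  proof (cases "k < m")
    case False
    then have "k - m < n" using that by simp
    then show ?thesis using 2(1)[of "k - m"] False by (simp add: us_def)
  qed (use 1(1) us_def in simp)
  moreover have "(\<lambda>js. \<beta> js + \<gamma> js) = (\<lambda>js. \<Sum>k<m + n. d k * pv_project (csed F) (wedge (us k)) js)"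
    unfolding 1(2) 2(2) sum_lessThan_add by (simp add: d_def us_def)
  ultimately show ?thesis unfolding Fp_def by blast
qed

lemma Fp_scale:
  assumes "\<beta> \<in> Fp K p F" shows "(\<lambda>js. t * \<beta> js) \<in> Fp K p F"
proof -
  obtain m :: nat and a vs where 1:
    "\<forall>k<m. length (vs k) = p \<and> (\<exists>G\<in>K. F \<subseteq> G \<and> csed G = csed F \<and> set (vs k) \<subseteq> tlattice G)"
    "\<beta> = (\<lambda>js. \<Sum>k<m. a k * pv_project (csed F) (wedge (vs k)) js)"
    using assms unfolding Fp_def by blast
  have "(\<lambda>js. t * \<beta> js) = (\<lambda>js. \<Sum>k<m. (t * a k) * pv_project (csed F) (wedge (vs k)) js)"
    unfolding 1(2) by (simp add: sum_distrib_left mult.assoc)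
  then show ?thesis unfolding Fp_def using 1(1)
    by (intro CollectI exI[of _ m] exI[of _ "\<lambda>k. t * a k"] exI[of _ vs]) simp
qed

lemma Fp_sum:
  assumes "\<And>a. a \<in> A \<Longrightarrow> f a \<in> Fp K p F" shows "(\<lambda>js. \<Sum>a\<in>A. f a js) \<in> Fp K p F"
  using assms by (induction A rule: infinite_finite_induct) (simp_all add: Fp_zero Fp_add)

lemma Fp_generator:
  assumes "G \<in> K" "F \<subseteq> G" "csed G = csed F" "length us = p" "set us \<subseteq> tlattice G"
  shows "pv_project (csed F) (wedge us) \<in> Fp K p F"
  unfolding Fp_def using assms
  by (intro CollectI exI[of _ "1 :: nat"] exI[of _ "\<lambda>_. 1"] exI[of _ "\<lambda>_. us"]) auto

lemma carrier_cell_subset: "G \<in> K \<Longrightarrow> \<sigma> \<subseteq> G \<Longrightarrow> carrier_cell K \<sigma> \<subseteq> G"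
  by (auto simp: carrier_cell_def)

lemma csed_carrier_cell:
  assumes "x \<in> \<sigma>" "sed x = {}" shows "csed (carrier_cell K \<sigma>) = {}"
proof -
  have "x \<in> carrier_cell K \<sigma>" using assms(1) by (auto simp: carrier_cell_def)
  then show ?thesis using assms(2) by (auto simp: csed_def)
qed

lemma pv_project_vwedge_sum:
  "pv_project I (vwedge v (\<lambda>js. \<Sum>a\<in>A. f a js)) js = (\<Sum>a\<in>A. pv_project I (vwedge v (f a)) js)"
  by (simp add: pv_project_def vwedge_sum)

lemma pv_project_vwedge_scale:
  "pv_project I (vwedge v (\<lambda>js. t * \<beta> js)) js = t * pv_project I (vwedge v \<beta>) js"
  by (simp add: pv_project_def vwedge_scale)

section \<open>The shifted chains of a propeller\<close>

locale propeller_simplex = triangulated_complex K b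
  for K :: "(ereal ^ 'n::finite) set set" and b +
  fixes y :: "ereal ^ 'n \<Rightarrow> real ^ 'n" and D :: "(ereal ^ 'n) set" and ds :: "(ereal ^ 'n) list" and l :: nat
  assumes lift: "eigenwave_lift K b y"
    and D: "D \<in> K" "finite_face K D" "csed D = {}"
    and ds: "distinct ds" "set ds = vertices_of K D"
begin

definition faces :: "nat \<Rightarrow> (ereal ^ 'n) set set" where
  "faces r = {D' \<in> K. D' \<subseteq> D \<and> tdim D' = r}"

text \<open>The same ordering of the vertices of \<open>D'\<close> is used here and in
  \<open>face_volume\<close>. Another ordering may change the sign of both, but not their
  product.\<close>

definition flag_sign :: "'n generator set \<Rightarrow> (ereal ^ 'n) set \<Rightarrow> (ereal ^ 'n) set list \<Rightarrow> real" where
  "flag_sign qb D' Fs = orientation_sign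
     (rev (flag_edges K b Fs) @ frame (listing (vertices_of K D')) []) (frame ds (listing qb))"

definition face_volume :: "'n generator set \<Rightarrow> (ereal ^ 'n) set \<Rightarrow> 'n polyvector" where
  "face_volume qb D' = volume_element (joined K D' qb) (frame (listing (vertices_of K D')) (listing qb))"

lemma shifted_chain_eq:
  "shifted_chain K b D ds l \<rho> r \<sigma> = (\<lambda>js. \<Sum>qb\<in>Link K D l. \<Sum>D'\<in>faces r.
     \<Sum>Fs\<in>{Fs \<in> dual_flags K D' (joined K D qb). b ` set Fs = \<sigma>}.
       real_of_rat (\<rho> qb) * flag_sign qb D' Fs * face_volume qb D' js)"
  by (simp add: shifted_chain_def faces_def flag_sign_def face_volume_def Let_def)

lemma lift_stratum: "F \<in> K \<Longrightarrow> stratum_point (sed (b F)) (y (b F)) = b F"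
  using lift by (simp add: eigenwave_lift_def stratum_point_def)

lemma face_facts:
  assumes "D' \<in> faces r"
  shows "D' \<in> K" "D' \<subseteq> D" "tdim D' = r" "csed D' = {}" "gens D' = Vertex ` vertices_of K D'"
    "finite (vertices_of K D')" "vertices_of K D' \<noteq> {}" "vertices_of K D' \<subseteq> vertices_of K D"
    "card (vertices_of K D') = r + 1" "distinct (listing (vertices_of K D'))"
    "set (listing (vertices_of K D')) = vertices_of K D'"
proof -
  show f: "D' \<in> K" "D' \<subseteq> D" "tdim D' = r" using assms by (auto simp: faces_def)
  note g = gens_simplex_face[OF D f(1,2)]
  show "csed D' = {}" "gens D' = Vertex ` vertices_of K D'"
    "finite (vertices_of K D')" "vertices_of K D' \<noteq> {}" "vertices_of K D' \<subseteq> vertices_of K D"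
    "card (vertices_of K D') = r + 1" using g f(3) by auto
  show "distinct (listing (vertices_of K D'))" "set (listing (vertices_of K D')) = vertices_of K D'"
    using listing_finite[OF g(3)] by auto
qed

lemma Link_facts:
  assumes "qb \<in> Link K D l"
  shows "distinct (listing qb)" "set (listing qb) = qb"
    "wedge (frame ds (listing qb)) \<noteq> (\<lambda>js. 0)"
proof -
  note G = gens_joined[OF D assms]
  show q: "distinct (listing qb)" "set (listing qb) = qb" using listing_finite[OF G(5)] by auto
  have "independent_list (frame ds (listing qb))"
    using frame_cell(2)[OF G(1,2), of "vertices_of K D" "listing qb" ds] G(3,4) q ds
      gens_simplex_face(4)[OF D D(1) subset_refl] by simp
  then show "wedge (frame ds (listing qb)) \<noteq> (\<lambda>js. 0)" by (rule wedge_nonzero)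
qed

lemma face_volume_facts:
  assumes "qb \<in> Link K D l" "D' \<in> faces r"
  shows "face_volume qb D' = wedge (frame (listing (vertices_of K D')) (listing qb))"
    "tangent (joined K D' qb) = span (insert 1 (set (frame (listing (vertices_of K D')) (listing qb))))"
    "length (frame (listing (vertices_of K D')) (listing qb)) = r + l"
    "set (frame (listing (vertices_of K D')) (listing qb)) \<subseteq> tlattice (joined K D qb)"
proof -
  note q = Link_facts[OF assms(1)] and f = face_facts[OF assms(2)]
  note J = gens_joined_face[OF D assms(1) f(1,2)] and G = gens_joined[OF D assms(1)]
  note fc = frame_cell[OF J(1,2), of "vertices_of K D'" "listing qb" "listing (vertices_of K D')",
      unfolded q(2), OF J(3,4) f(10,11,7) q(1)]
  show "face_volume qb D' = wedge (frame (listing (vertices_of K D')) (listing qb))"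
    using fc(3) by (simp add: face_volume_def)
  show "tangent (joined K D' qb) = span (insert 1 (set (frame (listing (vertices_of K D')) (listing qb))))"
    using fc(4) .
  have "card qb = l" using assms(1) by (simp add: Link_def)
  then have "card (gens (joined K D' qb)) = r + 1 + l"
    unfolding J(3) using f(6,9) G(5) J(4) by (simp add: card_Un_disjoint card_image inj_on_def)
  then show "length (frame (listing (vertices_of K D')) (listing qb)) = r + l"
    using fc(5) card_gens[OF J(1,2)] by simp
  have "set (frame (listing (vertices_of K D')) (listing qb)) \<subseteq> tlattice (joined K D' qb)"
    using fc(1) by (simp add: lattice_basis_def)
  also have "\<dots> \<subseteq> tlattice (joined K D qb)"
    using tangent_mono[OF J(1,2) G(1,2) J(5)] by (auto simp: tlattice_def)
  finally show "set (frame (listing (vertices_of K D')) (listing qb)) \<subseteq> tlattice (joined K D qb)" .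
qed

lemma flag_in_joined:
  assumes "qb \<in> Link K D l" "Fs \<in> dual_flags K D' (joined K D qb)"
  shows "b ` set Fs \<subseteq> joined K D qb"
proof -
  note o = dual_flags_open[OF assms(2)]
  have "F \<subseteq> last Fs" if F: "F \<in> set Fs" for F
  proof -
    obtain Gs where Gs: "Fs = Gs @ [last Fs]"
      using F append_butlast_last_id[of Fs] by (metis empty_iff empty_set)
    have "sorted_wrt (\<subset>) (Gs @ [last Fs])" using o(1) Gs unfolding open_flag_def by metis
    then have lt: "\<forall>F\<in>set Gs. F \<subset> last Fs" by (simp add: sorted_wrt_append)
    have "F \<in> set Gs \<or> F = last Fs" using F arg_cong[OF Gs, of set] by auto
    then show ?thesis using lt by blast
  qed
  then have sub: "\<And>F. F \<in> set Fs \<Longrightarrow> F \<subseteq> joined K D qb" using o(3) by simp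
  show ?thesis
  proof (rule image_subsetI)
    fix F assume F: "F \<in> set Fs"
    then have "b F \<in> F" using o(1) barycenter_in(1) unfolding open_flag_def by blast
    then show "b F \<in> joined K D qb" using sub[OF F] by blast
  qed
qed

text \<open>The barycenter of \<open>D'\<close> is a vertex of the simplex and has sedentarity
  \<open>{}\<close>, so the carrier has generic sedentarity \<open>{}\<close>. It lies in
  \<open>joined K D qb\<close>, whose lattice contains the frame of \<open>joined K D' qb\<close>;
  hence the volume element is a generator of the coefficient group.\<close>

lemma shifted_chain_in_chains:
  assumes "r \<le> tdim D"
  shows "shifted_chain K b D ds l \<rho> r \<in> bary_chains K b (tdim D + l - r) (l + r)"
  unfolding bary_chains_def
proof (intro CollectI allI)
  fix \<sigma>
  let ?\<gamma> = "shifted_chain K b D ds l \<rho> r"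
  show "if \<sigma> \<in> bary_simplices K b \<and> card \<sigma> = tdim D + l - r + 1
      then ?\<gamma> \<sigma> \<in> Fp K (l + r) (carrier_cell K \<sigma>) else ?\<gamma> \<sigma> = (\<lambda>_. 0)"
  proof (cases "\<sigma> \<in> bary_simplices K b \<and> card \<sigma> = tdim D + l - r + 1")
    case True
    have "(\<lambda>js. real_of_rat (\<rho> qb) * flag_sign qb D' Fs * face_volume qb D' js) \<in> Fp K (l + r) (carrier_cell K \<sigma>)"
      if qb: "qb \<in> Link K D l" and D': "D' \<in> faces r"
        and Fs: "Fs \<in> {Fs \<in> dual_flags K D' (joined K D qb). b ` set Fs = \<sigma>}" for qb D' Fs
    proof (rule Fp_scale)
      note G = gens_joined[OF D qb] and f = face_facts[OF D'] and v = face_volume_facts[OF qb D']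
      have flag: "Fs \<in> dual_flags K D' (joined K D qb)" "b ` set Fs = \<sigma>" using Fs by auto
      have "b D' \<in> \<sigma>" using dual_flags_open(1,2)[OF flag(1)] flag(2) by (auto simp: open_flag_def)
      moreover have "sed (b D') = {}" using barycentric_coordinates[OF f(1,4,5)] by metis
      ultimately have cs: "csed (carrier_cell K \<sigma>) = {}" by (rule csed_carrier_cell)
      have "carrier_cell K \<sigma> \<subseteq> joined K D qb"
        using carrier_cell_subset[OF G(1)] flag_in_joined[OF qb flag(1)] flag(2) by simp
      from Fp_generator[OF G(1) this _ v(3,4)]
      have "pv_project {} (face_volume qb D') \<in> Fp K (r + l) (carrier_cell K \<sigma>)"
        using G(2) cs v(1) by simp
      then show "face_volume qb D' \<in> Fp K (l + r) (carrier_cell K \<sigma>)"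
        unfolding v(1) pv_project_wedge by (simp add: add.commute)
    qed
    then have "?\<gamma> \<sigma> \<in> Fp K (l + r) (carrier_cell K \<sigma>)"
      unfolding shifted_chain_eq by (intro Fp_sum)
    then show ?thesis using True by simp
  next
    case False
    have "{Fs \<in> dual_flags K D' (joined K D qb). b ` set Fs = \<sigma>} = {}"
      if qb: "qb \<in> Link K D l" and D': "D' \<in> faces r" for qb D'
    proof (rule ccontr)
      assume "{Fs \<in> dual_flags K D' (joined K D qb). b ` set Fs = \<sigma>} \<noteq> {}"
      then obtain Fs where Fs: "Fs \<in> dual_flags K D' (joined K D qb)" "b ` set Fs = \<sigma>" by blast
      note o = dual_flags_open[OF Fs(1)]
      have "length Fs = tdim D + l - r + 1"
        using o(4) gens_joined(6)[OF D qb] face_facts(3)[OF D'] by simp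
      then show False using False open_flag_bary(1,4)[OF o(1)] Fs(2) by simp
    qed
    then have "?\<gamma> \<sigma> = (\<lambda>_. 0)"
      unfolding shifted_chain_eq by (intro ext sum.neutral ballI) blast
    then show ?thesis using False by (simp only: if_False)
  qed
qed

text \<open>The sign \<open>\<epsilon>\<close> compares the listing of \<open>D''\<close> with the
  listing of \<open>D'\<close> enlarged by \<open>v0\<close>. It multiplies both the volume element
  and the flag orientation and so disappears, whereas the positive factor \<open>p v0\<close>
  survives in the coefficient but not in the orientation sign.\<close>

lemma facet_term:
  assumes qb: "qb \<in> Link K D l" and D'': "D'' \<in> faces (Suc r)"
    and p: "(\<Sum>v\<in>vertices_of K D''. p v) = 1" "p v0 > 0" "sed (b D'') = {}"
      "b D'' = stratum_point {} (\<Sum>v\<in>vertices_of K D''. p v *\<^sub>R rvec v)"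
    and v0: "v0 \<in> vertices_of K D''" and D': "D' \<in> faces r" "vertices_of K D' = vertices_of K D'' - {v0}"
    and Ts: "Ts \<noteq> []" "hd Ts = D''"
  shows "flag_sign qb D' (D' # Ts) * pv_project {} (vwedge (y (b D'') - y (b D')) (face_volume qb D')) js =
    p v0 * (flag_sign qb D'' Ts * face_volume qb D'' js)"
proof -
  define xs' xs'' qs where "xs' = listing (vertices_of K D')" and "xs'' = listing (vertices_of K D'')"
    and "qs = listing qb"
  note f' = face_facts[OF D'(1)] and f'' = face_facts[OF D'']
  have ne: "vertices_of K D'' - {v0} \<noteq> {}" using f'(7) D'(2) by simp
  have l': "distinct xs'" "set xs' = vertices_of K D'' - {v0}" using f'(10,11) D'(2) by (simp_all add: xs'_def)
  have l'': "distinct xs''" "set xs'' = vertices_of K D''" using f''(10,11) by (simp_all add: xs''_def)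
  have g': "gens D' = Vertex ` (vertices_of K D'' - {v0})" using f'(5) D'(2) by simp
  have "xs' \<noteq> []" using l'(2) ne by (metis set_empty2)
  then obtain x0 zs where xs': "xs' = x0 # zs" by (cases xs') auto
  \<comment> \<open>The new vertex goes into second place: the base vertex \<open>x0\<close> is
    kept, and the frame becomes the vector from \<open>x0\<close> to \<open>v0\<close> followed by
    the frame of \<open>D'\<close>.\<close>
  have ins: "distinct (x0 # v0 # zs)" "set (x0 # v0 # zs) = set xs''" "x0 # v0 # zs \<noteq> []"
    using l' l'' v0 by (auto simp: xs')
  obtain \<epsilon> where \<epsilon>: "\<epsilon> \<in> {1, -1}"
    "\<And>H qs. wedge (H @ frame (x0 # v0 # zs) qs) = (\<lambda>js. \<epsilon> * wedge (H @ frame xs'' qs) js)"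
    using wedge_frame_permute[OF ins(1) l''(1) ins(2,3)] by blast
  note edge = facet_edge[OF f''(1,4,5,6) f'(1,4) g' v0 ne l' p(1,4), unfolded xs' list.sel]
  have sb': "sed (b D') = {}" using barycentric_coordinates[OF f'(1,4,5)] by metis
  have ylift: "stratum_point {} (y (b D'')) = b D''" "stratum_point {} (y (b D')) = b D'"
    using lift_stratum[OF f''(1)] lift_stratum[OF f'(1)] p(3) sb' by simp_all
  have ilift: "stratum_point {} (inner_lift K b D'') = b D''" "stratum_point {} (inner_lift K b D') = b D'"
    using inner_lift_finite[OF f''(1,4,5)] inner_lift_finite[OF f'(1,4,5)] by simp_all
  obtain t where t: "t \<in> span (set (frame xs' []))"
    "(y (b D'') - y (b D')) - (p v0 *\<^sub>R (rvec v0 - rvec x0) + t) \<in> span {1}"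
    using edge[OF ylift] unfolding xs' by blast
  obtain u where u: "u \<in> span (set (frame xs' []))"
    "(inner_lift K b D'' - inner_lift K b D') - (p v0 *\<^sub>R (rvec v0 - rvec x0) + u) \<in> span {1}"
    using edge[OF ilift] unfolding xs' by blast
  have "set (frame xs' []) \<subseteq> set (frame xs' qs)" unfolding frame_append[of xs' qs] by simp
  then have t': "t \<in> span (set (frame xs' qs))" using t(1) span_mono by blast
  have vol: "pv_project {} (vwedge (y (b D'') - y (b D')) (face_volume qb D')) =
      (\<lambda>js. p v0 * \<epsilon> * face_volume qb D'' js)"
  proof -
    have "pv_project {} (vwedge (y (b D'') - y (b D')) (face_volume qb D')) =
        wedge ((y (b D'') - y (b D')) # frame xs' qs)"
      unfolding face_volume_facts(1)[OF qb D'(1)] xs'_def[symmetric] qs_def[symmetric] by (rule wedge_Cons)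
    also have "\<dots> = (\<lambda>js. p v0 * wedge (frame (x0 # v0 # zs) qs) js)"
      using wedge_replace[OF t' t(2), of "[]"] by (simp add: frame_Cons_Cons xs')
    also have "\<dots> = (\<lambda>js. p v0 * (\<epsilon> * wedge (frame xs'' qs) js))"
      using \<epsilon>(2)[of "[]" qs] by simp
    also have "\<dots> = (\<lambda>js. p v0 * \<epsilon> * face_volume qb D'' js)"
      unfolding face_volume_facts(1)[OF qb D''] xs''_def[symmetric] qs_def[symmetric] by (simp add: mult.assoc)
    finally show ?thesis .
  qed
  have "flag_sign qb D' (D' # Ts) = sgn (p v0 * \<epsilon>) * flag_sign qb D'' Ts"
    unfolding flag_sign_def xs'_def[symmetric] xs''_def[symmetric]
  proof (rule orientation_sign_scale)
    show "wedge (frame ds (listing qb)) \<noteq> (\<lambda>js. 0)" using Link_facts(3)[OF qb] .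
    show "p v0 * \<epsilon> \<noteq> 0" using p(2) \<epsilon>(1) by auto
    obtain Us where Us: "Ts = D'' # Us" using Ts by (cases Ts) auto
    \<comment> \<open>Reversal puts the first edge of the flag directly in front of the frame of
      \<open>D'\<close>, where \<open>wedge_replace\<close> applies.\<close>
    have "rev (flag_edges K b (D' # Ts)) @ frame xs' [] =
        rev (flag_edges K b Ts) @ (inner_lift K b D'' - inner_lift K b D') # frame xs' []"
      by (simp add: flag_edges_def Us)
    then have "wedge (rev (flag_edges K b (D' # Ts)) @ frame xs' []) =
        (\<lambda>js. p v0 * wedge (rev (flag_edges K b Ts) @ (rvec v0 - rvec x0) # frame xs' []) js)"
      using wedge_replace[OF u, of "rev (flag_edges K b Ts)"] by simp
    also have "\<dots> = (\<lambda>js. p v0 * (\<epsilon> * wedge (rev (flag_edges K b Ts) @ frame xs'' []) js))"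
      unfolding xs' frame_Cons_Cons[symmetric] \<epsilon>(2) ..
    finally show "wedge (rev (flag_edges K b (D' # Ts)) @ frame xs' []) =
        (\<lambda>js. p v0 * \<epsilon> * wedge (rev (flag_edges K b Ts) @ frame xs'' []) js)"
      by (simp add: mult.assoc)
  qed
  moreover have "sgn (p v0 * \<epsilon>) = \<epsilon>" "\<epsilon> * \<epsilon> = 1" using p(2) \<epsilon>(1) by (auto simp: sgn_mult)
  ultimately show ?thesis unfolding vol by (simp add: algebra_simps)
qed

text \<open>Facets are indexed by the vertex they omit, so that a sum over facets becomes a sum of
  barycentric coordinates.\<close>

lemma facets_bij:
  assumes "D'' \<in> faces (Suc r)"
  shows "bij_betw (\<lambda>v. gen_cell (Vertex ` (vertices_of K D'' - {v}))) (vertices_of K D'') {D' \<in> faces r. D' \<subset> D''}"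
    "\<And>v. v \<in> vertices_of K D'' \<Longrightarrow>
      vertices_of K (gen_cell (Vertex ` (vertices_of K D'' - {v}))) = vertices_of K D'' - {v}"
proof -
  note f'' = face_facts[OF assms]
  let ?V = "vertices_of K D''" and ?h = "\<lambda>v. gen_cell (Vertex ` (vertices_of K D'' - {v}))"
  have injV: "Vertex ` A = Vertex ` B \<Longrightarrow> A = B" for A B :: "(ereal, 'n) vec set"
    by (simp add: inj_image_eq_iff inj_def)
  have sub: "Vertex ` (?V - {v}) \<subseteq> gens D''" for v using f''(5) by auto
  have cardV: "card (?V - {v}) = r + 1" if "v \<in> ?V" for v using f''(6,9) that by simp
  have ne: "gen_verts (Vertex ` (?V - {v})) \<noteq> {}" if "v \<in> ?V" for v
  proof -
    have "?V - {v} \<noteq> {}" using cardV[OF that] by (metis Suc_eq_plus1 card.empty nat.distinct(1))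
    then show ?thesis by auto
  qed
  have h: "?h v \<in> K" "gens (?h v) = Vertex ` (?V - {v})" if "v \<in> ?V" for v
    using gens_cell(3,4)[OF f''(1,4) sub ne[OF that]] by auto
  have hsub: "?h v \<subset> D''" if v: "v \<in> ?V" for v
  proof -
    have "?h v \<subseteq> D''" using gen_cell_mono[OF cell_gens_gens[OF f''(1,4)] sub ne[OF v]] gens_cell(2)[OF f''(1,4)] by simp
    moreover have "Vertex v \<notin> gens (?h v)" "Vertex v \<in> gens D''" using h(2)[OF v] f''(5) v by auto
    then have "?h v \<noteq> D''" by metis
    ultimately show ?thesis by (intro psubsetI)
  qed
  have hverts: "vertices_of K (?h v) = ?V - {v}" if v: "v \<in> ?V" for v
  proof -
    have "gens (?h v) = Vertex ` vertices_of K (?h v)"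
      using gens_simplex_face(2)[OF D h(1)[OF v]] hsub[OF v] f''(2) by blast
    then show ?thesis using h(2)[OF v] injV by metis
  qed
  show "\<And>v. v \<in> ?V \<Longrightarrow> vertices_of K (?h v) = ?V - {v}" by (rule hverts)
  have hface: "?h v \<in> faces r" if v: "v \<in> ?V" for v
  proof -
    have "tdim (?h v) + 1 = card (vertices_of K (?h v))"
      using gens_simplex_face(6)[OF D h(1)[OF v]] hsub[OF v] f''(2) by simp
    then show ?thesis using h(1)[OF v] hsub[OF v] f''(2) cardV[OF v] hverts[OF v] by (auto simp: faces_def)
  qed
  show "bij_betw ?h ?V {D' \<in> faces r. D' \<subset> D''}"
    unfolding bij_betw_def
  proof
    show "inj_on ?h ?V"
    proof (rule inj_onI)
      fix v w assume vw: "v \<in> ?V" "w \<in> ?V" "?h v = ?h w"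
      then have "?V - {v} = ?V - {w}" using hverts by metis
      then show "v = w" using vw(1,2) by blast
    qed
    show "?h ` ?V = {D' \<in> faces r. D' \<subset> D''}"
    proof (intro subset_antisym subsetI)
      show "x \<in> {D' \<in> faces r. D' \<subset> D''}" if "x \<in> ?h ` ?V" for x using that hface hsub by auto
      fix D' assume a: "D' \<in> {D' \<in> faces r. D' \<subset> D''}"
      then have "D' \<in> faces r" by blast
      note f' = face_facts[OF this]
      have s: "vertices_of K D' \<subseteq> ?V" using a by (auto simp: vertices_of_def)
      then have "card (?V - vertices_of K D') = 1" using f'(6,9) f''(9) by (simp add: card_Diff_subset)
      then obtain v where v: "?V - vertices_of K D' = {v}" by (auto simp: card_1_singleton_iff)
      then have "vertices_of K D' = ?V - {v}" "v \<in> ?V" using s by auto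
      moreover have "D' = gen_cell (Vertex ` vertices_of K D')" using gens_cell(2)[OF f'(1,4)] f'(5) by simp
      ultimately show "D' \<in> ?h ` ?V" by auto
    qed
  qed
qed

lemma facets_sum:
  assumes qb: "qb \<in> Link K D l" and D'': "D'' \<in> faces (Suc r)" and Ts: "Ts \<noteq> []" "hd Ts = D''"
  shows "(\<Sum>D'\<in>{D' \<in> faces r. D' \<subset> D''}.
      flag_sign qb D' (D' # Ts) * pv_project {} (vwedge (y (b D'') - y (b D')) (face_volume qb D')) js) =
    flag_sign qb D'' Ts * face_volume qb D'' js"
proof -
  note f'' = face_facts[OF D''] and bij = facets_bij[OF D'']
  let ?h = "\<lambda>v. gen_cell (Vertex ` (vertices_of K D'' - {v}))"
  obtain p where p: "\<And>v. v \<in> vertices_of K D'' \<Longrightarrow> p v > 0" "(\<Sum>v\<in>vertices_of K D''. p v) = 1"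
    "sed (b D'') = {}" "b D'' = stratum_point {} (\<Sum>v\<in>vertices_of K D''. p v *\<^sub>R rvec v)"
    using barycentric_coordinates[OF f''(1,4,5)] by metis
  have "(\<Sum>D'\<in>{D' \<in> faces r. D' \<subset> D''}.
      flag_sign qb D' (D' # Ts) * pv_project {} (vwedge (y (b D'') - y (b D')) (face_volume qb D')) js) =
    (\<Sum>v\<in>vertices_of K D''. flag_sign qb (?h v) (?h v # Ts) *
      pv_project {} (vwedge (y (b D'') - y (b (?h v))) (face_volume qb (?h v))) js)"
    by (rule sum.reindex_bij_betw[OF bij(1), symmetric])
  also have "\<dots> = (\<Sum>v\<in>vertices_of K D''. p v * (flag_sign qb D'' Ts * face_volume qb D'' js))"
  proof (rule sum.cong[OF refl])
    fix v assume v: "v \<in> vertices_of K D''"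
    have "?h v \<in> faces r" using bij_betw_apply[OF bij(1) v] by simp
    from facet_term[OF qb D'' p(2) p(1)[OF v] p(3,4) v this bij(2)[OF v] Ts]
    show "flag_sign qb (?h v) (?h v # Ts) *
        pv_project {} (vwedge (y (b D'') - y (b (?h v))) (face_volume qb (?h v))) js =
      p v * (flag_sign qb D'' Ts * face_volume qb D'' js)" .
  qed
  also have "\<dots> = flag_sign qb D'' Ts * face_volume qb D'' js"
    by (simp only: sum_distrib_right[symmetric] p(2) mult_1_left)
  finally show ?thesis .
qed

text \<open>If the flag leaves \<open>D\<close> at its first step, then this step is tangent to the coefficient.\<close>

lemma transverse_term_zero:
  assumes qb: "qb \<in> Link K D l" and D': "D' \<in> faces r"
    and F: "F \<in> K" "csed F = {}" "D' \<subset> F" "F \<subseteq> joined K D qb" "tdim F = Suc r" "\<not> F \<subseteq> D"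
  shows "pv_project I (vwedge (y (b F) - y (b D')) (face_volume qb D')) = (\<lambda>js. 0)"
proof -
  note f' = face_facts[OF D'] and G = gens_joined[OF D qb]
  note J = gens_joined_face[OF D qb f'(1,2)]
  have gD: "gens D = Vertex ` vertices_of K D" using gens_simplex_face(2)[OF D D(1) subset_refl] .
  have s: "Vertex ` vertices_of K D' \<subseteq> gens F" using cell_mono[OF f'(1,4) F(1,2)] F(3) f'(5) by auto
  have "card (Vertex ` vertices_of K D') = r + 1" using f'(9) by (simp add: card_image inj_on_def)
  then have "card (gens F - Vertex ` vertices_of K D') = 1"
    using card_gens[OF F(1,2)] F(5) s f'(6) by (simp add: card_Diff_subset)
  then obtain q where "gens F - Vertex ` vertices_of K D' = {q}" by (auto simp: card_1_singleton_iff)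
  then have q: "gens F = insert q (Vertex ` vertices_of K D')" using s by auto
  have "gens F \<subseteq> Vertex ` vertices_of K D \<union> qb" using cell_mono[OF F(1,2) G(1,2)] F(4) G(3) by blast
  moreover have "\<not> gens F \<subseteq> Vertex ` vertices_of K D" using cell_mono[OF F(1,2) D(1,3)] F(6) gD by simp
  ultimately have "q \<in> qb" using f'(8) unfolding q by auto
  then have "gens F \<subseteq> gens (joined K D' qb)" unfolding q J(3) by auto
  then have sub: "F \<subseteq> joined K D' qb" using cell_mono[OF F(1,2) J(1,2)] by blast
  have "y (b F) - y (b D') \<in> tangent F"
    using F(3) lift_difference_tangent[OF F(1,2) f'(1,4) _ lift_stratum[OF F(1)] lift_stratum[OF f'(1)]] by blast
  then have "y (b F) - y (b D') \<in> tangent (joined K D' qb)" using tangent_mono[OF F(1,2) J(1,2) sub] by blast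
  then show ?thesis
    unfolding face_volume_facts(1,2)[OF qb D'] by (rule vwedge_project_zero)
qed

text \<open>The order of summation is exchanged: for a fixed tail \<open>Ts\<close> one sums over
  the faces \<open>D'\<close> that can precede it. When \<open>hd Ts\<close> lies in
  \<open>D\<close> these are its facets, and \<open>facets_sum\<close> evaluates the inner
  sum.\<close>

lemma flags_sum:
  assumes qb: "qb \<in> Link K D l" and \<tau>: "\<tau> \<noteq> {}" and r: "r \<le> tdim D"
  shows "(\<Sum>D'\<in>faces r. \<Sum>Fs\<in>{Fs \<in> dual_flags K D' (joined K D qb). b ` set (tl Fs) = \<tau>}.
      flag_sign qb D' Fs * pv_project (csed (carrier_cell K \<tau>))
        (vwedge (y (first_vertex K b \<tau>) - y (b D')) (face_volume qb D')) js) =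
    (\<Sum>D''\<in>faces (Suc r). \<Sum>Ts\<in>{Ts \<in> dual_flags K D'' (joined K D qb). b ` set Ts = \<tau>}.
      flag_sign qb D'' Ts * face_volume qb D'' js)"
proof -
  let ?G = "joined K D qb"
  note G = gens_joined[OF D qb]
  define g where "g = (\<lambda>D' Fs. flag_sign qb D' Fs * pv_project (csed (carrier_cell K \<tau>))
        (vwedge (y (first_vertex K b \<tau>) - y (b D')) (face_volume qb D')) js)"
  \<comment> \<open>\<open>A\<close> collects the possible tails without reference to a head. Those
    outside \<open>B\<close> start with a cell not contained in \<open>D\<close> and contribute
    \<open>0\<close> by \<open>transverse_term_zero\<close>.\<close>
  define A where "A = {Ts. Ts \<noteq> [] \<and> Ts \<in> dual_flags K (hd Ts) ?G \<and> tdim (hd Ts) = Suc r \<and> b ` set Ts = \<tau>}"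
  define B where "B = {Ts \<in> A. hd Ts \<subseteq> D}"
  have finA: "finite A"
  proof (rule finite_subset)
    show "A \<subseteq> (\<Union>F\<in>K. dual_flags K F ?G)"
    proof
      fix Ts assume "Ts \<in> A"
      then have d: "Ts \<noteq> []" "Ts \<in> dual_flags K (hd Ts) ?G" by (simp_all add: A_def)
      then have "hd Ts \<in> K" using hd_in_set[OF d(1)] unfolding dual_flags_def by blast
      then show "Ts \<in> (\<Union>F\<in>K. dual_flags K F ?G)" using d(2) by blast
    qed
  qed (use finite_K finite_dual_flags in blast)
  have finB: "finite B" using finA by (simp add: B_def)
  have finf: "finite (faces n)" for n using finite_K by (simp add: faces_def)
  have hdA: "hd Ts \<in> K" "csed (hd Ts) = {}" "open_flag Ts" "first_vertex K b \<tau> = b (hd Ts)" "hd Ts \<subseteq> ?G"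
    if "Ts \<in> A" for Ts
  proof -
    have d: "Ts \<in> dual_flags K (hd Ts) ?G" "Ts \<noteq> []" "b ` set Ts = \<tau>" using that by (auto simp: A_def)
    show o: "open_flag Ts" using dual_flags_open[OF d(1)] by blast
    show "hd Ts \<in> K" "csed (hd Ts) = {}" using o hd_in_set[OF d(2)] unfolding open_flag_def by blast+
    show "first_vertex K b \<tau> = b (hd Ts)" using open_flag_bary(2)[OF o] d(3) by simp
    have "hd Ts = last Ts \<or> hd Ts \<subset> last Ts"
    proof (cases Ts)
      case (Cons F Us)
      then show ?thesis using o by (cases "Us = []") (auto simp: open_flag_Cons)
    qed (use d in simp)
    then show "hd Ts \<subseteq> ?G" using dual_flags_open(3)[OF d(1)] by auto
  qed
  have inner: "(\<Sum>Fs\<in>{Fs \<in> dual_flags K D' ?G. b ` set (tl Fs) = \<tau>}. g D' Fs) =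
      (\<Sum>Ts\<in>{Ts \<in> B. D' \<subset> hd Ts}. g D' (D' # Ts))" if D': "D' \<in> faces r" for D'
  proof -
    note f' = face_facts[OF D']
    have le: "tdim D' \<le> tdim ?G" using f'(3) r G(6) by simp
    have "{Fs \<in> dual_flags K D' ?G. b ` set (tl Fs) = \<tau>} = (#) D' ` {Ts \<in> A. D' \<subset> hd Ts}"
    proof (intro subset_antisym subsetI)
      fix Fs assume Fs: "Fs \<in> {Fs \<in> dual_flags K D' ?G. b ` set (tl Fs) = \<tau>}"
      then have o: "open_flag Fs" "hd Fs = D'" using dual_flags_open[of Fs D' ?G] by auto
      obtain Ts where Ts: "Fs = D' # Ts" using o by (cases Fs) (auto simp: open_flag_def)
      have "Ts \<noteq> []" using Fs \<tau> by (auto simp: Ts)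
      then have "Ts \<in> {Ts \<in> A. D' \<subset> hd Ts}"
        using Fs dual_flags_Cons[OF f'(1,4) _ le, of Ts] f'(3) by (auto simp: Ts A_def)
      then show "Fs \<in> (#) D' ` {Ts \<in> A. D' \<subset> hd Ts}" using Ts by blast
    next
      fix Fs assume "Fs \<in> (#) D' ` {Ts \<in> A. D' \<subset> hd Ts}"
      then obtain Ts where "Fs = D' # Ts" "Ts \<in> A" "D' \<subset> hd Ts" by blast
      then show "Fs \<in> {Fs \<in> dual_flags K D' ?G. b ` set (tl Fs) = \<tau>}"
        using dual_flags_Cons[OF f'(1,4) _ le, of Ts] f'(3) by (auto simp: A_def)
    qed
    then have "(\<Sum>Fs\<in>{Fs \<in> dual_flags K D' ?G. b ` set (tl Fs) = \<tau>}. g D' Fs) =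
      (\<Sum>Ts\<in>{Ts \<in> A. D' \<subset> hd Ts}. g D' (D' # Ts))"
      by (simp add: sum.reindex)
    also have "\<dots> = (\<Sum>Ts\<in>{Ts \<in> B. D' \<subset> hd Ts}. g D' (D' # Ts))"
    proof (rule sum.mono_neutral_right)
      show "finite {Ts \<in> A. D' \<subset> hd Ts}" using finA by simp
      show "{Ts \<in> B. D' \<subset> hd Ts} \<subseteq> {Ts \<in> A. D' \<subset> hd Ts}" by (auto simp: B_def)
      show "\<forall>Ts\<in>{Ts \<in> A. D' \<subset> hd Ts} - {Ts \<in> B. D' \<subset> hd Ts}. g D' (D' # Ts) = 0"
      proof
        fix Ts assume "Ts \<in> {Ts \<in> A. D' \<subset> hd Ts} - {Ts \<in> B. D' \<subset> hd Ts}"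
        then have Ts: "Ts \<in> A" "D' \<subset> hd Ts" "\<not> hd Ts \<subseteq> D" by (auto simp: B_def)
        note h = hdA[OF Ts(1)]
        have "tdim (hd Ts) = Suc r" using Ts(1) by (simp add: A_def)
        from transverse_term_zero[OF qb D' h(1,2) Ts(2) h(5) this Ts(3)]
        show "g D' (D' # Ts) = 0" by (simp add: g_def h(4))
      qed
    qed
    finally show ?thesis .
  qed
  have hdB: "hd Ts \<in> faces (Suc r)" if "Ts \<in> B" for Ts
    using that hdA(1) by (auto simp: B_def A_def faces_def)
  have "(\<Sum>D'\<in>faces r. \<Sum>Fs\<in>{Fs \<in> dual_flags K D' ?G. b ` set (tl Fs) = \<tau>}. g D' Fs) =
      (\<Sum>D'\<in>faces r. \<Sum>Ts\<in>{Ts \<in> B. D' \<subset> hd Ts}. g D' (D' # Ts))"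
    by (intro sum.cong refl inner)
  also have "\<dots> = (\<Sum>Ts\<in>B. \<Sum>D'\<in>{D' \<in> faces r. D' \<subset> hd Ts}. g D' (D' # Ts))"
    by (rule sum.swap_restrict[OF finf finB])
  also have "\<dots> = (\<Sum>Ts\<in>B. flag_sign qb (hd Ts) Ts * face_volume qb (hd Ts) js)"
  proof (rule sum.cong[OF refl])
    fix Ts assume Ts: "Ts \<in> B"
    then have A: "Ts \<in> A" and ne: "Ts \<noteq> []" by (auto simp: B_def A_def)
    note h = hdA[OF A] and f = face_facts[OF hdB[OF Ts]]
    have "b (hd Ts) \<in> \<tau>" using A ne by (auto simp: A_def)
    moreover have "sed (b (hd Ts)) = {}" using barycentric_coordinates[OF f(1,4,5)] by metis
    \<comment> \<open>A tail starting in \<open>D\<close> keeps a vertex of sedentarity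
      \<open>{}\<close>, so pushing its coefficient to the carrier involves no divisorial
      quotient.\<close>
    ultimately have "csed (carrier_cell K \<tau>) = {}" by (rule csed_carrier_cell)
    then show "(\<Sum>D'\<in>{D' \<in> faces r. D' \<subset> hd Ts}. g D' (D' # Ts)) =
        flag_sign qb (hd Ts) Ts * face_volume qb (hd Ts) js"
      unfolding g_def h(4) using facets_sum[OF qb hdB[OF Ts] ne refl] by simp
  qed
  also have "\<dots> = (\<Sum>D''\<in>faces (Suc r). \<Sum>Ts\<in>{Ts \<in> B. hd Ts = D''}. flag_sign qb (hd Ts) Ts * face_volume qb (hd Ts) js)"
    by (rule sum.group[OF finB finf, symmetric]) (use hdB in auto)
  also have "\<dots> = (\<Sum>D''\<in>faces (Suc r). \<Sum>Ts\<in>{Ts \<in> dual_flags K D'' ?G. b ` set Ts = \<tau>}.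
      flag_sign qb D'' Ts * face_volume qb D'' js)"
  proof (intro sum.cong refl)
    fix D'' assume D'': "D'' \<in> faces (Suc r)"
    show "{Ts \<in> B. hd Ts = D''} = {Ts \<in> dual_flags K D'' ?G. b ` set Ts = \<tau>}"
      using \<tau> face_facts(2,3)[OF D''] by (auto simp: A_def B_def dual_flags_def)
  qed (auto simp: dual_flags_def)
  finally show ?thesis by (simp only: g_def)
qed

lemma finite_bary_simplices: "finite (bary_simplices K b)"
proof (rule finite_subset)
  show "bary_simplices K b \<subseteq> (\<lambda>\<F>. b ` \<F>) ` Pow K" by (auto simp: bary_simplices_def)
qed (use finite_K in simp)

lemma eigenwave_cap_shifted:
  assumes r: "r \<le> tdim D"
  shows "eigenwave_cap K b y (shifted_chain K b D ds l \<rho> r) = shifted_chain K b D ds l \<rho> (Suc r)"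
proof (intro ext)
  fix \<tau> js
  show "eigenwave_cap K b y (shifted_chain K b D ds l \<rho> r) \<tau> js = shifted_chain K b D ds l \<rho> (Suc r) \<tau> js"
  proof (cases "\<tau> = {}")
    case True
    \<comment> \<open>The cap product is \<open>0\<close> at the empty set by convention. The
      shifted chain agrees, because flags are nonempty.\<close>
    have "{Fs \<in> dual_flags K D' G. b ` set Fs = \<tau>} = {}" for D' G
      using True dual_flags_open(1) by (auto simp: open_flag_def)
    then have "shifted_chain K b D ds l \<rho> (Suc r) \<tau> js = 0"
      unfolding shifted_chain_eq by (simp only: sum.empty sum.neutral_const)
    then show ?thesis using True by (simp add: eigenwave_cap_def)
  next
    case False
    define S where "S = {\<sigma> \<in> bary_simplices K b. \<sigma> - {first_vertex K b \<sigma>} = \<tau>}"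
    define P where "P = (\<lambda>x \<beta>. pv_project (csed (carrier_cell K \<tau>)) (vwedge (y (first_vertex K b \<tau>) - y x) \<beta>) js)"
    have finS: "finite S" using finite_bary_simplices by (simp add: S_def)
    have P_sum: "P x (\<lambda>js. \<Sum>a\<in>A. f a js) = (\<Sum>a\<in>A. P x (f a))" for x and A :: "'c set" and f
      unfolding P_def by (rule pv_project_vwedge_sum)
    have P_scale: "P x (\<lambda>js. t * \<beta> js) = t * P x \<beta>" for x t \<beta>
      unfolding P_def by (rule pv_project_vwedge_scale)
    \<comment> \<open>Each flag has a single image, and that image has opposite face
      \<open>\<tau>\<close> exactly when the tail of the flag maps onto \<open>\<tau>\<close>.
      Grouping flags by their images therefore removes the sum over simplices.\<close>
    have flags: "(\<Sum>\<sigma>\<in>S. \<Sum>Fs\<in>{Fs \<in> dual_flags K D' (joined K D qb). b ` set Fs = \<sigma>}.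
          real_of_rat (\<rho> qb) * flag_sign qb D' Fs * P (first_vertex K b \<sigma>) (face_volume qb D')) =
        real_of_rat (\<rho> qb) * (\<Sum>Fs\<in>{Fs \<in> dual_flags K D' (joined K D qb). b ` set (tl Fs) = \<tau>}.
          flag_sign qb D' Fs * P (b D') (face_volume qb D'))" for qb D'
    proof -
      let ?DF = "dual_flags K D' (joined K D qb)"
      have fl: "first_vertex K b (b ` set Fs) = b D'" "b ` set Fs \<in> S \<longleftrightarrow> b ` set (tl Fs) = \<tau>"
        if "Fs \<in> ?DF" for Fs
        using open_flag_bary[OF dual_flags_open(1)[OF that]] dual_flags_open(2)[OF that]
        by (auto simp: S_def)
      have "(\<Sum>\<sigma>\<in>S. \<Sum>Fs\<in>{Fs \<in> ?DF. b ` set Fs = \<sigma>}.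
          real_of_rat (\<rho> qb) * flag_sign qb D' Fs * P (first_vertex K b \<sigma>) (face_volume qb D')) =
        (\<Sum>\<sigma>\<in>S. \<Sum>Fs\<in>{Fs \<in> {Fs \<in> ?DF. b ` set (tl Fs) = \<tau>}. b ` set Fs = \<sigma>}.
          real_of_rat (\<rho> qb) * flag_sign qb D' Fs * P (b D') (face_volume qb D'))"
        using fl by (intro sum.cong) auto
      also have "\<dots> = (\<Sum>Fs\<in>{Fs \<in> ?DF. b ` set (tl Fs) = \<tau>}.
          real_of_rat (\<rho> qb) * flag_sign qb D' Fs * P (b D') (face_volume qb D'))"
        using finite_dual_flags finS fl(2) by (intro sum.group) auto
      finally show ?thesis by (simp add: sum_distrib_left mult.assoc)
    qed
    have "eigenwave_cap K b y (shifted_chain K b D ds l \<rho> r) \<tau> js =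
        (\<Sum>\<sigma>\<in>S. P (first_vertex K b \<sigma>) (shifted_chain K b D ds l \<rho> r \<sigma>))"
      using False by (simp add: eigenwave_cap_def S_def P_def)
    also have "\<dots> = (\<Sum>\<sigma>\<in>S. \<Sum>qb\<in>Link K D l. \<Sum>D'\<in>faces r.
        \<Sum>Fs\<in>{Fs \<in> dual_flags K D' (joined K D qb). b ` set Fs = \<sigma>}.
          real_of_rat (\<rho> qb) * flag_sign qb D' Fs * P (first_vertex K b \<sigma>) (face_volume qb D'))"
      unfolding shifted_chain_eq P_sum P_scale ..
    also have "\<dots> = (\<Sum>qb\<in>Link K D l. \<Sum>D'\<in>faces r. \<Sum>\<sigma>\<in>S.
        \<Sum>Fs\<in>{Fs \<in> dual_flags K D' (joined K D qb). b ` set Fs = \<sigma>}.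
          real_of_rat (\<rho> qb) * flag_sign qb D' Fs * P (first_vertex K b \<sigma>) (face_volume qb D'))"
      by (subst sum.swap, intro sum.cong refl sum.swap)
    also have "\<dots> = (\<Sum>qb\<in>Link K D l. real_of_rat (\<rho> qb) * (\<Sum>D'\<in>faces r.
        \<Sum>Fs\<in>{Fs \<in> dual_flags K D' (joined K D qb). b ` set (tl Fs) = \<tau>}.
          flag_sign qb D' Fs * P (b D') (face_volume qb D')))"
      unfolding flags sum_distrib_left ..
    also have "\<dots> = (\<Sum>qb\<in>Link K D l. real_of_rat (\<rho> qb) * (\<Sum>D''\<in>faces (Suc r).
        \<Sum>Ts\<in>{Ts \<in> dual_flags K D'' (joined K D qb). b ` set Ts = \<tau>}.
          flag_sign qb D'' Ts * face_volume qb D'' js))"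
      unfolding P_def by (intro sum.cong refl arg_cong2[of _ _ _ _ "(*)"] flags_sum False r)
    also have "\<dots> = shifted_chain K b D ds l \<rho> (Suc r) \<tau> js"
      unfolding shifted_chain_eq by (simp add: sum_distrib_left mult.assoc)
    finally show ?thesis .
  qed
qed

lemma shifted_chain_beyond: "shifted_chain K b D ds l \<rho> (Suc (tdim D)) = (\<lambda>\<sigma> js. 0)"
proof -
  have "faces (Suc (tdim D)) = {}"
  proof (rule ccontr)
    assume "faces (Suc (tdim D)) \<noteq> {}"
    then obtain D' where D': "D' \<in> faces (Suc (tdim D))" by blast
    note f = face_facts[OF D'] and g = gens_simplex_face[OF D D(1) subset_refl]
    have "card (vertices_of K D') \<le> card (vertices_of K D)" using card_mono[OF g(3) f(8)] .
    then show False using f(9) g(6) by simp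
  qed
  then show ?thesis by (simp add: fun_eq_iff shifted_chain_eq)
qed

end

theorem proposition7p6:
  fixes X :: "(ereal ^ 'n::finite) set"
    and K :: "(ereal ^ 'n) set set"
    and b :: "(ereal ^ 'n) set \<Rightarrow> ereal ^ 'n"
    and y :: "ereal ^ 'n \<Rightarrow> real ^ 'n"
    and D :: "(ereal ^ 'n) set"
    and ds :: "(ereal ^ 'n) list"
    and c :: "'n generator set \<Rightarrow> rat"
    and k l r :: nat
  assumes "projective_tropical_space X" and "smooth_tropical_space X"
    and "tropical_limit_of_family X"
    and "unimodular_triangulation K X"
    and "barycenters K b"
    and "eigenwave_lift K b y"
    and "D \<in> K" and "finite_face K D" and "csed D = {}" and "tdim D = k"
    and "distinct ds" and "set ds = vertices_of K D"
    and "c \<in> propellers K D l"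
    and "r \<le> k"
  shows "shifted_chain K b D ds l c r \<in> bary_chains K b (k + l - r) (l + r) \<and>
    eigenwave_cap K b y (shifted_chain K b D ds l c r) =
      (if r = k then (\<lambda>\<sigma> js. 0) else shifted_chain K b D ds l c (r + 1))"
proof -
  interpret propeller_simplex K b y D ds l
    using assms(4-9,11,12) by unfold_locales (auto simp: unimodular_triangulation_def)
  have r: "r \<le> tdim D" using assms(10,14) by simp
  show ?thesis
    using shifted_chain_in_chains[OF r, of c] eigenwave_cap_shifted[OF r, of c]
      shifted_chain_beyond[of c] assms(10) by auto
qed

end
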